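(* Let $G$ be a simply connected, $2$-step nilpotent Lie group equipped with a left-invariant sub-Riemannian metric $d$. Denote by $d_\infty$ the canonical asymptotic metric of $(G,d)$. Then there exists $C>0$ such that $$\lvert d_\infty(p,q)^2-d(p,q)^2\rvert\le C\quad\text{for every }p,q\in G.$$ In particular, $$\lvert d_\infty(p,q)-d(p,q)\rvert=O\left(\frac{1}{d(p,q)}\right)\to 0\quad\text{as }d(p,q)\to\infty.$$
   Context: Let $G$ be a connected Lie group with identity $e$ and Lie algebra $\mathfrak g=T_eG$; $L_p$ denotes left translation by $p$. The group is $2$-step nilpotent if its nilpotency step is $2$, i.e. $[\mathfrak g,[\mathfrak g,\mathfrak g]]=0$ and $[\mathfrak g,\mathfrak g]\neq 0$. A sub-Riemannian structure $(\Delta,\rho)$ on $G$ consists of a left-invariant subbundle $\Delta\subseteq TG$ that is bracket-generating (the Lie algebra generated by $\Delta_e$ is $\mathfrak g$) and a left-invariant metric tensor $\rho$ on $\Delta$ (the left-invariant extension of an inner product $\rho_e$ on $\Delta_e$). The case $\Delta=TG$ (Riemannian) is included. An absolutely continuous curve $\gamma:[0,1]\to G$ is $\Delta$-horizontal if $\dot\gamma(t)\in\Delta_{\gamma(t)}$ for a.e. $t$; its length is $\ell(\gamma)=\int_0^1\sqrt{\rho(\dot\gamma(t),\dot\gamma(t))}\,dt$. The associated (left-invariant) sub-Riemannian metric is $d(p,q)=\inf\{\ell(\gamma): \gamma \text{ is } \Delta\text{-horizontal},\ p,q\in\gamma([0,1])\}$. Canonical asymptotic metric: given $(\Delta,\rho)$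 with metric $d$, let $V=\{v\in\Delta_e: \rho(v,w)=0 \text{ for every } w\in\Delta_e\cap[\mathfrak g,\mathfrak g]\}$ and $\Delta_\infty=\bigcup_{p\in G}dL_p(V)\subseteq\Delta$. Then $d_\infty(p,q)=\inf\{\ell(\gamma):\gamma:[0,1]\to G\text{ is }\Delta_\infty\text{-horizontal},\ p,q\in\gamma([0,1])\}$. *)

theory Defs
  imports "HOL-Analysis.Analysis" "HOL-Library.Landau_Symbols"
begin

section \<open>Smooth manifolds given by an atlas\<close>

text \<open>Only meant for open \<open>S\<close>. The continuity demanded at level \<open>0\<close> for all iterated
  directional derivatives makes this the usual notion of being \<open>n\<close> times continuously
  differentiable.\<close>

primrec C_k_on :: "nat \<Rightarrow> 'a::real_normed_vector set \<Rightarrow> ('a \<Rightarrow> 'b::real_normed_vector) \<Rightarrow> bool" where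
  "C_k_on 0 S f \<longleftrightarrow> continuous_on S f"
| "C_k_on (Suc n) S f \<longleftrightarrow>
     (\<forall>x\<in>S. f differentiable (at x)) \<and> (\<forall>v. C_k_on n S (\<lambda>x. frechet_derivative f (at x) v))"

definition smooth_on :: "'a::real_normed_vector set \<Rightarrow> ('a \<Rightarrow> 'b::real_normed_vector) \<Rightarrow> bool" where
  "smooth_on S f \<longleftrightarrow> (\<forall>n. C_k_on n S f)"

type_synonym ('m, 'e) chart = "'m set \<times> ('m \<Rightarrow> 'e)"

definition smooth_atlas :: "('m::topological_space, 'e::euclidean_space) chart set \<Rightarrow> bool" where
  "smooth_atlas A \<longleftrightarrow>
     (\<Union>(U, \<phi>)\<in>A. U) = UNIV \<and>
     (\<forall>(U, \<phi>)\<in>A. open U \<and> open (\<phi> ` U) \<and> homeomorphism U (\<phi> ` U) \<phi> (inv_into U \<phi>)) \<and>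
     (\<forall>(U, \<phi>)\<in>A. \<forall>(V, \<psi>)\<in>A. smooth_on (\<phi> ` (U \<inter> V)) (\<psi> \<circ> inv_into U \<phi>))"

definition smooth_map :: "('m::topological_space, 'e::euclidean_space) chart set \<Rightarrow>
    ('n::topological_space, 'f::euclidean_space) chart set \<Rightarrow> ('m \<Rightarrow> 'n) \<Rightarrow> bool" where
  "smooth_map A B f \<longleftrightarrow>
     continuous_on UNIV f \<and>
     (\<forall>(U, \<phi>)\<in>A. \<forall>(V, \<psi>)\<in>B. smooth_on (\<phi> ` (U \<inter> f -` V)) (\<psi> \<circ> f \<circ> inv_into U \<phi>))"

definition prod_atlas :: "('m, 'e) chart set \<Rightarrow> ('n, 'f) chart set \<Rightarrow> ('m \<times> 'n, 'e \<times> 'f) chart set" where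
  "prod_atlas A B = (\<lambda>((U, \<phi>), (V, \<psi>)). (U \<times> V, map_prod \<phi> \<psi>)) ` (A \<times> B)"

text \<open>The tangent space at \<open>p\<close> is the model space \<open>'e\<close>, where \<open>v :: 'e\<close> stands for the tangent
  vector whose coordinates in one fixed preferred chart around \<open>p\<close> are \<open>v\<close>. Tangent
  vectors at different points are in general expressed in different charts.\<close>

definition pref_chart :: "('m, 'e) chart set \<Rightarrow> 'm \<Rightarrow> ('m, 'e) chart" where
  "pref_chart A p = (SOME c. c \<in> A \<and> p \<in> fst c)"

abbreviation chart_at :: "('m, 'e) chart set \<Rightarrow> 'm \<Rightarrow> 'm \<Rightarrow> 'e" where
  "chart_at A p \<equiv> snd (pref_chart A p)"

definition chart_inv :: "('m, 'e) chart set \<Rightarrow> 'm \<Rightarrow> 'e \<Rightarrow> 'm" where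
  "chart_inv A p = inv_into (fst (pref_chart A p)) (chart_at A p)"

definition mderiv :: "('m, 'e::euclidean_space) chart set \<Rightarrow> ('n, 'f::euclidean_space) chart set \<Rightarrow>
    ('m \<Rightarrow> 'n) \<Rightarrow> 'm \<Rightarrow> 'e \<Rightarrow> 'f" where
  "mderiv A B f p =
     frechet_derivative (chart_at B (f p) \<circ> f \<circ> chart_inv A p) (at (chart_at A p p))"

text \<open>A vector field is a function \<open>X\<close> with \<open>X p\<close> in the tangent space at \<open>p\<close>;
  \<open>vf_coord A p X\<close> is its coordinate expression in the preferred chart at \<open>p\<close>, and the
  bracket is computed in that chart as \<open>[X, Y] = DY X - DX Y\<close>.\<close>

definition vf_coord :: "('m, 'e::euclidean_space) chart set \<Rightarrow> 'm \<Rightarrow> ('m \<Rightarrow> 'e) \<Rightarrow> 'e \<Rightarrow> 'e" where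
  "vf_coord A p X x =
     (let q = chart_inv A p x
      in frechet_derivative (chart_at A p \<circ> chart_inv A q) (at (chart_at A q q)) (X q))"

definition vf_bracket :: "('m, 'e::euclidean_space) chart set \<Rightarrow> ('m \<Rightarrow> 'e) \<Rightarrow> ('m \<Rightarrow> 'e) \<Rightarrow> 'm \<Rightarrow> 'e" where
  "vf_bracket A X Y p =
     frechet_derivative (vf_coord A p Y) (at (chart_at A p p)) (X p) -
     frechet_derivative (vf_coord A p X) (at (chart_at A p p)) (Y p)"

section \<open>Lie groups\<close>

text \<open>The group operation is written additively, but \<open>group_add\<close> does not include
  commutativity. The identity \<open>e\<close> is \<open>0\<close> and left translation is \<open>L_p q = p + q\<close>.\<close>

definition lie_group ::
    "('g::{group_add, t2_space, second_countable_topology}, 'e::euclidean_space) chart set \<Rightarrow> bool" where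
  "lie_group A \<longleftrightarrow>
     smooth_atlas A \<and>
     smooth_map (prod_atlas A A) A (\<lambda>(p, q). p + q) \<and>
     smooth_map A A uminus"

definition d_left :: "('g::group_add, 'e::euclidean_space) chart set \<Rightarrow> 'g \<Rightarrow> 'g \<Rightarrow> 'e \<Rightarrow> 'e" where
  "d_left A p q = mderiv A A (\<lambda>x. p + x) q"

definition left_inv_field :: "('g::group_add, 'e::euclidean_space) chart set \<Rightarrow> 'e \<Rightarrow> 'g \<Rightarrow> 'e" where
  "left_inv_field A v p = d_left A p 0 v"

definition lie_bracket :: "('g::group_add, 'e::euclidean_space) chart set \<Rightarrow> 'e \<Rightarrow> 'e \<Rightarrow> 'e" where
  "lie_bracket A v w = vf_bracket A (left_inv_field A v) (left_inv_field A w) 0"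

definition bracket_space :: "('g::group_add, 'e::euclidean_space) chart set \<Rightarrow> 'e set \<Rightarrow> 'e set \<Rightarrow> 'e set" where
  "bracket_space A S T = span {lie_bracket A v w |v w. v \<in> S \<and> w \<in> T}"

abbreviation derived_algebra :: "('g::group_add, 'e::euclidean_space) chart set \<Rightarrow> 'e set" where
  "derived_algebra A \<equiv> bracket_space A UNIV UNIV"

definition two_step_nilpotent :: "('g::group_add, 'e::euclidean_space) chart set \<Rightarrow> bool" where
  "two_step_nilpotent A \<longleftrightarrow>
     bracket_space A UNIV (derived_algebra A) = {0} \<and> derived_algebra A \<noteq> {0}"

definition lie_generated :: "('g::group_add, 'e::euclidean_space) chart set \<Rightarrow> 'e set \<Rightarrow> 'e set" where
  "lie_generated A S =
     \<Inter>{T. subspace T \<and> S \<subseteq> T \<and> (\<forall>v\<in>T. \<forall>w\<in>T. lie_bracket A v w \<in> T)}"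

section \<open>Sub-Riemannian structures\<close>

definition inner_product_on :: "'e::real_vector set \<Rightarrow> ('e \<Rightarrow> 'e \<Rightarrow> real) \<Rightarrow> bool" where
  "inner_product_on S b \<longleftrightarrow>
     (\<forall>u\<in>S. \<forall>v\<in>S. b u v = b v u) \<and>
     (\<forall>u\<in>S. \<forall>v\<in>S. \<forall>w\<in>S. b (u + v) w = b u w + b v w) \<and>
     (\<forall>r. \<forall>u\<in>S. \<forall>v\<in>S. b (r *\<^sub>R u) v = r * b u v) \<and>
     (\<forall>u\<in>S. u \<noteq> 0 \<longrightarrow> b u u > 0)"

text \<open>\<open>\<Delta> p\<close> is the fibre at \<open>p\<close>, and \<open>\<rho> p\<close> is only relevant on \<open>\<Delta> p\<close>. Left-invariance
  makes both smooth, so smoothness is not required separately.\<close>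

definition sub_riemannian_structure :: "('g::group_add, 'e::euclidean_space) chart set \<Rightarrow>
    ('g \<Rightarrow> 'e set) \<Rightarrow> ('g \<Rightarrow> 'e \<Rightarrow> 'e \<Rightarrow> real) \<Rightarrow> bool" where
  "sub_riemannian_structure A \<Delta> \<rho> \<longleftrightarrow>
     (\<forall>p. subspace (\<Delta> p)) \<and>
     (\<forall>p q. \<Delta> (p + q) = d_left A p q ` \<Delta> q) \<and>
     lie_generated A (\<Delta> 0) = UNIV \<and>
     (\<forall>p. inner_product_on (\<Delta> p) (\<rho> p)) \<and>
     (\<forall>p q. \<forall>v\<in>\<Delta> q. \<forall>w\<in>\<Delta> q. \<rho> (p + q) (d_left A p q v) (d_left A p q w) = \<rho> q v w)"

definition abs_cont_on :: "real \<Rightarrow> real \<Rightarrow> (real \<Rightarrow> 'a::real_normed_vector) \<Rightarrow> bool" where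
  "abs_cont_on a b f \<longleftrightarrow>
     (\<forall>\<epsilon>>0. \<exists>\<delta>>0. \<forall>\<D>. \<D> division_of (\<Union>\<D>) \<and> \<Union>\<D> \<subseteq> {a..b} \<and> (\<Sum>I\<in>\<D>. Sup I - Inf I) < \<delta>
        \<longrightarrow> (\<Sum>I\<in>\<D>. norm (f (Sup I) - f (Inf I))) < \<epsilon>)"

definition abs_cont_curve :: "('m::topological_space, 'e::euclidean_space) chart set \<Rightarrow> (real \<Rightarrow> 'm) \<Rightarrow> bool" where
  "abs_cont_curve A \<gamma> \<longleftrightarrow>
     continuous_on {0..1} \<gamma> \<and>
     (\<forall>(U, \<phi>)\<in>A. \<forall>a b. 0 \<le> a \<and> a \<le> b \<and> b \<le> 1 \<and> \<gamma> ` {a..b} \<subseteq> U \<longrightarrow> abs_cont_on a b (\<phi> \<circ> \<gamma>))"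

definition velocity :: "('m, 'e::euclidean_space) chart set \<Rightarrow> (real \<Rightarrow> 'm) \<Rightarrow> real \<Rightarrow> 'e" where
  "velocity A \<gamma> t = vector_derivative (chart_at A (\<gamma> t) \<circ> \<gamma>) (at t within {0..1})"

definition horizontal :: "('m::topological_space, 'e::euclidean_space) chart set \<Rightarrow> ('m \<Rightarrow> 'e set) \<Rightarrow>
    (real \<Rightarrow> 'm) \<Rightarrow> bool" where
  "horizontal A \<Delta> \<gamma> \<longleftrightarrow>
     abs_cont_curve A \<gamma> \<and>
     (AE t in lebesgue_on {0..1}.
        (chart_at A (\<gamma> t) \<circ> \<gamma>) differentiable (at t within {0..1}) \<and> velocity A \<gamma> t \<in> \<Delta> (\<gamma> t))"

definition curve_length :: "('m, 'e::euclidean_space) chart set \<Rightarrow> ('m \<Rightarrow> 'e \<Rightarrow> 'e \<Rightarrow> real) \<Rightarrow>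
    (real \<Rightarrow> 'm) \<Rightarrow> real" where
  "curve_length A \<rho> \<gamma> = integral {0..1} (\<lambda>t. sqrt (\<rho> (\<gamma> t) (velocity A \<gamma> t) (velocity A \<gamma> t)))"

text \<open>The infimum is a real number, which is meaningful when some horizontal curve passes
  through both points; for bracket-generating \<open>\<Delta>\<close> on a connected group this is always so
  (Chow's theorem).\<close>

definition sr_dist :: "('m::topological_space, 'e::euclidean_space) chart set \<Rightarrow> ('m \<Rightarrow> 'e set) \<Rightarrow>
    ('m \<Rightarrow> 'e \<Rightarrow> 'e \<Rightarrow> real) \<Rightarrow> 'm \<Rightarrow> 'm \<Rightarrow> real" where
  "sr_dist A \<Delta> \<rho> p q =
     Inf {curve_length A \<rho> \<gamma> |\<gamma>. horizontal A \<Delta> \<gamma> \<and> p \<in> \<gamma> ` {0..1} \<and> q \<in> \<gamma> ` {0..1}}"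

definition asymptotic_space :: "('g::group_add, 'e::euclidean_space) chart set \<Rightarrow> ('g \<Rightarrow> 'e set) \<Rightarrow>
    ('g \<Rightarrow> 'e \<Rightarrow> 'e \<Rightarrow> real) \<Rightarrow> 'e set" where
  "asymptotic_space A \<Delta> \<rho> = {v \<in> \<Delta> 0. \<forall>w \<in> \<Delta> 0 \<inter> derived_algebra A. \<rho> 0 v w = 0}"

definition asymptotic_bundle :: "('g::group_add, 'e::euclidean_space) chart set \<Rightarrow> ('g \<Rightarrow> 'e set) \<Rightarrow>
    ('g \<Rightarrow> 'e \<Rightarrow> 'e \<Rightarrow> real) \<Rightarrow> 'g \<Rightarrow> 'e set" where
  "asymptotic_bundle A \<Delta> \<rho> p = d_left A p 0 ` asymptotic_space A \<Delta> \<rho>"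

definition asymptotic_dist :: "('g::{group_add, topological_space}, 'e::euclidean_space) chart set \<Rightarrow>
    ('g \<Rightarrow> 'e set) \<Rightarrow> ('g \<Rightarrow> 'e \<Rightarrow> 'e \<Rightarrow> real) \<Rightarrow> 'g \<Rightarrow> 'g \<Rightarrow> real" where
  "asymptotic_dist A \<Delta> \<rho> = sr_dist A (asymptotic_bundle A \<Delta> \<rho>) \<rho>"

end

theory Submission
  imports Defs
begin

text \<open>The inequality \<open>d \<le> d_inf\<close> holds because \<open>d_inf\<close> is an infimum over fewer curves. For the other direction
a curve is described by its control \<open>u\<close>: the velocity at time \<open>t\<close>, translated back to the identity. Let
\<open>D\<close> be the fibre of the distribution at the identity, \<open>Z\<close> the derived algebra, which is central, and \<open>V\<close>
the orthogonal complement of \<open>D \<inter> Z\<close> in \<open>D\<close>, so that \<open>u = a + b\<close> with \<open>a\<close> in \<open>V\<close> and \<open>b\<close> in \<open>D \<inter> Z\<close>.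

The group enters through one construction. Multiplying a curve on the right by an integral curve of the
left-invariant field \<open>X\<close>, run to the parameter \<open>x t\<close>, turns the control \<open>u\<close> into \<open>u - x [X, u] + x' X\<close>, because
the second bracket with \<open>X\<close> vanishes (\<open>control_perturbation\<close>). If \<open>x\<close> vanishes at both ends then the end
points of the curve stay. All new curves arise in this way, from short integral curves of
fixed fields; the scalar functions \<open>x\<close> are indefinite integrals, whence the theory of absolutely continuous
functions and Lebesgue's differentiation theorem.

For \<open>X\<close> in \<open>Z\<close> the construction says that a control may be changed by any \<open>Z\<close>-valued function with
integral zero (\<open>add_central\<close>). Hence \<open>u\<close> may be replaced by \<open>a + k\<close>, where \<open>k\<close> is the integral of \<open>b\<close>, and it remains
to remove the constant \<open>k\<close> while keeping \<open>a\<close> in \<open>V\<close>. Adding to \<open>a\<close> a loop in the directions \<open>X\<close>, \<open>Y\<close> of \<open>V\<close> that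
encloses the area \<open>c\<close> changes \<open>k\<close> by \<open>c [X, Y]\<close>, and such brackets span \<open>Z\<close>. The cost is measured by the
energy \<open>W \<integral>\<bar>a\<bar>\<^sup>2 / w\<close>, where \<open>w\<close> is the speed of the given curve and \<open>W\<close> its integral; by the Cauchy-Schwarz
inequality it bounds the square of the length of the new curve. The loop alone costs a multiple of \<open>c\<close>, but there are also cross
terms with \<open>a\<close>, linear in the loop. There are finitely many of them, so a suitable linear
combination of sufficiently many disjoint small loops makes them vanish (\<open>cancel_positive_multiple_of_bracket\<close>).
Altogether removing \<open>k\<close> costs at most \<open>K \<bar>k\<bar>\<close>. On the other hand, dropping \<open>b\<close> has lowered the energy from
\<open>W\<^sup>2\<close> by at least \<open>\<kappa> \<bar>k\<bar>\<^sup>2\<close>. The quadratic gain outweighs the linear cost up to the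
constant \<open>K\<^sup>2 / (4 \<kappa>)\<close>, which bounds \<open>d_inf\<^sup>2 - d\<^sup>2\<close> (\<open>replace_control\<close>).\<close>

section \<open>Lebesgue's differentiation theorem on the line\<close>

text \<open>By Henstock's lemma the Riemann sums over disjoint, sufficiently fine intervals err by little in total.
Vitali's covering lemma selects, among the intervals on which the difference quotient fails by \<open>k\<close>, disjoint ones whose
fivefold enlargements still cover; their total length is therefore small.\<close>

lemma negligible_small_difference_quotient_failure:
  fixes f :: "real \<Rightarrow> 'a::euclidean_space"
  assumes f: "f integrable_on {a..b}" and k: "0 < k"
  defines "E \<equiv> {t\<in>{a..b}. \<forall>\<delta>>0. \<exists>s\<in>{a..b}. s \<noteq> t \<and> \<bar>s - t\<bar> < \<delta> \<and>
     k * \<bar>s - t\<bar> < norm (integral {a..s} f - integral {a..t} f - (s - t) *\<^sub>R f t)}"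
  shows "negligible E"
  unfolding negligible_outer_le
proof (intro allI impI)
  fix e :: real assume "0 < e"
  define e' where "e' = e * k / 10"
  have e': "0 < e'" using \<open>0 < e\<close> k by (simp add: e'_def)
  obtain \<gamma> where \<gamma>: "gauge \<gamma>" and H: "\<And>p. \<lbrakk>p tagged_partial_division_of cbox a b; \<gamma> fine p\<rbrakk> \<Longrightarrow>
      (\<Sum>(x,K)\<in>p. norm (measure lborel K *\<^sub>R f x - integral K f)) < e'"
    using Henstock_lemma[of f a b e'] f e' by (auto simp: cbox_interval)
  have "\<exists>s. s \<in> {a..b} \<and> s \<noteq> t \<and> cball t \<bar>s - t\<bar> \<subseteq> \<gamma> t \<and>
      k * \<bar>s - t\<bar> < norm (integral {a..s} f - integral {a..t} f - (s - t) *\<^sub>R f t)" if "t \<in> E" for t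
  proof -
    obtain \<delta> where \<delta>: "\<delta> > 0" "ball t \<delta> \<subseteq> \<gamma> t"
      using \<gamma> by (meson gauge_def open_contains_ball)
    obtain s where "s \<in> {a..b}" "s \<noteq> t" "\<bar>s - t\<bar> < \<delta>"
      "k * \<bar>s - t\<bar> < norm (integral {a..s} f - integral {a..t} f - (s - t) *\<^sub>R f t)"
      using \<open>t \<in> E\<close> \<delta>(1) unfolding E_def by auto
    moreover have "cball t \<bar>s - t\<bar> \<subseteq> ball t \<delta>" using \<open>\<bar>s - t\<bar> < \<delta>\<close> by auto
    ultimately show ?thesis using \<delta>(2) by blast
  qed
  then obtain s where s: "\<And>t. t \<in> E \<Longrightarrow> s t \<in> {a..b}" "\<And>t. t \<in> E \<Longrightarrow> s t \<noteq> t"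
    "\<And>t. t \<in> E \<Longrightarrow> cball t \<bar>s t - t\<bar> \<subseteq> \<gamma> t"
    "\<And>t. t \<in> E \<Longrightarrow> k * \<bar>s t - t\<bar> < norm (integral {a..s t} f - integral {a..t} f - (s t - t) *\<^sub>R f t)"
    by metis
  define r where "r t = \<bar>s t - t\<bar>" for t
  have E: "t \<in> {a..b}" if "t \<in> E" for t using that by (simp add: E_def)
  have r: "0 < r t \<and> r t \<le> b - a" if "t \<in> E" for t
    using s(1,2)[OF that] E[OF that] by (auto simp: r_def)
  have cov: "E \<subseteq> (\<Union>i\<in>E. cball i (r i))"
  proof
    fix x assume "x \<in> E"
    then have "x \<in> cball x (r x)" using r[of x] by (simp add: less_imp_le)
    with \<open>x \<in> E\<close> show "x \<in> (\<Union>i\<in>E. cball i (r i))" by blast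
  qed
  obtain C where C: "countable C" "C \<subseteq> E"
     "pairwise (\<lambda>i j. disjnt (cball i (r i)) (cball j (r j))) C"
     "E \<subseteq> (\<Union>i\<in>C. cball i (5 * r i))"
    using Vitali_covering_lemma_cballs[OF cov r] by blast
  have fin: "measure lebesgue (\<Union>i\<in>F. cball i (5 * r i)) \<le> e" if F: "F \<subseteq> C" "finite F" for F
  proof -
    define S where "S t = {min t (s t)..max t (s t)}" for t
    have S: "S t \<subseteq> cball t (r t)" for t by (auto simp: S_def r_def dist_real_def)
    have FE: "t \<in> E" if "t \<in> F" for t using that F C by auto
    have cS: "measure lborel (S t) = r t" for t by (auto simp: S_def r_def)
    have SI: "norm (measure lborel (S t) *\<^sub>R f t - integral (S t) f) =
       norm (integral {a..s t} f - integral {a..t} f - (s t - t) *\<^sub>R f t)" if "t \<in> E" for t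
    proof (cases "t \<le> s t")
      case True
      have "integral {a..t} f + integral {t..s t} f = integral {a..s t} f"
        by (rule Henstock_Kurzweil_Integration.integral_combine)
          (use True E[OF that] s(1)[OF that] in \<open>auto intro: integrable_on_subinterval[OF f]\<close>)
      then have "integral (S t) f = integral {a..s t} f - integral {a..t} f"
        using True by (simp add: S_def algebra_simps)
      moreover have "measure lborel (S t) = s t - t" using True by (simp add: cS r_def)
      ultimately show ?thesis by (simp only:) (rule norm_minus_commute)
    next
      case False
      have "integral {a..s t} f + integral {s t..t} f = integral {a..t} f"
        by (rule Henstock_Kurzweil_Integration.integral_combine)
          (use False E[OF that] s(1)[OF that] in \<open>auto intro: integrable_on_subinterval[OF f]\<close>)
      then have "integral (S t) f = integral {a..t} f - integral {a..s t} f"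
        using False by (simp add: S_def algebra_simps)
      moreover have "measure lborel (S t) = t - s t" using False by (simp add: cS r_def)
      ultimately show ?thesis by (simp only:) (simp add: algebra_simps)
    qed
    let ?p = "(\<lambda>t. (t, S t)) ` F"
    have inj: "inj_on (\<lambda>t. (t, S t)) F" by (auto simp: inj_on_def)
    have "?p tagged_partial_division_of cbox a b"
      unfolding tagged_partial_division_of_def
    proof (intro conjI allI impI)
      fix x K assume "(x, K) \<in> ?p"
      then have "x \<in> E" "K = S x" using FE by auto
      then show "x \<in> K" "K \<subseteq> cbox a b" "\<exists>a b. K = cbox a b"
        using E[of x] s(1)[of x] by (auto simp: S_def)
    next
      fix x1 K1 x2 K2 assume *: "(x1, K1) \<in> ?p \<and> (x2, K2) \<in> ?p \<and> (x1, K1) \<noteq> (x2, K2)"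
      then have "x1 \<in> C" "x2 \<in> C" "x1 \<noteq> x2" using F by auto
      then have "disjnt (cball x1 (r x1)) (cball x2 (r x2))"
        using C(3) by (auto simp: pairwise_def)
      moreover have "K1 = S x1" "K2 = S x2" using * by auto
      ultimately have "K1 \<inter> K2 = {}" using S[of x1] S[of x2] by (auto simp: disjnt_def)
      then show "interior K1 \<inter> interior K2 = {}" using interior_subset by blast
    qed (use F in auto)
    moreover have "\<gamma> fine ?p"
      using s(3) S FE by (fastforce simp: fine_def r_def)
    ultimately have "(\<Sum>(x,K)\<in>?p. norm (measure lborel K *\<^sub>R f x - integral K f)) < e'" by (rule H)
    then have "(\<Sum>t\<in>F. norm (measure lborel (S t) *\<^sub>R f t - integral (S t) f)) < e'"
      by (simp add: sum.reindex[OF inj])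
    moreover have "(\<Sum>t\<in>F. k * r t) \<le> (\<Sum>t\<in>F. norm (measure lborel (S t) *\<^sub>R f t - integral (S t) f))"
      by (rule sum_mono) (use s(4) FE in \<open>auto simp: SI r_def intro: less_imp_le\<close>)
    ultimately have *: "k * (\<Sum>t\<in>F. r t) \<le> e'" by (simp add: sum_distrib_left)
    have "measure lebesgue (\<Union>i\<in>F. cball i (5 * r i)) \<le> (\<Sum>i\<in>F. measure lebesgue (cball i (5 * r i)))"
      by (rule measure_UNION_le) (use F in auto)
    also have "\<dots> = (\<Sum>i\<in>F. 10 * r i)"
      by (rule sum.cong) (use r FE in \<open>force simp: cball_eq_atLeastAtMost\<close>)+
    also have "\<dots> \<le> e" using * k by (subst sum_distrib_left[symmetric]) (simp add: e'_def field_simps)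
    finally show ?thesis .
  qed
  show "\<exists>T. E \<subseteq> T \<and> T \<in> lmeasurable \<and> measure lebesgue T \<le> e"
  proof (intro exI conjI)
    show "E \<subseteq> (\<Union>i\<in>C. cball i (5 * r i))" by (rule C(4))
    show "(\<Union>i\<in>C. cball i (5 * r i)) \<in> lmeasurable"
      by (rule fmeasurable_UN_bound[OF C(1) _ fin]) auto
    show "measure lebesgue (\<Union>i\<in>C. cball i (5 * r i)) \<le> e"
      by (rule measure_UN_bound[OF C(1) _ fin]) auto
  qed
qed

text \<open>Lebesgue's differentiation theorem: the exceptional set is the union of the preceding null sets
over the tolerances \<open>1 / (n + 1)\<close>.\<close>

theorem indefinite_integral_has_vector_derivative_ae:
  fixes f :: "real \<Rightarrow> 'a::euclidean_space"
  assumes f: "f integrable_on {a..b}"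
  obtains N where "negligible N"
    "\<And>t. t \<in> {a..b} - N \<Longrightarrow> ((\<lambda>s. integral {a..s} f) has_vector_derivative f t) (at t within {a..b})"
proof -
  define E where "E k = {t\<in>{a..b}. \<forall>\<delta>>0. \<exists>s\<in>{a..b}. s \<noteq> t \<and> \<bar>s - t\<bar> < \<delta> \<and>
     k * \<bar>s - t\<bar> < norm (integral {a..s} f - integral {a..t} f - (s - t) *\<^sub>R f t)}" for k :: real
  have "negligible (\<Union>n. E (1 / real (Suc n)))"
    by (rule negligible_Union_nat, unfold E_def, rule negligible_small_difference_quotient_failure[OF f]) simp
  moreover have "((\<lambda>s. integral {a..s} f) has_vector_derivative f t) (at t within {a..b})"
    if t: "t \<in> {a..b} - (\<Union>n. E (1 / real (Suc n)))" for t
    unfolding has_vector_derivative_def has_derivative_within_alt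
  proof (intro conjI allI impI)
    show "bounded_linear (\<lambda>x. x *\<^sub>R f t)" by (rule bounded_linear_scaleR_left)
    fix e :: real assume "0 < e"
    then obtain n where n: "1 / real (Suc n) < e" by (metis nat_approx_posE of_nat_Suc)
    have "t \<notin> E (1 / real (Suc n))" "t \<in> {a..b}" using t by auto
    then have "\<exists>\<delta>>0. \<forall>s\<in>{a..b}. s \<noteq> t \<longrightarrow> \<bar>s - t\<bar> < \<delta> \<longrightarrow>
      norm (integral {a..s} f - integral {a..t} f - (s - t) *\<^sub>R f t) \<le> 1 / real (Suc n) * \<bar>s - t\<bar>"
      unfolding E_def mem_Collect_eq by (meson not_le)
    then obtain \<delta> where "\<delta> > 0" and \<delta>: "\<And>s. \<lbrakk>s \<in> {a..b}; s \<noteq> t; \<bar>s - t\<bar> < \<delta>\<rbrakk> \<Longrightarrow>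
      norm (integral {a..s} f - integral {a..t} f - (s - t) *\<^sub>R f t) \<le> 1 / real (Suc n) * \<bar>s - t\<bar>"
      by blast
    have "norm (integral {a..s} f - integral {a..t} f - (s - t) *\<^sub>R f t) \<le> e * norm (s - t)"
      if "s \<in> {a..b}" "norm (s - t) < \<delta>" for s
    proof (cases "s = t")
      case False
      with \<delta>[OF that(1)] that have "norm (integral {a..s} f - integral {a..t} f - (s - t) *\<^sub>R f t)
          \<le> 1 / real (Suc n) * \<bar>s - t\<bar>" by auto
      also have "\<dots> \<le> e * \<bar>s - t\<bar>" by (rule mult_right_mono) (use n in auto)
      finally show ?thesis by simp
    qed auto
    then show "\<exists>d>0. \<forall>y\<in>{a..b}. norm (y - t) < d \<longrightarrow>
        norm (integral {a..y} f - integral {a..t} f - (y - t) *\<^sub>R f t) \<le> e * norm (y - t)"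
      using \<open>\<delta> > 0\<close> by blast
  qed
  ultimately show thesis by (rule that)
qed

section \<open>Absolutely continuous functions\<close>

lemma division_real_interval:
  fixes I :: "real set"
  assumes "\<D> division_of S" "I \<in> \<D>"
  shows "I = {Inf I..Sup I}" "Inf I \<le> Sup I"
proof -
  obtain c d where "I = {c..d}" "I \<noteq> {}"
    using division_ofD(3,4)[OF assms] by (metis cbox_interval)
  then show "I = {Inf I..Sup I}" "Inf I \<le> Sup I" by auto
qed

abbreviation variation :: "(real \<Rightarrow> 'a::real_normed_vector) \<Rightarrow> real set set \<Rightarrow> real" where
  "variation f \<D> \<equiv> \<Sum>I\<in>\<D>. norm (f (Sup I) - f (Inf I))"

abbreviation total_length :: "real set set \<Rightarrow> real" where
  "total_length \<D> \<equiv> \<Sum>I\<in>\<D>. Sup I - Inf I"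

lemma abs_cont_onD:
  assumes "abs_cont_on a b f" "0 < \<epsilon>"
  obtains \<delta> where "0 < \<delta>" "\<And>\<D>. \<D> division_of \<Union>\<D> \<Longrightarrow> \<Union>\<D> \<subseteq> {a..b} \<Longrightarrow> total_length \<D> < \<delta> \<Longrightarrow>
     variation f \<D> < \<epsilon>"
proof -
  from assms(1)[unfolded abs_cont_on_def, rule_format, OF assms(2)] show thesis
    by (elim exE conjE) (rule that, auto)
qed

lemma abs_cont_onI:
  assumes "\<And>\<epsilon>. 0 < \<epsilon> \<Longrightarrow> \<exists>\<delta>>0. \<forall>\<D>. \<D> division_of \<Union>\<D> \<longrightarrow> \<Union>\<D> \<subseteq> {a..b} \<longrightarrow> total_length \<D> < \<delta> \<longrightarrow>
     variation f \<D> < \<epsilon>"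
  shows "abs_cont_on a b f"
  unfolding abs_cont_on_def
proof (intro allI impI)
  fix \<epsilon> :: real assume "0 < \<epsilon>"
  from assms[OF this] show "\<exists>\<delta>>0. \<forall>\<D>. \<D> division_of \<Union>\<D> \<and> \<Union>\<D> \<subseteq> {a..b} \<and> total_length \<D> < \<delta> \<longrightarrow>
     variation f \<D> < \<epsilon>"
    by (elim exE conjE) (intro exI conjI, assumption, simp)
qed

lemma abs_cont_on_subset: "abs_cont_on a b f \<Longrightarrow> a \<le> c \<Longrightarrow> d \<le> b \<Longrightarrow> abs_cont_on c d f"
  unfolding abs_cont_on_def by (meson atLeastatMost_subset_iff order_trans)

lemma abs_cont_on_dominated:
  assumes f: "abs_cont_on a b f" and g: "abs_cont_on a b g" and K: "0 \<le> K"
    and h: "\<And>s t. s \<in> {a..b} \<Longrightarrow> t \<in> {a..b} \<Longrightarrow> norm (h s - h t) \<le> K * (norm (f s - f t) + norm (g s - g t))"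
  shows "abs_cont_on a b h"
proof (rule abs_cont_onI)
  fix \<epsilon> :: real assume "0 < \<epsilon>"
  define e where "e = \<epsilon> / (K + 1) / 2"
  have e: "0 < e" using \<open>0 < \<epsilon>\<close> K by (simp add: e_def)
  obtain \<delta>1 where \<delta>1: "0 < \<delta>1" "\<And>\<D>. \<D> division_of \<Union>\<D> \<Longrightarrow> \<Union>\<D> \<subseteq> {a..b} \<Longrightarrow> total_length \<D> < \<delta>1 \<Longrightarrow>
     variation f \<D> < e" using abs_cont_onD[OF f e] by blast
  obtain \<delta>2 where \<delta>2: "0 < \<delta>2" "\<And>\<D>. \<D> division_of \<Union>\<D> \<Longrightarrow> \<Union>\<D> \<subseteq> {a..b} \<Longrightarrow> total_length \<D> < \<delta>2 \<Longrightarrow>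
     variation g \<D> < e" using abs_cont_onD[OF g e] by blast
  have "variation h \<D> < \<epsilon>"
    if D: "\<D> division_of \<Union>\<D>" "\<Union>\<D> \<subseteq> {a..b}" "total_length \<D> < min \<delta>1 \<delta>2" for \<D>
  proof -
    have "variation h \<D> \<le>
        (\<Sum>I\<in>\<D>. K * (norm (f (Sup I) - f (Inf I)) + norm (g (Sup I) - g (Inf I))))"
    proof (rule sum_mono)
      fix I assume I: "I \<in> \<D>"
      have "Sup I \<in> I" "Inf I \<in> I" using division_real_interval[OF D(1) I] by (metis atLeastAtMost_iff order_refl)+
      then show "norm (h (Sup I) - h (Inf I)) \<le> K * (norm (f (Sup I) - f (Inf I)) + norm (g (Sup I) - g (Inf I)))"
        using h D(2) I by (meson UnionI subsetD)
    qed
    also have "\<dots> = K * (variation f \<D> + variation g \<D>)"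
      by (simp add: sum_distrib_left[symmetric] sum.distrib)
    also have "\<dots> \<le> K * (e + e)"
      using \<delta>1(2)[OF D(1,2)] \<delta>2(2)[OF D(1,2)] D(3) by (intro mult_left_mono K add_mono) auto
    also have "\<dots> < \<epsilon>" proof -
      have "e + e = \<epsilon> / (K + 1)" unfolding e_def by (rule field_sum_of_halves)
      then have "K * (e + e) = \<epsilon> * (K / (K + 1))" by simp
      also have "\<dots> < \<epsilon> * 1" using \<open>0 < \<epsilon>\<close> K by (intro mult_strict_left_mono) auto
      finally show ?thesis by simp
    qed
    finally show ?thesis .
  qed
  then show "\<exists>\<delta>>0. \<forall>\<D>. \<D> division_of \<Union>\<D> \<longrightarrow> \<Union>\<D> \<subseteq> {a..b} \<longrightarrow> total_length \<D> < \<delta> \<longrightarrow>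
     variation h \<D> < \<epsilon>"
    using \<delta>1(1) \<delta>2(1) by (intro exI[of _ "min \<delta>1 \<delta>2"]) auto
qed

text \<open>The part of \<open>norm f\<close> above a high level \<open>n\<close> has small integral, and the part below contributes at most
\<open>n\<close> times the total length.\<close>

lemma abs_cont_on_integral:
  fixes f :: "real \<Rightarrow> 'a::euclidean_space"
  assumes f: "f absolutely_integrable_on {a..b}"
  shows "abs_cont_on a b (\<lambda>t. integral {a..t} f)"
proof (rule abs_cont_onI)
  fix \<epsilon> :: real assume \<epsilon>: "0 < \<epsilon>"
  have fi: "f integrable_on {a..b}" and gi: "(\<lambda>x. norm (f x)) integrable_on {a..b}"
    using f by (auto simp: absolutely_integrable_on_def)
  define g where "g n x = norm (f x) - min (norm (f x)) (real n)" for n x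
  have ga: "(\<lambda>x. min (norm (f x)) (real n)) absolutely_integrable_on {a..b}" for n
    using f by (intro absolutely_integrable_min_1 absolutely_integrable_on_const) (auto simp: absolutely_integrable_on_def)
  have mi: "(\<lambda>x. min (norm (f x)) (real n)) integrable_on {a..b}" for n
    using ga by (auto simp: absolutely_integrable_on_def)
  have gn: "g n integrable_on {a..b}" for n
    unfolding g_def by (intro integrable_diff gi mi)
  have "(\<lambda>n. integral {a..b} (g n)) \<longlonglongrightarrow> integral {a..b} (\<lambda>x. 0::real)"
  proof (rule dominated_convergence(2)[OF gn gi])
    show "norm (g k x) \<le> norm (f x)" for k x by (auto simp: g_def)
    show "(\<lambda>k. g k x) \<longlonglongrightarrow> 0" for x
    proof (rule tendsto_eventually)
      obtain n0 where "norm (f x) \<le> real n0" using real_arch_simple by blast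
      then show "\<forall>\<^sub>F k in sequentially. g k x = 0"
        unfolding eventually_sequentially g_def by (intro exI[of _ n0]) auto
    qed
  qed
  then have "\<forall>\<^sub>F n in sequentially. integral {a..b} (g n) < \<epsilon> / 2"
    using \<epsilon> by (intro order_tendstoD(2)[where y = 0]) auto
  then obtain n where n: "integral {a..b} (g n) < \<epsilon> / 2" by (auto simp: eventually_sequentially)
  define \<delta> where "\<delta> = \<epsilon> / (2 * (real n + 1))"
  have "(\<Sum>I\<in>\<D>. norm (integral {a..Sup I} f - integral {a..Inf I} f)) < \<epsilon>"
    if D: "\<D> division_of \<Union>\<D>" "\<Union>\<D> \<subseteq> {a..b}" "total_length \<D> < \<delta>" for \<D>
  proof -
    have Ieq: "I = {Inf I..Sup I}" if "I \<in> \<D>" for I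
      using division_real_interval[OF D(1) that] by blast
    have Ii: "Inf I \<le> Sup I" "a \<le> Inf I" "Sup I \<le> b" "I \<subseteq> {a..b}" if "I \<in> \<D>" for I
    proof -
      show 1: "Inf I \<le> Sup I" using division_real_interval(2)[OF D(1) that] .
      show 2: "I \<subseteq> {a..b}" using D(2) that by blast
      show "a \<le> Inf I" "Sup I \<le> b" using 1 2 Ieq[OF that] by (metis atLeastatMost_subset_iff)+
    qed
    have sub: "h integrable_on I" if "I \<in> \<D>" "h integrable_on {a..b}" for I and h :: "real \<Rightarrow> 'b::banach"
      by (subst Ieq[OF that(1)], rule integrable_on_subinterval[OF that(2)]) (use Ii[OF that(1)] in auto)
    have const: "(\<lambda>x. c) integrable_on I" if "I \<in> \<D>" for I and c :: real
      by (rule sub[OF that]) (rule integrable_const_ivl)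
    have le: "norm (integral {a..Sup I} f - integral {a..Inf I} f) \<le>
        integral I (g n) + real n * (Sup I - Inf I)" if I: "I \<in> \<D>" for I
    proof -
      have "integral {a..Inf I} f + integral {Inf I..Sup I} f = integral {a..Sup I} f"
        by (rule Henstock_Kurzweil_Integration.integral_combine)
          (use Ii[OF I] in \<open>auto intro: integrable_on_subinterval[OF fi]\<close>)
      then have "integral {a..Sup I} f - integral {a..Inf I} f = integral I f"
        by (subst Ieq[OF I]) (simp add: algebra_simps)
      also have "norm (integral I f) \<le> integral I (\<lambda>x. norm (f x))"
        by (rule integral_norm_bound_integral) (use sub[OF I fi] sub[OF I gi] in auto)
      also have "\<dots> \<le> integral I (\<lambda>x. g n x + real n)"
      proof (rule integral_le)
        show "(\<lambda>x. g n x + real n) integrable_on I" by (intro integrable_add sub[OF I gn] const[OF I])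
      qed (use sub[OF I gi] in \<open>auto simp: g_def\<close>)
      also have "\<dots> = integral I (g n) + integral I (\<lambda>x. real n)"
        by (rule integral_add) (use sub[OF I gn] const[OF I] in auto)
      also have "integral I (\<lambda>x. real n) = real n * (Sup I - Inf I)"
        by (subst Ieq[OF I]) (use Ii[OF I] in simp)
      finally show ?thesis .
    qed
    have "(\<Sum>I\<in>\<D>. norm (integral {a..Sup I} f - integral {a..Inf I} f)) \<le>
        (\<Sum>I\<in>\<D>. integral I (g n)) + real n * total_length \<D>"
      using sum_mono[OF le] by (simp add: sum.distrib sum_distrib_left)
    also have "(\<Sum>I\<in>\<D>. integral I (g n)) = integral (\<Union>\<D>) (g n)"
      by (rule integral_combine_division_bottomup[OF D(1), symmetric]) (use sub gn in blast)
    also have "\<dots> \<le> integral {a..b} (g n)"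
    proof (rule integral_subset_le[OF D(2)])
      show "g n integrable_on \<Union>\<D>"
        using integrable_combine_division[OF D(1)] sub gn by blast
    qed (auto simp: gn, auto simp: g_def)
    also have "real n * total_length \<D> \<le> real n * \<delta>"
      using D(3) by (intro mult_left_mono) auto
    also have "real n * \<delta> \<le> \<epsilon> / 2" using \<epsilon> by (simp add: \<delta>_def field_simps)
    finally show ?thesis using n by simp
  qed
  moreover have "\<delta> > 0" using \<epsilon> by (simp add: \<delta>_def)
  ultimately show "\<exists>\<delta>>0. \<forall>\<D>. \<D> division_of \<Union>\<D> \<longrightarrow> \<Union>\<D> \<subseteq> {a..b} \<longrightarrow> total_length \<D> < \<delta> \<longrightarrow>
     (\<Sum>I\<in>\<D>. norm (integral {a..Sup I} f - integral {a..Inf I} f)) < \<epsilon>" by blast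
qed

text \<open>Below the Lebesgue number of a finite cover by good neighbourhoods every interval of a division lies inside one of
them, so that no interval has to be cut.\<close>

lemma abs_cont_on_local:
  assumes loc: "\<And>t. t \<in> {a..b} \<Longrightarrow> \<exists>e>0. abs_cont_on (max a (t - e)) (min b (t + e)) f"
  shows "abs_cont_on a b f"
proof (cases "a \<le> b")
  case False
  have empty: "\<D> = {}" if "\<D> division_of \<Union>\<D>" "\<Union>\<D> \<subseteq> {a..b}" for \<D>
  proof (rule equals0I)
    fix I assume "I \<in> \<D>"
    then have "I \<noteq> {}" "I \<subseteq> {a..b}" using that division_ofD(3) by blast+
    then show False using False by auto
  qed
  show ?thesis
  proof (intro abs_cont_onI exI[of _ 1] conjI allI impI)
    fix \<epsilon> :: real and \<D> assume "0 < \<epsilon>" "\<D> division_of \<Union>\<D>" "\<Union>\<D> \<subseteq> {a..b}"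
    then show "variation f \<D> < \<epsilon>" using empty[of \<D>] by simp
  qed simp
next
  case True
  obtain e where e: "\<And>t. t \<in> {a..b} \<Longrightarrow> 0 < e t"
    "\<And>t. t \<in> {a..b} \<Longrightarrow> abs_cont_on (max a (t - e t)) (min b (t + e t)) f" using loc by metis
  obtain D where D: "D \<subseteq> {a..b}" "finite D" "{a..b} \<subseteq> (\<Union>t\<in>D. ball t (e t))"
    by (rule compactE_image[of "{a..b}" "{a..b}" "\<lambda>t. ball t (e t)"]) (use e in force)+
  have "D \<noteq> {}" using D(3) True by auto
  obtain \<eta> where \<eta>: "0 < \<eta>" "\<And>T. T \<subseteq> {a..b} \<Longrightarrow> diameter T < \<eta> \<Longrightarrow> \<exists>B\<in>(\<lambda>t. ball t (e t)) ` D. T \<subseteq> B"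
    by (rule Lebesgue_number_lemma[of "{a..b}" "(\<lambda>t. ball t (e t)) ` D"]) (use D \<open>D \<noteq> {}\<close> in auto)
  show ?thesis
  proof (rule abs_cont_onI)
    fix \<epsilon> :: real assume "0 < \<epsilon>"
    then have "0 < \<epsilon> / card D" using D(2) \<open>D \<noteq> {}\<close> by (simp add: card_gt_0_iff)
    then have "\<exists>\<delta>>0. \<forall>\<D>. \<D> division_of \<Union>\<D> \<longrightarrow> \<Union>\<D> \<subseteq> {max a (t - e t)..min b (t + e t)} \<longrightarrow>
       total_length \<D> < \<delta> \<longrightarrow> variation f \<D> < \<epsilon> / card D" if "t \<in> D" for t
    proof -
      have t: "t \<in> {a..b}" using that D(1) by blast
      obtain \<delta> where "0 < \<delta>" "\<And>\<D>. \<D> division_of \<Union>\<D> \<Longrightarrow> \<Union>\<D> \<subseteq> {max a (t - e t)..min b (t + e t)} \<Longrightarrow>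
         total_length \<D> < \<delta> \<Longrightarrow> variation f \<D> < \<epsilon> / card D"
        using abs_cont_onD[OF e(2)[OF t] \<open>0 < \<epsilon> / card D\<close>] by blast
      then show ?thesis by (intro exI[of _ \<delta>]) simp
    qed
    then have "\<exists>\<delta>. \<forall>t\<in>D. 0 < \<delta> t \<and> (\<forall>\<D>. \<D> division_of \<Union>\<D> \<longrightarrow> \<Union>\<D> \<subseteq> {max a (t - e t)..min b (t + e t)} \<longrightarrow>
       total_length \<D> < \<delta> t \<longrightarrow> variation f \<D> < \<epsilon> / card D)"
      by (intro bchoice) blast
    then obtain \<delta> where "\<forall>t\<in>D. 0 < \<delta> t \<and> (\<forall>\<D>. \<D> division_of \<Union>\<D> \<longrightarrow> \<Union>\<D> \<subseteq> {max a (t - e t)..min b (t + e t)} \<longrightarrow>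
       total_length \<D> < \<delta> t \<longrightarrow> variation f \<D> < \<epsilon> / card D)" by (rule exE)
    then have \<delta>: "\<And>t. t \<in> D \<Longrightarrow> 0 < \<delta> t" "\<And>t \<D>. \<lbrakk>t \<in> D; \<D> division_of \<Union>\<D>;
       \<Union>\<D> \<subseteq> {max a (t - e t)..min b (t + e t)}; total_length \<D> < \<delta> t\<rbrakk> \<Longrightarrow>
       variation f \<D> < \<epsilon> / card D" by simp_all
    define \<delta>' where "\<delta>' = min \<eta> (Min (\<delta> ` D))"
    have "0 < \<delta>'" using \<eta>(1) \<delta>(1) D(2) \<open>D \<noteq> {}\<close> by (simp add: \<delta>'_def)
    moreover have "variation f \<D> < \<epsilon>"
      if \<D>: "\<D> division_of \<Union>\<D>" "\<Union>\<D> \<subseteq> {a..b}" "total_length \<D> < \<delta>'" for \<D>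
    proof -
      have fin: "finite \<D>" using \<D>(1) by blast
      have Ieq: "I = {Inf I..Sup I}" if "I \<in> \<D>" for I
        using division_real_interval[OF \<D>(1) that] by blast
      have Ii: "Inf I \<le> Sup I" if "I \<in> \<D>" for I
        using division_real_interval[OF \<D>(1) that] by blast
      define P where "P t = {I\<in>\<D>. I \<subseteq> ball t (e t)}" for t
      let ?n = "\<lambda>I. norm (f (Sup I) - f (Inf I))"
      have ex: "\<exists>t\<in>D. I \<in> P t" if "I \<in> \<D>" for I
      proof -
        have "Sup I - Inf I \<le> total_length \<D>"
          by (rule member_le_sum) (use that Ii fin in auto)
        then have "Sup I - Inf I < \<eta>" using \<D>(3) by (simp add: \<delta>'_def)
        moreover have "diameter I = Sup I - Inf I" by (subst Ieq[OF that]) (use Ii[OF that] in simp)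
        ultimately show ?thesis using \<eta>(2)[of I] \<D>(2) that by (auto simp: P_def)
      qed
      have part: "sum ?n (P t) < \<epsilon> / card D" if t: "t \<in> D" for t
      proof (rule \<delta>(2)[OF t])
        show "P t division_of \<Union>(P t)" by (rule division_of_subset[OF \<D>(1)]) (auto simp: P_def)
        show "\<Union>(P t) \<subseteq> {max a (t - e t)..min b (t + e t)}"
          using \<D>(2) by (force simp: P_def dist_real_def)
        have "(\<Sum>I\<in>P t. Sup I - Inf I) \<le> total_length \<D>"
          by (rule sum_mono2) (use fin Ii in \<open>auto simp: P_def\<close>)
        also have "\<dots> < Min (\<delta> ` D)" using \<D>(3) by (simp add: \<delta>'_def)
        also have "\<dots> \<le> \<delta> t" using t D(2) by simp
        finally show "(\<Sum>I\<in>P t. Sup I - Inf I) < \<delta> t" .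
      qed
      have "sum ?n \<D> \<le> (\<Sum>I\<in>\<D>. \<Sum>t\<in>D. if I \<in> P t then ?n I else 0)"
      proof (rule sum_mono)
        fix I assume "I \<in> \<D>"
        then obtain t where "t \<in> D" "I \<in> P t" using ex by blast
        then show "?n I \<le> (\<Sum>t\<in>D. if I \<in> P t then ?n I else 0)"
          using member_le_sum[of t D "\<lambda>t. if I \<in> P t then ?n I else 0"] D(2) by auto
      qed
      also have "\<dots> = (\<Sum>t\<in>D. \<Sum>I\<in>\<D>. if I \<in> P t then ?n I else 0)" by (rule sum.swap)
      also have "\<dots> = (\<Sum>t\<in>D. sum ?n (P t))"
        by (rule sum.cong) (auto simp: P_def sum.If_cases fin Int_def)
      also have "\<dots> < (\<Sum>t\<in>D. \<epsilon> / card D)"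
        by (rule sum_strict_mono) (use part D(2) \<open>D \<noteq> {}\<close> in auto)
      also have "\<dots> = \<epsilon>" using D(2) \<open>D \<noteq> {}\<close> by simp
      finally show ?thesis .
    qed
    ultimately show "\<exists>\<delta>>0. \<forall>\<D>. \<D> division_of \<Union>\<D> \<longrightarrow> \<Union>\<D> \<subseteq> {a..b} \<longrightarrow> total_length \<D> < \<delta> \<longrightarrow>
     variation f \<D> < \<epsilon>" by blast
  qed
qed

text \<open>The images of the intervals of a division form a division that is no longer than the original one. Intervals
collapsed by \<open>\<theta>\<close> contribute nothing and are dropped first, since their images need not be distinct.\<close>

lemma abs_cont_on_reparametrize:
  assumes g: "abs_cont_on a b g" and mono: "mono_on {c..d} \<theta>" and im: "\<theta> ` {c..d} \<subseteq> {a..b}"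
    and nonexp: "\<And>s t. s \<in> {c..d} \<Longrightarrow> t \<in> {c..d} \<Longrightarrow> s \<le> t \<Longrightarrow> \<theta> t - \<theta> s \<le> t - s"
  shows "abs_cont_on c d (g \<circ> \<theta>)"
proof (rule abs_cont_onI)
  fix \<epsilon> :: real assume "0 < \<epsilon>"
  obtain \<delta> where \<delta>: "0 < \<delta>" "\<And>\<D>. \<D> division_of \<Union>\<D> \<Longrightarrow> \<Union>\<D> \<subseteq> {a..b} \<Longrightarrow> total_length \<D> < \<delta> \<Longrightarrow>
     variation g \<D> < \<epsilon>" using abs_cont_onD[OF g \<open>0 < \<epsilon>\<close>] by blast
  have "(\<Sum>I\<in>\<D>. norm ((g \<circ> \<theta>) (Sup I) - (g \<circ> \<theta>) (Inf I))) < \<epsilon>"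
    if D: "\<D> division_of \<Union>\<D>" "\<Union>\<D> \<subseteq> {c..d}" "total_length \<D> < \<delta>" for \<D>
  proof -
    have fin: "finite \<D>" using D(1) by blast
    have Ieq: "I = {Inf I..Sup I}" if "I \<in> \<D>" for I
      using division_real_interval[OF D(1) that] by blast
    have Ii: "Inf I \<le> Sup I" "Inf I \<in> {c..d}" "Sup I \<in> {c..d}" if "I \<in> \<D>" for I
    proof -
      show 1: "Inf I \<le> Sup I" using division_real_interval(2)[OF D(1) that] .
      have "Inf I \<in> I" "Sup I \<in> I" using 1 Ieq[OF that] by (metis atLeastAtMost_iff order_refl)+
      then show "Inf I \<in> {c..d}" "Sup I \<in> {c..d}" using D(2) that by auto
    qed
    define P where "P = {I\<in>\<D>. \<theta> (Inf I) < \<theta> (Sup I)}"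
    define J where "J I = {\<theta> (Inf I)..\<theta> (Sup I)}" for I
    have disj: "interior (J I) \<inter> interior (J I') = {}" if "I \<in> P" "I' \<in> P" "I \<noteq> I'" for I I'
    proof -
      have II: "I \<in> \<D>" "I' \<in> \<D>" using that by (auto simp: P_def)
      have "interior I \<inter> interior I' = {}" using D(1) II that(3) by blast
      then have dj: "{Inf I<..<Sup I} \<inter> {Inf I'<..<Sup I'} = {}"
        using Ieq[OF II(1)] Ieq[OF II(2)] by (metis interior_atLeastAtMost_real)
      have "Inf I < Sup I" "Inf I' < Sup I'"
        using that Ii(1)[OF II(1)] Ii(1)[OF II(2)] by (auto simp: P_def order_less_le)
      then have "Sup I \<le> Inf I' \<or> Sup I' \<le> Inf I"
        using dj dense[of "max (Inf I) (Inf I')" "min (Sup I) (Sup I')"] by (force simp: not_le)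
      then have "\<theta> (Sup I) \<le> \<theta> (Inf I') \<or> \<theta> (Sup I') \<le> \<theta> (Inf I)"
        using mono_onD[OF mono] Ii[OF II(1)] Ii[OF II(2)] by metis
      then show ?thesis by (auto simp: J_def interior_atLeastAtMost_real)
    qed
    have inj: "inj_on J P"
    proof (rule inj_onI, rule ccontr)
      fix I I' assume "I \<in> P" "I' \<in> P" "J I = J I'" "I \<noteq> I'"
      with disj[of I I'] have "interior (J I) = {}" by auto
      with \<open>I \<in> P\<close> show False by (auto simp: J_def P_def interior_atLeastAtMost_real)
    qed
    have J: "Inf (J I) = \<theta> (Inf I)" "Sup (J I) = \<theta> (Sup I)" if "I \<in> P" for I
      using that by (auto simp: J_def P_def)
    have JD: "J ` P division_of \<Union>(J ` P)"
    proof (rule division_ofI)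
      fix K assume "K \<in> J ` P"
      then obtain I where I: "I \<in> P" "K = J I" by auto
      show "K \<noteq> {}" using I by (auto simp: J_def P_def)
      show "\<exists>a b. K = cbox a b" unfolding I(2) J_def cbox_interval[symmetric] by blast
      fix K' assume "K' \<in> J ` P" "K \<noteq> K'"
      then show "interior K \<inter> interior K' = {}" using disj I by blast
    qed (use fin in \<open>auto simp: P_def\<close>)
    have Jab: "\<Union>(J ` P) \<subseteq> {a..b}"
    proof (intro Union_least)
      fix K assume "K \<in> J ` P"
      then obtain I where I: "I \<in> \<D>" "K = J I" by (auto simp: P_def)
      have "\<theta> (Inf I) \<in> {a..b}" "\<theta> (Sup I) \<in> {a..b}" using im Ii(2,3)[OF I(1)] by blast+
      then show "K \<subseteq> {a..b}" by (auto simp: I(2) J_def)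
    qed
    have "(\<Sum>K\<in>J ` P. Sup K - Inf K) = (\<Sum>I\<in>P. \<theta> (Sup I) - \<theta> (Inf I))"
      by (simp add: sum.reindex[OF inj] J)
    also have "\<dots> \<le> (\<Sum>I\<in>P. Sup I - Inf I)"
      by (rule sum_mono) (use nonexp Ii in \<open>auto simp: P_def\<close>)
    also have "\<dots> \<le> total_length \<D>"
      by (rule sum_mono2) (use fin Ii in \<open>auto simp: P_def\<close>)
    finally have "(\<Sum>K\<in>J ` P. Sup K - Inf K) < \<delta>" using D(3) by simp
    then have "(\<Sum>K\<in>J ` P. norm (g (Sup K) - g (Inf K))) < \<epsilon>" using \<delta>(2) JD Jab by blast
    moreover have "(\<Sum>I\<in>\<D>. norm ((g \<circ> \<theta>) (Sup I) - (g \<circ> \<theta>) (Inf I))) = (\<Sum>I\<in>P. norm (g (\<theta> (Sup I)) - g (\<theta> (Inf I))))"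
    proof (rule sum.mono_neutral_cong_right)
      show "\<forall>I\<in>\<D> - P. norm ((g \<circ> \<theta>) (Sup I) - (g \<circ> \<theta>) (Inf I)) = 0"
      proof
        fix I assume I: "I \<in> \<D> - P"
        then have "\<theta> (Inf I) \<le> \<theta> (Sup I)" using mono_onD[OF mono] Ii[of I] by auto
        with I show "norm ((g \<circ> \<theta>) (Sup I) - (g \<circ> \<theta>) (Inf I)) = 0" by (simp add: P_def)
      qed
    qed (auto simp: P_def fin)
    ultimately show ?thesis by (simp add: sum.reindex[OF inj] J)
  qed
  with \<delta>(1) show "\<exists>\<delta>>0. \<forall>\<D>. \<D> division_of \<Union>\<D> \<longrightarrow> \<Union>\<D> \<subseteq> {c..d} \<longrightarrow> total_length \<D> < \<delta> \<longrightarrow>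
     (\<Sum>I\<in>\<D>. norm ((g \<circ> \<theta>) (Sup I) - (g \<circ> \<theta>) (Inf I))) < \<epsilon>" by blast
qed

text \<open>Tagged divisions may contain the same degenerate interval with several tags; its contribution is zero.\<close>

lemma abs_cont_on_tagged:
  fixes f :: "real \<Rightarrow> 'a::real_normed_vector"
  assumes ac: "\<And>\<D>. \<D> division_of \<Union>\<D> \<Longrightarrow> \<Union>\<D> \<subseteq> {a..b} \<Longrightarrow> total_length \<D> < \<delta> \<Longrightarrow>
      variation f \<D> < \<epsilon>"
    and p: "p tagged_partial_division_of {a..b}" and T: "\<Union>(snd ` p) \<subseteq> T" "T \<in> lmeasurable" "measure lebesgue T < \<delta>"
  shows "(\<Sum>(x,K)\<in>p. norm (f (Sup K) - f (Inf K))) < \<epsilon>"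
proof -
  let ?D = "snd ` p"
  have D: "?D division_of \<Union>?D" by (rule partial_division_of_tagged_division[OF p])
  have cI: "Sup K - Inf K = measure lebesgue K" if "K \<in> ?D" for K
  proof -
    have "measure lebesgue {Inf K..Sup K} = Sup K - Inf K"
      using division_real_interval(2)[OF D that] by simp
    then show ?thesis using division_real_interval(1)[OF D that] by simp
  qed
  have "(\<Sum>K\<in>?D. Sup K - Inf K) = (\<Sum>K\<in>?D. measure lebesgue K)"
    by (rule sum.cong) (use cI in auto)
  also have "\<dots> = measure lebesgue (\<Union>?D)"
    by (rule content_division[OF D])
  also have "\<dots> \<le> measure lebesgue T"
    by (rule measure_mono_fmeasurable[OF T(1) _ T(2)]) (use D lmeasurable_division in blast)
  finally have "(\<Sum>K\<in>?D. Sup K - Inf K) < \<delta>" using T(3) by simp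
  moreover have "\<Union>?D \<subseteq> {a..b}" using p unfolding tagged_partial_division_of_def by fastforce
  ultimately have "(\<Sum>K\<in>?D. norm (f (Sup K) - f (Inf K))) < \<epsilon>" using ac D by blast
  also have "(\<Sum>K\<in>?D. norm (f (Sup K) - f (Inf K))) = (\<Sum>K\<in>?D. if K = {} then 0 else norm (f (Sup K) - f (Inf K)))"
    by (rule sum.cong) (use p in \<open>force simp: tagged_partial_division_of_def\<close>)+
  also have "\<dots> = (\<Sum>(x,K)\<in>p. if K = {} then 0 else norm (f (Sup K) - f (Inf K)))"
  proof (rule sum.over_tagged_division_lemma[OF tagged_partial_division_of_Union_self[OF p], symmetric])
    fix u v :: real assume "box u v = {}"
    then have "v \<le> u" by (simp add: box_real)
    then show "(if cbox u v = {} then 0 else norm (f (Sup (cbox u v)) - f (Inf (cbox u v)))) = 0"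
      by (cases "u = v") (auto simp: cbox_interval)
  qed
  also have "\<dots> = (\<Sum>(x,K)\<in>p. norm (f (Sup K) - f (Inf K)))"
    by (rule sum.cong) (use p in \<open>force simp: tagged_partial_division_of_def\<close>)+
  finally show ?thesis .
qed

lemma negligible_outer_open:
  fixes S :: "'a::euclidean_space set"
  assumes S: "negligible S" and d: "0 < d"
  obtains T where "open T" "S \<subseteq> T" "T \<in> lmeasurable" "measure lebesgue T < d"
proof -
  obtain T where T: "open T" "S \<subseteq> T" "T - S \<in> lmeasurable" "emeasure lebesgue (T - S) < ennreal d"
    using sets_lebesgue_outer_open[OF negligible_imp_sets[OF S] d] by blast
  have "negligible (sym_diff T (T - S))" by (rule negligible_subset[OF S]) auto
  then have "T \<in> lmeasurable" "measure lebesgue T = measure lebesgue (T - S)"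
    using lmeasurable_negligible_symdiff[OF T(3)] measure_negligible_symdiff[of "T - S" T] T(3)
    by (auto simp: Un_commute)
  moreover have "measure lebesgue (T - S) < d"
    using T(3,4) d by (simp add: emeasure_eq_measure2 ennreal_less_iff)
  ultimately show thesis using that T(1,2) by metis
qed

text \<open>The fundamental theorem of calculus for absolutely continuous functions. The gauge forces intervals tagged in the
exceptional set into an open set of small measure, where absolute continuity controls the increments of \<open>f\<close>; at all
other tags the derivative does.\<close>

theorem has_integral_derivative_of_abs_cont:
  fixes f :: "real \<Rightarrow> 'a::euclidean_space"
  assumes ac: "abs_cont_on a b f" and ab: "a \<le> b" and N: "negligible N"
    and der: "\<And>t. t \<in> {a..b} - N \<Longrightarrow> (f has_vector_derivative f' t) (at t within {a..b})"
  shows "(f' has_integral (f b - f a)) {a..b}"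
proof -
  define g where "g t = (if t \<in> N then 0 else f' t)" for t
  have "(g has_integral (f b - f a)) (cbox a b)"
    unfolding has_integral
  proof (intro allI impI)
    fix e :: real assume e: "0 < e"
    obtain \<delta> where \<delta>: "0 < \<delta>" "\<And>\<D>. \<D> division_of \<Union>\<D> \<Longrightarrow> \<Union>\<D> \<subseteq> {a..b} \<Longrightarrow> total_length \<D> < \<delta> \<Longrightarrow>
      variation f \<D> < e / 2" using abs_cont_onD[OF ac half_gt_zero[OF e]] by blast
    obtain T where T: "open T" "N \<subseteq> T" "T \<in> lmeasurable" "measure lebesgue T < \<delta>"
      using negligible_outer_open[OF N \<delta>(1)] by metis
    define e' where "e' = e / 2 / (b - a + 1)"
    have e': "0 < e'" using e ab by (simp add: e'_def)
    have "\<exists>d>0. \<forall>s\<in>{a..b}. \<bar>s - t\<bar> < d \<longrightarrow> norm (f s - f t - (s - t) *\<^sub>R g t) \<le> e' * \<bar>s - t\<bar>"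
      if "t \<in> {a..b} - N" for t
    proof -
      have "(f has_derivative (\<lambda>h. h *\<^sub>R g t)) (at t within {a..b})"
        using der[OF that] that by (simp add: has_vector_derivative_def g_def)
      then show ?thesis using e' unfolding has_derivative_within_alt by (auto simp: g_def)
    qed
    then obtain d where d: "\<And>t. t \<in> {a..b} - N \<Longrightarrow> 0 < d t"
      "\<And>t s. t \<in> {a..b} - N \<Longrightarrow> s \<in> {a..b} \<Longrightarrow> \<bar>s - t\<bar> < d t \<Longrightarrow> norm (f s - f t - (s - t) *\<^sub>R g t) \<le> e' * \<bar>s - t\<bar>"
      by metis
    define \<gamma> where "\<gamma> t = (if t \<in> N then T else if t \<in> {a..b} then ball t (d t) else UNIV)" for t
    have gg: "gauge \<gamma>" using T d(1) by (auto simp: gauge_def \<gamma>_def)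
    have bnd: "norm ((\<Sum>(x, K)\<in>\<D>. measure lborel K *\<^sub>R g x) - (f b - f a)) < e"
      if \<D>: "\<D> tagged_division_of cbox a b" "\<gamma> fine \<D>" for \<D>
    proof -
      note \<D>' = tagged_division_ofD[OF \<D>(1)]
      have fin: "finite \<D>" using \<D>'(1) .
      have K: "K = {Inf K..Sup K} \<and> Inf K \<le> x \<and> x \<le> Sup K \<and> K \<subseteq> {a..b} \<and> K \<subseteq> \<gamma> x \<and> measure lborel K = Sup K - Inf K"
        if xK: "(x, K) \<in> \<D>" for x K
      proof -
        obtain u v where "K = cbox u v" using \<D>'(4)[OF xK] by blast
        then have "K = {u..v}" by (simp add: cbox_interval)
        moreover have "x \<in> K" "K \<subseteq> {a..b}" using \<D>'(2,3)[OF that] by (auto simp: cbox_interval)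
        moreover have "K \<subseteq> \<gamma> x" using \<D>(2) that by (auto simp: fine_def)
        ultimately show ?thesis by auto
      qed
      define P where "P = {(x, K). (x, K) \<in> \<D> \<and> x \<in> N}"
      define Q where "Q = {(x, K). (x, K) \<in> \<D> \<and> x \<notin> N}"
      have PQ: "\<D> = P \<union> Q" "P \<inter> Q = {}" "finite P" "finite Q"
        using fin by (auto simp: P_def Q_def intro: finite_subset[of _ \<D>])
      let ?h = "\<lambda>(x, K). measure lborel K *\<^sub>R g x - (f (Sup K) - f (Inf K))"
      have "(\<Sum>(x, K)\<in>\<D>. f (Sup K) - f (Inf K)) = f b - f a"
        by (rule additive_tagged_division_1[OF ab]) (use \<D>(1) in \<open>simp add: cbox_interval\<close>)
      then have "(\<Sum>(x, K)\<in>\<D>. measure lborel K *\<^sub>R g x) - (f b - f a) = sum ?h \<D>"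
        by (simp add: split_def sum_subtractf)
      also have "\<dots> = sum ?h P + sum ?h Q" unfolding PQ(1) by (rule sum.union_disjoint[OF PQ(3,4,2)])
      also have "norm \<dots> \<le> norm (sum ?h P) + norm (sum ?h Q)" by (rule norm_triangle_ineq)
      also have "\<dots> < e / 2 + e / 2"
      proof (rule add_less_le_mono)
        have "norm (sum ?h P) \<le> (\<Sum>(x, K)\<in>P. norm (f (Sup K) - f (Inf K)))"
          by (rule sum_norm_le) (auto simp: P_def g_def norm_minus_commute)
        also have "\<dots> < e / 2"
        proof (rule abs_cont_on_tagged[OF \<delta>(2)])
          show "P tagged_partial_division_of {a..b}"
            using \<D>(1) tagged_partial_division_subset[of \<D> "{a..b}" P] PQ(1)
            by (auto simp: tagged_division_of_def cbox_interval)
          show "\<Union>(snd ` P) \<subseteq> T"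
            using K by (fastforce simp: P_def \<gamma>_def)
        qed (use T in auto)
        finally show "norm (sum ?h P) < e / 2" .
        have "norm (sum ?h Q) \<le> (\<Sum>(x, K)\<in>Q. e' * (Sup K - Inf K))"
        proof (rule sum_norm_le, clarify)
          fix x K assume "(x, K) \<in> Q"
          then have xK: "(x, K) \<in> \<D>" and x: "x \<in> {a..b} - N"
            using \<D>'(2)[of x K] \<D>'(3)[of x K] by (auto simp: Q_def cbox_interval)
          have Kx: "Inf K \<le> x" "x \<le> Sup K" "measure lborel K = Sup K - Inf K"
            using K[OF xK] by blast+
          have in_K: "Inf K \<in> K" "Sup K \<in> K" using K[OF xK] by (metis atLeastAtMost_iff order.refl order.trans)+
          have "K \<subseteq> ball x (d x)" using K[OF xK] x by (auto simp: \<gamma>_def)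
          then have *: "norm (f s - f x - (s - x) *\<^sub>R g x) \<le> e' * \<bar>s - x\<bar>" if "s \<in> K" for s
            using d(2)[OF x, of s] that K[OF xK] by (force simp: dist_real_def abs_minus_commute)
          have "measure lborel K *\<^sub>R g x - (f (Sup K) - f (Inf K)) =
             (f (Inf K) - f x - (Inf K - x) *\<^sub>R g x) - (f (Sup K) - f x - (Sup K - x) *\<^sub>R g x)"
            by (simp add: Kx(3) algebra_simps)
          also have "norm \<dots> \<le> e' * \<bar>Inf K - x\<bar> + e' * \<bar>Sup K - x\<bar>"
            by (rule norm_triangle_le_diff) (rule add_mono[OF *[OF in_K(1)] *[OF in_K(2)]])
          also have "\<dots> = e' * (Sup K - Inf K)" using Kx by (simp add: algebra_simps)
          finally show "norm (measure lborel K *\<^sub>R g x - (f (Sup K) - f (Inf K))) \<le> e' * (Sup K - Inf K)" .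
        qed
        also have "\<dots> \<le> (\<Sum>(x, K)\<in>\<D>. e' * (Sup K - Inf K))"
        proof (rule sum_mono2[OF fin])
          fix p assume "p \<in> \<D> - Q"
          then obtain x K where xK: "p = (x, K)" "(x, K) \<in> \<D>" by (cases p) auto
          have "Inf K \<le> Sup K" using K[OF xK(2)] by linarith
          then show "0 \<le> (case p of (x, K) \<Rightarrow> e' * (Sup K - Inf K))" using e' xK(1) by simp
        qed (use PQ in auto)
        also have "\<dots> = e' * (b - a)"
          using additive_tagged_division_1[OF ab, of \<D> "\<lambda>x. x"] \<D>(1)
          by (simp only: cbox_interval split_def sum_distrib_left[symmetric])
        also have "\<dots> \<le> e / 2"
        proof -
          have "e' * (b - a) \<le> e' * (b - a + 1)" using e' by simp
          also have "\<dots> = e / 2" unfolding e'_def by (rule nonzero_eq_divide_eq[THEN iffD1, OF _ refl]) (use ab in simp)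
          finally show ?thesis .
        qed
        finally show "norm (sum ?h Q) \<le> e / 2" .
      qed
      finally show ?thesis by simp
    qed
    show "\<exists>\<gamma>. gauge \<gamma> \<and> (\<forall>\<D>. \<D> tagged_division_of cbox a b \<and> \<gamma> fine \<D> \<longrightarrow>
        norm ((\<Sum>(x, k)\<in>\<D>. measure lborel k *\<^sub>R g x) - (f b - f a)) < e)"
      by (intro exI[of _ \<gamma>] conjI allI impI gg; elim conjE; rule bnd)
  qed
  then have "(g has_integral (f b - f a)) {a..b}" by (simp add: cbox_interval)
  then show ?thesis by (rule has_integral_spike[OF N, rotated]) (auto simp: g_def)
qed

lemma absolutely_integrable_on_little_subintervals:
  fixes f :: "real \<Rightarrow> 'a::euclidean_space"
  assumes "\<And>t. t \<in> {a..b} \<Longrightarrow> \<exists>e>0. \<forall>c d. c \<le> d \<and> {c..d} \<subseteq> {a..b} \<inter> ball t e \<longrightarrow> f absolutely_integrable_on {c..d}"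
  shows "f absolutely_integrable_on {a..b}"
proof -
  have little: "\<forall>t\<in>cbox a b. \<exists>e>0. \<forall>c d. t \<in> cbox c d \<and> cbox c d \<subseteq> ball t e \<and> cbox c d \<subseteq> cbox a b \<longrightarrow>
      f integrable_on cbox c d \<and> (\<lambda>x. norm (f x)) integrable_on cbox c d"
  proof
    fix t assume "t \<in> cbox a b"
    then obtain e where e: "e > 0"
      "\<And>c d. c \<le> d \<Longrightarrow> {c..d} \<subseteq> {a..b} \<inter> ball t e \<Longrightarrow> f absolutely_integrable_on {c..d}"
      using assms[of t] by (auto simp: cbox_interval)
    show "\<exists>e>0. \<forall>c d. t \<in> cbox c d \<and> cbox c d \<subseteq> ball t e \<and> cbox c d \<subseteq> cbox a b \<longrightarrow>
      f integrable_on cbox c d \<and> (\<lambda>x. norm (f x)) integrable_on cbox c d"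
    proof (intro exI[of _ e] conjI allI impI e(1); elim conjE)
      fix c d assume "t \<in> cbox c d" "cbox c d \<subseteq> ball t e" "cbox c d \<subseteq> cbox a b"
      then have "f absolutely_integrable_on {c..d}" by (intro e(2)) (auto simp: cbox_interval)
      then show "f integrable_on cbox c d" "(\<lambda>x. norm (f x)) integrable_on cbox c d"
        by (auto simp: cbox_interval absolutely_integrable_on_def)
    qed
  qed
  have "f integrable_on cbox a b"
    by (rule integrable_on_little_subintervals, rule ballI, drule little[THEN bspec], elim exE conjE)
      (intro exI conjI, assumption, simp)
  moreover have "(\<lambda>x. norm (f x)) integrable_on cbox a b"
    by (rule integrable_on_little_subintervals, rule ballI, drule little[THEN bspec], elim exE conjE)
      (intro exI conjI, assumption, simp)
  ultimately show ?thesis by (simp add: cbox_interval absolutely_integrable_on_def)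
qed

text \<open>On intervals shorter than the \<open>\<delta>\<close> belonging to \<open>\<epsilon> = 1\<close> the indefinite integral of the derivative, which is \<open>f\<close>
itself, has variation at most \<open>1\<close>.\<close>

theorem derivative_of_abs_cont_absolutely_integrable:
  fixes f :: "real \<Rightarrow> 'a::euclidean_space"
  assumes ac: "abs_cont_on a b f" and N: "negligible N"
    and der: "\<And>t. t \<in> {a..b} - N \<Longrightarrow> (f has_vector_derivative f' t) (at t within {a..b})"
  shows "f' absolutely_integrable_on {a..b}"
proof (rule absolutely_integrable_on_little_subintervals)
  fix t assume "t \<in> {a..b}"
  obtain \<delta> where \<delta>: "0 < \<delta>" "\<And>\<D>. \<D> division_of \<Union>\<D> \<Longrightarrow> \<Union>\<D> \<subseteq> {a..b} \<Longrightarrow> total_length \<D> < \<delta> \<Longrightarrow>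
      variation f \<D> < 1" using abs_cont_onD[OF ac zero_less_one] by blast
  have int: "(f' has_integral (f v - f u)) {u..v}" if "u \<le> v" "{u..v} \<subseteq> {a..b}" for u v
    by (rule has_integral_derivative_of_abs_cont[OF abs_cont_on_subset[OF ac] that(1) N])
      (use that in \<open>auto intro: has_vector_derivative_within_subset[OF der]\<close>)
  have "f' absolutely_integrable_on cbox c d" if cd: "c \<le> d" "{c..d} \<subseteq> {a..b} \<inter> ball t (\<delta>/2)" for c d
  proof (rule bounded_variation_absolutely_integrable_interval[where B = 1])
    show "f' integrable_on cbox c d" using int[of c d] cd by (auto simp: cbox_interval)
    fix \<D> assume D: "\<D> division_of cbox c d"
    have D': "\<D> division_of \<Union>\<D>" "\<Union>\<D> = {c..d}" using D division_ofD(6)[OF D] by (auto simp: cbox_interval)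
    have "(\<Sum>K\<in>\<D>. norm (integral K f')) = (\<Sum>K\<in>\<D>. norm (f (Sup K) - f (Inf K)))"
    proof (rule sum.cong)
      fix K assume K: "K \<in> \<D>"
      have "integral {Inf K..Sup K} f' = f (Sup K) - f (Inf K)"
      proof (rule integral_unique, rule int)
        show "Inf K \<le> Sup K" by (rule division_real_interval(2)[OF D' (1) K])
        have "K \<subseteq> {a..b}" using K D'(2) cd by blast
        then show "{Inf K..Sup K} \<subseteq> {a..b}" using division_real_interval(1)[OF D'(1) K] by simp
      qed
      then show "norm (integral K f') = norm (f (Sup K) - f (Inf K))"
        using division_real_interval(1)[OF D'(1) K] by simp
    qed simp
    also have "\<dots> < 1"
    proof (rule \<delta>(2)[OF D'(1)])
      show "\<Union>\<D> \<subseteq> {a..b}" using D'(2) cd by blast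
      have "total_length \<D> = (\<Sum>I\<in>\<D>. measure lborel I)"
      proof (rule sum.cong)
        fix K assume K: "K \<in> \<D>"
        have "measure lborel {Inf K..Sup K} = Sup K - Inf K"
          using division_real_interval(2)[OF D'(1) K] by simp
        then show "Sup K - Inf K = measure lborel K"
          using division_real_interval(1)[OF D'(1) K] by simp
      qed simp
      also have "\<dots> = d - c" using additive_content_division[OF D] cd by (simp add: cbox_interval)
      also have "\<dots> < \<delta>"
      proof -
        have "c \<in> ball t (\<delta>/2)" "d \<in> ball t (\<delta>/2)" using cd by auto
        then have "\<bar>t - c\<bar> < \<delta>/2" "\<bar>t - d\<bar> < \<delta>/2" by (auto simp: dist_real_def)
        then show ?thesis by arith
      qed
      finally show "total_length \<D> < \<delta>" .
    qed
    finally show "(\<Sum>K\<in>\<D>. norm (integral K f')) \<le> 1" by simp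
  qed
  then show "\<exists>e>0. \<forall>c d. c \<le> d \<and> {c..d} \<subseteq> {a..b} \<inter> ball t e \<longrightarrow> f' absolutely_integrable_on {c..d}"
    using \<delta>(1) by (intro exI[of _ "\<delta>/2"]) (auto simp: cbox_interval)
qed

section \<open>Smooth maps and an existence theorem for differential equations\<close>

lemma smooth_on_differentiable: "smooth_on S f \<Longrightarrow> x \<in> S \<Longrightarrow> f differentiable (at x)"
  unfolding smooth_on_def by (metis C_k_on.simps(2))

lemma smooth_on_has_derivative:
  "smooth_on S f \<Longrightarrow> x \<in> S \<Longrightarrow> (f has_derivative frechet_derivative f (at x)) (at x)"
  using smooth_on_differentiable frechet_derivative_works by blast

lemma smooth_on_directional_derivative: "smooth_on S f \<Longrightarrow> smooth_on S (\<lambda>x. frechet_derivative f (at x) v)"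
  unfolding smooth_on_def by (metis C_k_on.simps(2))

lemma smooth_on_continuous: "smooth_on S f \<Longrightarrow> continuous_on S f"
  unfolding smooth_on_def by (metis C_k_on.simps(1))

lemma smooth_on_locally_lipschitz:
  fixes f :: "'a::euclidean_space \<Rightarrow> 'b::real_normed_vector"
  assumes f: "smooth_on S f" and S: "open S" "x \<in> S"
  obtains K e where "0 < e" "0 \<le> K" "cball x e \<subseteq> S"
    "\<And>y z. y \<in> cball x e \<Longrightarrow> z \<in> cball x e \<Longrightarrow> norm (f y - f z) \<le> K * norm (y - z)"
proof -
  let ?D = "\<lambda>y. frechet_derivative f (at y)"
  obtain e1 where e1: "0 < e1" "cball x e1 \<subseteq> S" using S open_contains_cball by blast
  have "\<exists>C. \<forall>y\<in>cball x e1. norm (?D y b) \<le> C" for b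
  proof -
    have "continuous_on (cball x e1) (\<lambda>y. ?D y b)"
      by (rule continuous_on_subset[OF smooth_on_continuous[OF smooth_on_directional_derivative[OF f]] e1(2)])
    then have "bounded ((\<lambda>y. ?D y b) ` cball x e1)"
      using compact_imp_bounded compact_continuous_image compact_cball by blast
    then show ?thesis by (auto simp: bounded_iff)
  qed
  then obtain C where C: "\<And>b y. y \<in> cball x e1 \<Longrightarrow> norm (?D y b) \<le> C b" by metis
  define K where "K = (\<Sum>b\<in>Basis. C b)"
  have C0: "0 \<le> C b" for b using C[of x b] e1(1) by (meson centre_in_cball less_imp_le norm_ge_zero order_trans)
  have on: "onorm (?D y) \<le> K" if "y \<in> cball x e1" for y
  proof (rule onorm_le)
    fix h :: 'a
    have lin: "linear (?D y)"
      using smooth_on_has_derivative[OF f] that e1(2) has_derivative_linear by blast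
    have "?D y h = ?D y (\<Sum>b\<in>Basis. (h \<bullet> b) *\<^sub>R b)" by (simp add: euclidean_representation)
    also have "\<dots> = (\<Sum>b\<in>Basis. (h \<bullet> b) *\<^sub>R ?D y b)"
      by (simp add: linear_sum[OF lin] linear_scale[OF lin])
    also have "norm \<dots> \<le> (\<Sum>b\<in>Basis. norm h * C b)"
    proof (rule sum_norm_le)
      fix b :: 'a assume "b \<in> Basis"
      then show "norm ((h \<bullet> b) *\<^sub>R ?D y b) \<le> norm h * C b"
        using C[OF that, of b] Basis_le_norm[of b h] by (auto intro!: mult_mono)
    qed
    finally show "norm (?D y h) \<le> K * norm h" by (simp add: K_def sum_distrib_left mult.commute)
  qed
  have "norm (f y - f z) \<le> K * norm (y - z)" if "y \<in> cball x e1" "z \<in> cball x e1" for y z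
  proof (rule differentiable_bound[OF convex_cball _ on that])
    fix u assume "u \<in> cball x e1"
    then have "u \<in> S" using e1(2) by blast
    then show "(f has_derivative ?D u) (at u within cball x e1)"
      by (rule has_derivative_at_withinI[OF smooth_on_has_derivative[OF f]])
  qed
  moreover have "0 \<le> K" unfolding K_def by (rule sum_nonneg) (use C0 in auto)
  ultimately show thesis using that e1 by blast
qed

text \<open>The mean value theorem, applied in the direction \<open>v\<close> and then in the direction \<open>w\<close>. The left-hand side is
symmetric in \<open>v\<close> and \<open>w\<close>, which gives the symmetry of second derivatives below.\<close>

lemma mixed_difference_mean_value:
  fixes g :: "'a::real_normed_vector \<Rightarrow> real"
  assumes h: "0 < h" "h * (norm v + norm w) < r"
    and gv: "\<And>y. y \<in> ball x r \<Longrightarrow> (g has_derivative Dg y) (at y)"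
    and gw: "\<And>y. y \<in> ball x r \<Longrightarrow> ((\<lambda>y. Dg y v) has_derivative DDg y) (at y)"
  obtains y where "y \<in> ball x r" "norm (y - x) \<le> h * (norm v + norm w)"
    "g (x + h *\<^sub>R v + h *\<^sub>R w) - g (x + h *\<^sub>R v) - g (x + h *\<^sub>R w) + g x = h * h * DDg y w"
proof -
  have near: "norm (s *\<^sub>R v + t *\<^sub>R w) \<le> h * (norm v + norm w)" if "0 \<le> s" "s \<le> h" "0 \<le> t" "t \<le> h" for s t
  proof -
    have "norm (s *\<^sub>R v + t *\<^sub>R w) \<le> norm (s *\<^sub>R v) + norm (t *\<^sub>R w)" by (rule norm_triangle_ineq)
    also have "\<dots> \<le> h * norm v + h * norm w" using that by (auto intro!: add_mono mult_right_mono)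
    finally show ?thesis by (simp add: algebra_simps)
  qed
  have inb: "x + s *\<^sub>R v + t *\<^sub>R w \<in> ball x r" if "0 \<le> s" "s \<le> h" "0 \<le> t" "t \<le> h" for s t
  proof -
    have "x - (x + s *\<^sub>R v + t *\<^sub>R w) = - (s *\<^sub>R v + t *\<^sub>R w)" by simp
    then have "dist x (x + s *\<^sub>R v + t *\<^sub>R w) = norm (s *\<^sub>R v + t *\<^sub>R w)" by (simp only: dist_norm norm_minus_cancel)
    then show ?thesis using near[OF that] h(2) by simp
  qed
  have inb0: "x + s *\<^sub>R v \<in> ball x r" if "0 \<le> s" "s \<le> h" for s
    using inb[OF that, of 0] h(1) by simp
  define \<phi> where "\<phi> s = g (x + s *\<^sub>R v + h *\<^sub>R w) - g (x + s *\<^sub>R v)" for s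
  have "\<exists>\<xi>>0. \<xi> < h \<and> \<phi> h - \<phi> 0 = (h - 0) * (Dg (x + \<xi> *\<^sub>R v + h *\<^sub>R w) v - Dg (x + \<xi> *\<^sub>R v) v)"
  proof (rule MVT2[OF h(1)])
    fix s assume s: "0 \<le> s" "s \<le> h"
    have lin: "linear (Dg (x + s *\<^sub>R v + h *\<^sub>R w))" "linear (Dg (x + s *\<^sub>R v))"
      using gv inb[OF s] inb0[OF s] h(1) has_derivative_linear by (meson less_imp_le order_refl)+
    have "((\<lambda>s. g (x + s *\<^sub>R v + h *\<^sub>R w)) has_derivative (\<lambda>k. Dg (x + s *\<^sub>R v + h *\<^sub>R w) (k *\<^sub>R v))) (at s)"
      by (rule has_derivative_compose[where g = g, OF _ gv]) (use inb[OF s] h(1) in \<open>auto intro!: derivative_eq_intros\<close>)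
    moreover have "((\<lambda>s. g (x + s *\<^sub>R v)) has_derivative (\<lambda>k. Dg (x + s *\<^sub>R v) (k *\<^sub>R v))) (at s)"
      by (rule has_derivative_compose[where g = g, OF _ gv]) (use inb0[OF s] in \<open>auto intro!: derivative_eq_intros\<close>)
    ultimately have "(\<phi> has_derivative (\<lambda>k. Dg (x + s *\<^sub>R v + h *\<^sub>R w) (k *\<^sub>R v) - Dg (x + s *\<^sub>R v) (k *\<^sub>R v))) (at s)"
      unfolding \<phi>_def by (rule has_derivative_diff)
    then show "DERIV \<phi> s :> Dg (x + s *\<^sub>R v + h *\<^sub>R w) v - Dg (x + s *\<^sub>R v) v"
      unfolding has_field_derivative_def
      by (rule has_derivative_eq_rhs) (simp only: fun_eq_iff linear_scale[OF lin(1)] linear_scale[OF lin(2)] real_scaleR_def, simp add: algebra_simps)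
  qed
  then obtain \<xi> where \<xi>: "0 < \<xi>" "\<xi> < h"
    "\<phi> h - \<phi> 0 = h * (Dg (x + \<xi> *\<^sub>R v + h *\<^sub>R w) v - Dg (x + \<xi> *\<^sub>R v) v)" by auto
  define \<psi> where "\<psi> t = Dg (x + \<xi> *\<^sub>R v + t *\<^sub>R w) v" for t
  have "\<exists>\<eta>>0. \<eta> < h \<and> \<psi> h - \<psi> 0 = (h - 0) * DDg (x + \<xi> *\<^sub>R v + \<eta> *\<^sub>R w) w"
  proof (rule MVT2[OF h(1)])
    fix t assume t: "0 \<le> t" "t \<le> h"
    have b: "x + \<xi> *\<^sub>R v + t *\<^sub>R w \<in> ball x r" using inb \<xi> t by auto
    have lin: "linear (DDg (x + \<xi> *\<^sub>R v + t *\<^sub>R w))" using gw[OF b] has_derivative_linear by blast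
    have "(\<psi> has_derivative (\<lambda>k. DDg (x + \<xi> *\<^sub>R v + t *\<^sub>R w) (k *\<^sub>R w))) (at t)"
      unfolding \<psi>_def
      by (rule has_derivative_compose[where f = "\<lambda>t. x + \<xi> *\<^sub>R v + t *\<^sub>R w" and g = "\<lambda>y. Dg y v" and f' = "\<lambda>k. k *\<^sub>R w"])
         (use gw[OF b] in \<open>auto intro!: derivative_eq_intros\<close>)
    then show "DERIV \<psi> t :> DDg (x + \<xi> *\<^sub>R v + t *\<^sub>R w) w"
      unfolding has_field_derivative_def
      by (rule has_derivative_eq_rhs) (simp only: fun_eq_iff linear_scale[OF lin] real_scaleR_def, simp add: algebra_simps)
  qed
  then obtain \<eta> where \<eta>: "0 < \<eta>" "\<eta> < h" "\<psi> h - \<psi> 0 = h * DDg (x + \<xi> *\<^sub>R v + \<eta> *\<^sub>R w) w" by auto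
  show thesis
  proof (rule that)
    show "x + \<xi> *\<^sub>R v + \<eta> *\<^sub>R w \<in> ball x r" using inb \<xi> \<eta> by auto
    show "norm (x + \<xi> *\<^sub>R v + \<eta> *\<^sub>R w - x) \<le> h * (norm v + norm w)" using near[of \<xi> \<eta>] \<xi> \<eta> by (simp add: add.assoc)
    have "\<phi> h - \<phi> 0 = h * (\<psi> h - \<psi> 0)" using \<xi>(3) by (simp add: \<psi>_def)
    also have "\<dots> = h * h * DDg (x + \<xi> *\<^sub>R v + \<eta> *\<^sub>R w) w" using \<eta>(3) by simp
    finally show "g (x + h *\<^sub>R v + h *\<^sub>R w) - g (x + h *\<^sub>R v) - g (x + h *\<^sub>R w) + g x = h * h * DDg (x + \<xi> *\<^sub>R v + \<eta> *\<^sub>R w) w"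
      by (simp add: \<phi>_def)
  qed
qed

lemma smooth_on_second_derivative_symmetric:
  fixes f :: "'a::real_normed_vector \<Rightarrow> 'b::euclidean_space"
  assumes f: "smooth_on S f" and S: "open S" "x \<in> S"
  shows "frechet_derivative (\<lambda>y. frechet_derivative f (at y) v) (at x) w =
         frechet_derivative (\<lambda>y. frechet_derivative f (at y) w) (at x) v"
proof (rule euclidean_eqI)
  fix b :: 'b assume b: "b \<in> Basis"
  let ?D = "\<lambda>y. frechet_derivative f (at y)"
  let ?H = "\<lambda>v y. frechet_derivative (\<lambda>y. ?D y v) (at y)"
  obtain r where r: "0 < r" "ball x r \<subseteq> S" using S openE by blast
  have D1: "((\<lambda>y. f y \<bullet> b) has_derivative (\<lambda>h. ?D y h \<bullet> b)) (at y)" if "y \<in> ball x r" for y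
    using smooth_on_has_derivative[OF f] that r by (auto intro!: has_derivative_inner_left)
  have D2: "((\<lambda>y. ?D y v \<bullet> b) has_derivative (\<lambda>h. ?H v y h \<bullet> b)) (at y)" if "y \<in> ball x r" for y v
    using smooth_on_has_derivative[OF smooth_on_directional_derivative[OF f]] that r
    by (auto intro!: has_derivative_inner_left)
  have cont: "isCont (\<lambda>y. ?H v y w \<bullet> b) x" for v w
  proof -
    have "continuous_on S (\<lambda>y. ?H v y w)"
      by (intro smooth_on_continuous smooth_on_directional_derivative f)
    then have "isCont (\<lambda>y. ?H v y w) x" using S continuous_on_eq_continuous_at by blast
    then show ?thesis by (intro continuous_intros)
  qed
  define H where "H n = r / 2 / (norm v + norm w + 1) / real (Suc n)" for n
  have H: "0 < H n" "H n * (norm v + norm w) < r" for n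
  proof -
    have p: "0 < norm v + norm w + 1" by (simp add: add_nonneg_pos)
    show "0 < H n" using r(1) p by (simp add: H_def)
    have "H n \<le> r / 2 / (norm v + norm w + 1)" using r(1) p by (simp add: H_def divide_le_eq mult_le_cancel_left1)
    then have "H n * (norm v + norm w) \<le> r / 2 / (norm v + norm w + 1) * (norm v + norm w + 1)"
      using r(1) p by (intro mult_mono) auto
    also have "\<dots> = r / 2" by (rule nonzero_eq_divide_eq[THEN iffD1, OF _ refl]) (use p in simp)
    finally show "H n * (norm v + norm w) < r" using r(1) by simp
  qed
  have H0: "H \<longlonglongrightarrow> 0" unfolding H_def by (rule LIMSEQ_Suc[OF lim_const_over_n])
  let ?\<Delta> = "\<lambda>v w h. f (x + h *\<^sub>R v + h *\<^sub>R w) \<bullet> b - f (x + h *\<^sub>R v) \<bullet> b - f (x + h *\<^sub>R w) \<bullet> b + f x \<bullet> b"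
  have lim: "(\<lambda>n. ?\<Delta> v w (H n) / (H n * H n)) \<longlonglongrightarrow> ?H v x w \<bullet> b"
    if H: "\<And>n. 0 < H n" "\<And>n. H n * (norm v + norm w) < r" for v w
  proof -
    have "\<exists>y. norm (y - x) \<le> H n * (norm v + norm w) \<and> ?\<Delta> v w (H n) = H n * H n * (?H v y w \<bullet> b)" for n
    proof -
      obtain y where "norm (y - x) \<le> H n * (norm v + norm w)" "?\<Delta> v w (H n) = H n * H n * (?H v y w \<bullet> b)"
        by (rule mixed_difference_mean_value[OF H(1) H(2), where x = x and g = "\<lambda>y. f y \<bullet> b"
              and Dg = "\<lambda>y h. ?D y h \<bullet> b" and DDg = "\<lambda>y h. ?H v y h \<bullet> b"]) (use D1 D2 in auto)
      then show ?thesis by blast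
    qed
    then obtain y where y: "\<And>n. norm (y n - x) \<le> H n * (norm v + norm w)"
      "\<And>n. ?\<Delta> v w (H n) = H n * H n * (?H v (y n) w \<bullet> b)" by metis
    have "(\<lambda>n. H n * (norm v + norm w)) \<longlonglongrightarrow> 0" using tendsto_mult_left_zero[OF H0] .
    then have "(\<lambda>n. y n - x) \<longlonglongrightarrow> 0"
      by (rule tendsto_0_le[where K = 1]) (use y(1) in \<open>auto intro!: always_eventually order_trans[OF _ abs_ge_self]\<close>)
    then have "y \<longlonglongrightarrow> x" by (simp add: LIM_zero_iff)
    then have "(\<lambda>n. ?H v (y n) w \<bullet> b) \<longlonglongrightarrow> ?H v x w \<bullet> b" by (rule isCont_tendsto_compose[OF cont])
    moreover have "?\<Delta> v w (H n) / (H n * H n) = ?H v (y n) w \<bullet> b" for n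
      using y(2)[of n] H(1)[of n] by simp
    ultimately show ?thesis by simp
  qed
  have eq: "?\<Delta> v w h = ?\<Delta> w v h" for h by (simp add: algebra_simps)
  have "(\<lambda>n. ?\<Delta> v w (H n) / (H n * H n)) \<longlonglongrightarrow> ?H v x w \<bullet> b" by (rule lim) (use H in auto)
  moreover have "(\<lambda>n. ?\<Delta> w v (H n) / (H n * H n)) \<longlonglongrightarrow> ?H w x v \<bullet> b"
    by (rule lim) (use H in \<open>auto simp: add.commute\<close>)
  ultimately show "?H v x w \<bullet> b = ?H w x v \<bullet> b" unfolding eq by (rule LIMSEQ_unique)
qed

text \<open>Banach's fixed point theorem for the integral operator on bounded continuous functions. Time is clamped to
\<open>{-r..r}\<close>, so that the operator acts on functions on the whole line, and the integral is taken from \<open>-r\<close> and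
normalised at \<open>0\<close>, which yields a solution on both sides of \<open>0\<close>.\<close>

theorem picard_lindelof_autonomous:
  fixes F :: "'a::euclidean_space \<Rightarrow> 'a"
  assumes \<rho>: "0 < \<rho>" and K: "0 \<le> K"
    and lip: "\<And>y z. y \<in> cball x0 \<rho> \<Longrightarrow> z \<in> cball x0 \<rho> \<Longrightarrow> norm (F y - F z) \<le> K * norm (y - z)"
  obtains r y where "0 < r" "y 0 = x0" "\<And>t. y t \<in> cball x0 \<rho>"
    "\<And>t. t \<in> {-r..r} \<Longrightarrow> (y has_vector_derivative F (y t)) (at t within {-r..r})"
proof -
  define M where "M = norm (F x0) + K * \<rho>"
  have M: "norm (F y) \<le> M" if "y \<in> cball x0 \<rho>" for y
  proof -
    have "norm (F y) \<le> norm (F x0) + norm (F y - F x0)" by (metis norm_triangle_sub)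
    also have "\<dots> \<le> norm (F x0) + K * norm (y - x0)" using lip[OF that, of x0] \<rho> by simp
    also have "K * norm (y - x0) \<le> K * \<rho>" using that K by (intro mult_left_mono) (auto simp: dist_norm norm_minus_commute)
    finally show ?thesis by (simp add: M_def)
  qed
  have M0: "0 \<le> M" unfolding M_def using K \<rho> by (intro add_nonneg_nonneg mult_nonneg_nonneg) auto
  define r where "r = min (\<rho> / (M + 1)) (1 / 2 / (K + 1))"
  have r: "0 < r" using \<rho> M0 K by (simp add: r_def)
  have rM: "M * r \<le> \<rho>"
  proof -
    have "M * r \<le> (M + 1) * (\<rho> / (M + 1))" using M0 r by (intro mult_mono) (auto simp: r_def)
    then show ?thesis using M0 by simp
  qed
  have rK: "K * r \<le> 1 / 2"
  proof -
    have "K * r \<le> (K + 1) * (1 / 2 / (K + 1))" using K r by (intro mult_mono) (auto simp: r_def)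
    also have "\<dots> = 1 / 2" by (rule nonzero_mult_div_cancel_left[of "K + 1", simplified times_divide_eq_right[symmetric]]) (use K in simp)
    finally show ?thesis .
  qed
  have Fcont: "continuous_on (cball x0 \<rho>) F"
    by (rule lipschitz_on_continuous_on[of K]) (auto simp: lipschitz_on_def dist_norm K lip)
  define c where "c t = max (- r) (min r t)" for t :: real
  have c: "- r \<le> c t" "c t \<le> r" for t using r by (auto simp: c_def)
  define J where "J h t = integral {-r..c t} h - integral {-r..0} h" for h :: "real \<Rightarrow> 'a" and t
  have Jbound: "norm (J h t) \<le> B * r" if h: "continuous_on {-r..r} h" and B: "\<And>s. norm (h s) \<le> B" for h t B
  proof -
    have B0: "0 \<le> B" using B[of 0] norm_ge_zero order_trans by blast
    have int: "h integrable_on {u..v}" if "- r \<le> u" "v \<le> r" for u v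
      by (rule integrable_continuous_real[OF continuous_on_subset[OF h]]) (use that in auto)
    have bnd: "norm (integral {u..v} h) \<le> B * r" if "- r \<le> u" "u \<le> v" "v \<le> r" "v - u \<le> r" for u v
    proof -
      have "norm (integral {u..v} h) \<le> integral {u..v} (\<lambda>_. B)"
        by (rule integral_norm_bound_integral) (use int that B in auto)
      also have "\<dots> = B * (v - u)" using that by simp
      also have "\<dots> \<le> B * r" using that B0 by (intro mult_left_mono)
      finally show ?thesis .
    qed
    show ?thesis
    proof (cases "0 \<le> c t")
      case True
      have "integral {-r..0} h + integral {0..c t} h = integral {-r..c t} h"
        by (rule Henstock_Kurzweil_Integration.integral_combine) (use True r c[of t] int in auto)
      then have "J h t = integral {0..c t} h" unfolding J_def by (metis add_diff_cancel_left')
      then show ?thesis using bnd[of 0 "c t"] True c[of t] r by simp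
    next
      case False
      have "integral {-r..c t} h + integral {c t..0} h = integral {-r..0} h"
        by (rule Henstock_Kurzweil_Integration.integral_combine) (use False r c[of t] int in auto)
      then have "J h t = - integral {c t..0} h" unfolding J_def by (metis add_diff_cancel_left' minus_diff_eq)
      then show ?thesis using bnd[of "c t" 0] False c[of t] r by simp
    qed
  qed
  have Jcont: "continuous_on UNIV (J h)" if h: "continuous_on {-r..r} h" for h
  proof -
    have 1: "continuous_on {-r..r} (\<lambda>t. integral {-r..t} h)"
      by (rule indefinite_integral_continuous_1[OF integrable_continuous_real[OF h]])
    have "continuous_on UNIV c" unfolding c_def by (intro continuous_intros)
    then have "continuous_on UNIV (\<lambda>t. integral {-r..c t} h)"
      by (rule continuous_on_compose2[OF 1]) (use c in auto)
    then show ?thesis unfolding J_def by (intro continuous_intros)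
  qed
  define S where "S = PiC UNIV (\<lambda>_::real. cball x0 \<rho>)"
  have S: "f \<in> S \<longleftrightarrow> (\<forall>t. apply_bcontfun f t \<in> cball x0 \<rho>)" for f
    by (auto simp: S_def mem_PiC_iff Pi_def)
  have Fc: "continuous_on T (\<lambda>s. F (apply_bcontfun f s))" if "f \<in> S" for f T
    by (rule continuous_on_compose2[OF Fcont]) (use that S in auto)
  define P where "P f = Bcontfun (\<lambda>t. x0 + J (\<lambda>s. F (apply_bcontfun f s)) t)" for f
  have P: "apply_bcontfun (P f) t = x0 + J (\<lambda>s. F (apply_bcontfun f s)) t"
    "J (\<lambda>s. F (apply_bcontfun f s)) t \<in> cball 0 \<rho>" if f: "f \<in> S" for f t
  proof -
    have Jb: "norm (J (\<lambda>s. F (apply_bcontfun f s)) t) \<le> M * r" for t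
      by (rule Jbound[OF Fc[OF f]]) (use M f S in auto)
    then show "J (\<lambda>s. F (apply_bcontfun f s)) t \<in> cball 0 \<rho>" using rM by (auto intro: order_trans)
    have "(\<lambda>t. x0 + J (\<lambda>s. F (apply_bcontfun f s)) t) \<in> bcontfun"
    proof (rule bcontfun_normI)
      show "continuous_on UNIV (\<lambda>t. x0 + J (\<lambda>s. F (apply_bcontfun f s)) t)"
        by (intro continuous_intros Jcont Fc f)
      show "norm (x0 + J (\<lambda>s. F (apply_bcontfun f s)) t) \<le> norm x0 + M * r" for t
        using Jb[of t] by (meson add_left_mono norm_triangle_ineq order_trans)
    qed
    then show "apply_bcontfun (P f) t = x0 + J (\<lambda>s. F (apply_bcontfun f s)) t"
      by (simp add: P_def Bcontfun_inverse)
  qed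
  have "\<exists>!f\<in>S. P f = f"
  proof (rule Banach_fix[where c = "1/2"])
    have "closed S" unfolding S_def by (rule closed_PiC) auto
    then show "complete S" by (simp add: complete_eq_closed)
    have "const_bcontfun x0 \<in> S" using \<rho> by (simp add: S const_bcontfun.rep_eq)
    then show "S \<noteq> {}" by blast
    show "P ` S \<subseteq> S" using P by (auto simp: S dist_norm)
    fix f g assume f: "f \<in> S" and g: "g \<in> S"
    have int: "(\<lambda>s. F (apply_bcontfun f s)) integrable_on {u..v}" if "f \<in> S" for f u v
      by (rule integrable_continuous_real[OF Fc[OF that]])
    show "dist (P f) (P g) \<le> 1/2 * dist f g"
    proof (rule dist_bound)
      fix t
      have "apply_bcontfun (P f) t - apply_bcontfun (P g) t = J (\<lambda>s. F (apply_bcontfun f s) - F (apply_bcontfun g s)) t"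
        unfolding P(1)[OF f] P(1)[OF g] J_def by (simp add: integral_diff int f g)
      also have "norm \<dots> \<le> (K * dist f g) * r"
      proof (rule Jbound)
        show "continuous_on {-r..r} (\<lambda>s. F (apply_bcontfun f s) - F (apply_bcontfun g s))"
          by (intro continuous_intros Fc f g)
        fix s
        have "norm (F (apply_bcontfun f s) - F (apply_bcontfun g s)) \<le> K * norm (apply_bcontfun f s - apply_bcontfun g s)"
          using f g S by (intro lip) auto
        also have "\<dots> \<le> K * dist f g" using dist_bounded[of f s g] K by (intro mult_left_mono) (auto simp: dist_norm)
        finally show "norm (F (apply_bcontfun f s) - F (apply_bcontfun g s)) \<le> K * dist f g" .
      qed
      also have "\<dots> = (K * r) * dist f g" by simp
      also have "\<dots> \<le> 1/2 * dist f g" using rK by (intro mult_right_mono) auto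
      finally show "dist (apply_bcontfun (P f) t) (apply_bcontfun (P g) t) \<le> 1/2 * dist f g" by (simp add: dist_norm)
    qed
  qed auto
  then obtain f where f: "f \<in> S" "P f = f" by blast
  let ?y = "apply_bcontfun f"
  have y: "?y t = x0 + J (\<lambda>s. F (?y s)) t" for t using P(1)[OF f(1), of t] unfolding f(2) .
  show thesis
  proof (rule that[OF r])
    show "?y 0 = x0" using r by (subst y) (simp add: J_def c_def)
    show "?y t \<in> cball x0 \<rho>" for t using f(1) S by blast
    fix t assume t: "t \<in> {-r..r}"
    have "((\<lambda>t. x0 + (integral {-r..t} (\<lambda>s. F (?y s)) - integral {-r..0} (\<lambda>s. F (?y s)))) has_vector_derivative F (?y t)) (at t within {-r..r})"
      using integral_has_vector_derivative[OF Fc[OF f(1)] t]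
      by (auto intro!: derivative_eq_intros)
    moreover have "?y s = x0 + (integral {-r..s} (\<lambda>s. F (?y s)) - integral {-r..0} (\<lambda>s. F (?y s)))" if "s \<in> {-r..r}" for s
    proof -
      have "c s = s" using that by (auto simp: c_def)
      then show ?thesis by (subst y) (simp add: J_def)
    qed
    ultimately show "(?y has_vector_derivative F (?y t)) (at t within {-r..r})"
      using t by (intro has_vector_derivative_transform[where g = ?y]) auto
  qed
qed

section \<open>Lie groups in charts\<close>

text \<open>Chart expressions have arbitrary values outside their domain, and \<open>frechet_derivative\<close> is taken on the whole
space; on an open set this makes no difference.\<close>

lemma C_k_on_cong:
  assumes "open S" "\<And>x. x \<in> S \<Longrightarrow> f x = g x"
  shows "C_k_on n S f \<longleftrightarrow> C_k_on n S g"
  using assms(2)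
proof (induction n arbitrary: f g)
  case 0
  then show ?case by (simp cong: continuous_on_cong)
next
  case (Suc n)
  have d: "f differentiable (at x) \<longleftrightarrow> g differentiable (at x)" if "x \<in> S" for x
    unfolding differentiable_def
    using has_derivative_transform_within_open[OF _ assms(1) that, of f _ UNIV g]
      has_derivative_transform_within_open[OF _ assms(1) that, of g _ UNIV f] Suc.prems by metis
  have fd: "frechet_derivative f (at x) v = frechet_derivative g (at x) v" if "\<forall>x\<in>S. f differentiable (at x)" "x \<in> S" for x v
    using frechet_derivative_transform_within_open[OF _ assms(1) that(2), of f g] that Suc.prems by metis
  show ?case
  proof (cases "\<forall>x\<in>S. f differentiable (at x)")
    case True
    then have "C_k_on n S (\<lambda>x. frechet_derivative f (at x) v) \<longleftrightarrow> C_k_on n S (\<lambda>x. frechet_derivative g (at x) v)" for v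
      using Suc.IH fd by presburger
    then show ?thesis using d by simp
  next
    case False
    then have "\<not> (\<forall>x\<in>S. g differentiable (at x))" using d by blast
    with False show ?thesis unfolding C_k_on.simps by blast
  qed
qed

lemma smooth_on_cong: "open S \<Longrightarrow> (\<And>x. x \<in> S \<Longrightarrow> f x = g x) \<Longrightarrow> smooth_on S f \<longleftrightarrow> smooth_on S g"
  unfolding smooth_on_def using C_k_on_cong by blast

locale lie_group_atlas =
  fixes A :: "('g::{group_add, t2_space, second_countable_topology}, 'e::euclidean_space) chart set"
  assumes lie: "lie_group A"
begin

abbreviation cinv :: "('g, 'e) chart \<Rightarrow> 'e \<Rightarrow> 'g" where "cinv c \<equiv> inv_into (fst c) (snd c)"
abbreviation c0 :: "('g, 'e) chart" where "c0 \<equiv> pref_chart A 0"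
abbreviation \<phi> :: "'g \<Rightarrow> 'e" where "\<phi> \<equiv> chart_at A 0"
abbreviation \<psi> :: "'e \<Rightarrow> 'g" where "\<psi> \<equiv> cinv c0"
abbreviation x0 :: 'e where "x0 \<equiv> \<phi> 0"

lemma atlas: "smooth_atlas A" using lie by (simp add: lie_group_def)

lemma chart_homeomorphism:
  assumes "c \<in> A"
  shows "open (fst c)" "open (snd c ` fst c)" "homeomorphism (fst c) (snd c ` fst c) (snd c) (cinv c)"
proof -
  have "\<forall>(U, \<phi>)\<in>A. open U \<and> open (\<phi> ` U) \<and> homeomorphism U (\<phi> ` U) \<phi> (inv_into U \<phi>)"
    using atlas unfolding smooth_atlas_def by (elim conjE)
  from bspec[OF this assms]
  show "open (fst c)" "open (snd c ` fst c)" "homeomorphism (fst c) (snd c ` fst c) (snd c) (cinv c)"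
    by (simp_all add: split_beta)
qed

lemma chart_inverse:
  assumes "c \<in> A"
  shows "p \<in> fst c \<Longrightarrow> cinv c (snd c p) = p"
    "y \<in> snd c ` fst c \<Longrightarrow> snd c (cinv c y) = y" "y \<in> snd c ` fst c \<Longrightarrow> cinv c y \<in> fst c"
  using chart_homeomorphism(3)[OF assms]
  by (auto simp: homeomorphism_def)

lemma chart_continuous:
  assumes "c \<in> A"
  shows "continuous_on (fst c) (snd c)" "continuous_on (snd c ` fst c) (cinv c)"
  using chart_homeomorphism(3)[OF assms] by (auto simp: homeomorphism_def)

lemma pref_chart: "pref_chart A p \<in> A" "p \<in> fst (pref_chart A p)"
proof -
  have "(\<Union>(U, \<phi>)\<in>A. U) = UNIV" using atlas unfolding smooth_atlas_def by (elim conjE)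
  then have "p \<in> (\<Union>c\<in>A. fst c)" by (simp add: split_beta)
  then have "\<exists>c. c \<in> A \<and> p \<in> fst c" by blast
  then have "pref_chart A p \<in> A \<and> p \<in> fst (pref_chart A p)" unfolding pref_chart_def by (rule someI_ex)
  then show "pref_chart A p \<in> A" "p \<in> fst (pref_chart A p)" by auto
qed

lemma continuous_on_add: "continuous_on UNIV (\<lambda>(p, q). p + q :: 'g)"
  using lie unfolding lie_group_def smooth_map_def by blast

lemma continuous_on_uminus: "continuous_on UNIV (uminus :: 'g \<Rightarrow> 'g)"
  using lie unfolding lie_group_def smooth_map_def by blast

lemma tendsto_group_add: "(f \<longlongrightarrow> a) F \<Longrightarrow> (g \<longlongrightarrow> b) F \<Longrightarrow> ((\<lambda>x. f x + g x :: 'g) \<longlongrightarrow> a + b) F"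
  using continuous_on_add
    continuous_on_tendsto_compose[of UNIV "\<lambda>(p, q). p + q :: 'g" "\<lambda>x. (f x, g x)" "(a, b)" F]
  by (auto intro: tendsto_Pair)

lemma tendsto_group_uminus: "(f \<longlongrightarrow> a) F \<Longrightarrow> ((\<lambda>x. - f x :: 'g) \<longlongrightarrow> - a) F"
  using continuous_on_tendsto_compose[OF continuous_on_uminus, of f a F] by auto

lemma tendsto_group_diff: "(f \<longlongrightarrow> a) F \<Longrightarrow> (g \<longlongrightarrow> b) F \<Longrightarrow> ((\<lambda>x. f x - g x :: 'g) \<longlongrightarrow> a - b) F"
  using tendsto_group_add[OF _ tendsto_group_uminus, of f a F g b] by simp

lemmas group_tendsto = tendsto_group_add tendsto_group_uminus tendsto_group_diff

lemma isCont_cinv: "c \<in> A \<Longrightarrow> y \<in> snd c ` fst c \<Longrightarrow> isCont (cinv c) y"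
  using chart_continuous(2) chart_homeomorphism(2) continuous_on_eq_continuous_at by blast

definition add_chart :: "('g, 'e) chart \<Rightarrow> ('g, 'e) chart \<Rightarrow> ('g, 'e) chart \<Rightarrow> 'e \<times> 'e \<Rightarrow> 'e" where
  "add_chart c1 c2 c3 z = snd c3 (cinv c1 (fst z) + cinv c2 (snd z))"

text \<open>The coordinates at which \<open>add_chart c1 c2 c3\<close>, the group operation read in three charts, is meaningful.\<close>

definition add_dom :: "('g, 'e) chart \<Rightarrow> ('g, 'e) chart \<Rightarrow> ('g, 'e) chart \<Rightarrow> ('e \<times> 'e) set" where
  "add_dom c1 c2 c3 = {z. fst z \<in> snd c1 ` fst c1 \<and> snd z \<in> snd c2 ` fst c2 \<and> cinv c1 (fst z) + cinv c2 (snd z) \<in> fst c3}"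

lemma add_dom_mem:
  "c1 \<in> A \<Longrightarrow> c2 \<in> A \<Longrightarrow> p \<in> fst c1 \<Longrightarrow> q \<in> fst c2 \<Longrightarrow> p + q \<in> fst c3 \<Longrightarrow> (snd c1 p, snd c2 q) \<in> add_dom c1 c2 c3"
  by (auto simp: add_dom_def chart_inverse)

lemma open_add_dom:
  assumes "c1 \<in> A" "c2 \<in> A" "c3 \<in> A"
  shows "open (add_dom c1 c2 c3)"
proof -
  let ?P = "(snd c1 ` fst c1) \<times> (snd c2 ` fst c2)"
  have P: "open ?P" using assms chart_homeomorphism(2) by (intro open_Times) auto
  have "continuous_on ?P (\<lambda>z. (cinv c1 (fst z), cinv c2 (snd z)))"
    by (intro continuous_on_Pair continuous_on_compose2[OF chart_continuous(2)[OF assms(1)]]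
        continuous_on_compose2[OF chart_continuous(2)[OF assms(2)]] continuous_intros) auto
  then have "continuous_on ?P (\<lambda>z. cinv c1 (fst z) + cinv c2 (snd z))"
    using continuous_on_compose2[OF continuous_on_add, of ?P "\<lambda>z. (cinv c1 (fst z), cinv c2 (snd z))"] by auto
  then have "open (?P \<inter> (\<lambda>z. cinv c1 (fst z) + cinv c2 (snd z)) -` fst c3)"
    by (rule continuous_open_preimage[OF _ P chart_homeomorphism(1)[OF assms(3)]])
  moreover have "?P \<inter> (\<lambda>z. cinv c1 (fst z) + cinv c2 (snd z)) -` fst c3 = add_dom c1 c2 c3"
    by (auto simp: add_dom_def)
  ultimately show ?thesis by simp
qed

lemma smooth_on_add_chart:
  assumes c: "c1 \<in> A" "c2 \<in> A" "c3 \<in> A"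
  shows "smooth_on (add_dom c1 c2 c3) (add_chart c1 c2 c3)"
proof -
  let ?f = "snd c3 \<circ> (\<lambda>(p, q). p + q) \<circ> inv_into (fst c1 \<times> fst c2) (map_prod (snd c1) (snd c2))"
  have m: "(fst c1 \<times> fst c2, map_prod (snd c1) (snd c2)) \<in> prod_atlas A A"
    using c unfolding prod_atlas_def by (intro image_eqI[where x = "(c1, c2)"]) (auto simp: split_def)
  have "smooth_map (prod_atlas A A) A (\<lambda>(p, q). p + q :: 'g)" using lie by (simp add: lie_group_def)
  then have "\<forall>(U, \<phi>)\<in>prod_atlas A A. \<forall>(V, \<psi>)\<in>A.
      smooth_on (\<phi> ` (U \<inter> (\<lambda>(p, q). p + q :: 'g) -` V)) (\<psi> \<circ> (\<lambda>(p, q). p + q) \<circ> inv_into U \<phi>)"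
    unfolding smooth_map_def by (elim conjE)
  from bspec[OF this m] have "\<forall>(V, \<psi>)\<in>A. smooth_on (map_prod (snd c1) (snd c2) ` ((fst c1 \<times> fst c2) \<inter> (\<lambda>(p, q). p + q) -` V))
      (\<psi> \<circ> (\<lambda>(p, q). p + q) \<circ> inv_into (fst c1 \<times> fst c2) (map_prod (snd c1) (snd c2)))"
    by (simp only: prod.case)
  from bspec[OF this c(3)]
  have sm: "smooth_on (map_prod (snd c1) (snd c2) ` ((fst c1 \<times> fst c2) \<inter> (\<lambda>(p, q). p + q) -` fst c3)) ?f"
    by (simp only: split_beta)
  have inv: "inv_into (fst c1 \<times> fst c2) (map_prod (snd c1) (snd c2)) (snd c1 p, snd c2 q) = (p, q)"
    if "p \<in> fst c1" "q \<in> fst c2" for p q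
  proof -
    have "inj_on (map_prod (snd c1) (snd c2)) (fst c1 \<times> fst c2)"
      using chart_inverse(1)[OF c(1)] chart_inverse(1)[OF c(2)]
      by (intro map_prod_inj_on) (metis inj_onI)+
    from inv_into_f_f[OF this, of "(p, q)"] that show ?thesis by simp
  qed
  have dom: "map_prod (snd c1) (snd c2) ` ((fst c1 \<times> fst c2) \<inter> (\<lambda>(p, q). p + q) -` fst c3) = add_dom c1 c2 c3"
  proof (intro equalityI subsetI)
    fix z assume "z \<in> add_dom c1 c2 c3"
    then have z: "fst z \<in> snd c1 ` fst c1" "snd z \<in> snd c2 ` fst c2" "cinv c1 (fst z) + cinv c2 (snd z) \<in> fst c3"
      by (auto simp: add_dom_def)
    show "z \<in> map_prod (snd c1) (snd c2) ` ((fst c1 \<times> fst c2) \<inter> (\<lambda>(p, q). p + q) -` fst c3)"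
      by (rule image_eqI[where x = "(cinv c1 (fst z), cinv c2 (snd z))"])
         (use z chart_inverse[OF c(1)] chart_inverse[OF c(2)] in \<open>auto simp: prod_eq_iff\<close>)
  qed (auto simp: add_dom_def chart_inverse c)
  have eq: "?f z = add_chart c1 c2 c3 z" if z: "z \<in> add_dom c1 c2 c3" for z
  proof -
    obtain p q where "p \<in> fst c1" "q \<in> fst c2" "z = (snd c1 p, snd c2 q)"
    proof -
      have "fst z \<in> snd c1 ` fst c1" "snd z \<in> snd c2 ` fst c2" using z by (auto simp: add_dom_def)
      then obtain p q where "p \<in> fst c1" "q \<in> fst c2" "fst z = snd c1 p" "snd z = snd c2 q" by blast
      then show thesis using that by (metis prod.collapse)
    qed
    then show ?thesis using inv c by (simp add: add_chart_def chart_inverse)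
  qed
  from sm[unfolded dom] smooth_on_cong[OF open_add_dom[OF c], of ?f] eq show ?thesis by blast
qed

text \<open>Continuity of \<open>f\<close> is demanded separately: the chart \<open>c'\<close> has arbitrary values outside its domain, so a
differentiable coordinate expression alone does not imply it.\<close>

definition chart_derivative :: "('g, 'e) chart \<Rightarrow> ('g, 'e) chart \<Rightarrow> ('g \<Rightarrow> 'g) \<Rightarrow> 'g \<Rightarrow> ('e \<Rightarrow> 'e) \<Rightarrow> bool" where
  "chart_derivative c c' f p L \<longleftrightarrow> c \<in> A \<and> c' \<in> A \<and> p \<in> fst c \<and> f p \<in> fst c' \<and> isCont f p \<and>
     ((\<lambda>y. snd c' (f (cinv c y))) has_derivative L) (at (snd c p))"

lemma chart_derivative_compose:
  assumes f: "chart_derivative c c' f p L" and g: "chart_derivative c' c'' g (f p) M"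
  shows "chart_derivative c c'' (\<lambda>x. g (f x)) p (\<lambda>v. M (L v))"
proof -
  have c: "c \<in> A" "c' \<in> A" "p \<in> fst c" "f p \<in> fst c'" "isCont f p" "isCont g (f p)" "c'' \<in> A" "g (f p) \<in> fst c''"
    using f g by (auto simp: chart_derivative_def)
  have df: "((\<lambda>y. snd c' (f (cinv c y))) has_derivative L) (at (snd c p))" using f by (simp add: chart_derivative_def)
  have dg: "((\<lambda>y. snd c'' (g (cinv c' y))) has_derivative M) (at (snd c' (f (cinv c (snd c p)))))"
    using g c by (simp add: chart_derivative_def chart_inverse)
  have comp: "((\<lambda>y. snd c'' (g (cinv c' (snd c' (f (cinv c y)))))) has_derivative (\<lambda>v. M (L v))) (at (snd c p))"
    by (rule has_derivative_compose[OF df dg])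
  have "(\<lambda>y. f (cinv c y)) \<midarrow>snd c p\<rightarrow> f p"
    using isCont_cinv[OF c(1), of "snd c p"] c(3,5) isCont_tendsto_compose[of p f "cinv c"]
    by (auto simp: isCont_def chart_inverse c(1))
  then have "\<forall>\<^sub>F y in at (snd c p). f (cinv c y) \<in> fst c'"
    using topological_tendstoD chart_homeomorphism(1)[OF c(2)] c(4) by metis
  then have "\<forall>\<^sub>F y in at (snd c p). snd c'' (g (cinv c' (snd c' (f (cinv c y))))) = snd c'' (g (f (cinv c y)))"
    by eventually_elim (simp add: chart_inverse c)
  then have "((\<lambda>y. snd c'' (g (f (cinv c y)))) has_derivative (\<lambda>v. M (L v))) (at (snd c p))"
    by (rule has_derivative_transform_eventually[OF comp]) (auto simp: chart_inverse c)
  moreover have "isCont (\<lambda>x. g (f x)) p" using c(5,6) isCont_o2 by blast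
  ultimately show ?thesis using c by (simp add: chart_derivative_def)
qed

lemma chart_derivative_unique: "chart_derivative c c' f p L \<Longrightarrow> chart_derivative c c' f p M \<Longrightarrow> L = M"
  unfolding chart_derivative_def using has_derivative_unique by blast

lemma chart_derivative_linear: "chart_derivative c c' f p L \<Longrightarrow> linear L"
  unfolding chart_derivative_def using has_derivative_linear by blast

lemma chart_derivative_id: "c \<in> A \<Longrightarrow> p \<in> fst c \<Longrightarrow> chart_derivative c c (\<lambda>x. x) p (\<lambda>v. v)"
  unfolding chart_derivative_def
  by (auto intro!: has_derivative_transform_within_open[OF has_derivative_ident chart_homeomorphism(2)] simp: chart_inverse)

lemma chart_derivative_left_translation:
  assumes c: "c \<in> A" "c' \<in> A" "q \<in> fst c" "p + q \<in> fst c'"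
  obtains L where "chart_derivative c c' (\<lambda>x. p + x) q L"
proof -
  let ?cp = "pref_chart A p"
  have "((add_chart ?cp c c') has_derivative frechet_derivative (add_chart ?cp c c') (at (snd ?cp p, snd c q)))
     (at (snd ?cp p, snd c q))"
    by (rule smooth_on_has_derivative[OF smooth_on_add_chart]) (use add_dom_mem pref_chart c in auto)
  then have "((\<lambda>y. add_chart ?cp c c' (snd ?cp p, y)) has_derivative
      (\<lambda>v. frechet_derivative (add_chart ?cp c c') (at (snd ?cp p, snd c q)) (0, v))) (at (snd c q))"
    by (rule has_derivative_compose[rotated]) (auto intro!: derivative_eq_intros)
  moreover have "isCont (\<lambda>x. p + x) q" unfolding isCont_def by (intro group_tendsto tendsto_intros)
  ultimately show thesis
    by (intro that) (auto simp: chart_derivative_def c add_chart_def chart_inverse pref_chart)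
qed

lemma chart_derivative_right_translation:
  assumes c: "c \<in> A" "c' \<in> A" "q \<in> fst c" "q + p \<in> fst c'"
  obtains L where "chart_derivative c c' (\<lambda>x. x + p) q L"
proof -
  let ?cp = "pref_chart A p"
  have "((add_chart c ?cp c') has_derivative frechet_derivative (add_chart c ?cp c') (at (snd c q, snd ?cp p)))
     (at (snd c q, snd ?cp p))"
    by (rule smooth_on_has_derivative[OF smooth_on_add_chart]) (use add_dom_mem pref_chart c in auto)
  then have "((\<lambda>y. add_chart c ?cp c' (y, snd ?cp p)) has_derivative
      (\<lambda>v. frechet_derivative (add_chart c ?cp c') (at (snd c q, snd ?cp p)) (v, 0))) (at (snd c q))"
    by (rule has_derivative_compose[rotated]) (auto intro!: derivative_eq_intros)
  moreover have "isCont (\<lambda>x. x + p) q" unfolding isCont_def by (intro group_tendsto tendsto_intros)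
  ultimately show thesis
    by (intro that) (auto simp: chart_derivative_def c add_chart_def chart_inverse pref_chart)
qed

lemma chart_derivative_d_left: "chart_derivative (pref_chart A q) (pref_chart A (p + q)) (\<lambda>x. p + x) q (d_left A p q)"
proof -
  obtain L where L: "chart_derivative (pref_chart A q) (pref_chart A (p + q)) (\<lambda>x. p + x) q L"
    using chart_derivative_left_translation pref_chart by metis
  then have "frechet_derivative (\<lambda>y. chart_at A (p + q) (p + cinv (pref_chart A q) y)) (at (chart_at A q q)) = L"
    unfolding chart_derivative_def using frechet_derivative_at by metis
  then have "d_left A p q = L" by (simp add: d_left_def mderiv_def chart_inv_def o_def)
  with L show ?thesis by simp
qed

lemma d_left_add: "d_left A (p + p') q v = d_left A p (p' + q) (d_left A p' q v)"
  using chart_derivative_unique[OF chart_derivative_compose[OF chart_derivative_d_left chart_derivative_d_left[of "p' + q" p]], of "d_left A (p + p') q"]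
    chart_derivative_d_left[of q "p + p'"] by (simp add: add.assoc) metis

lemma d_left_0: "d_left A 0 q v = v"
  using chart_derivative_unique[OF chart_derivative_id[OF pref_chart, of q], of "d_left A 0 q"] chart_derivative_d_left[of q 0] by simp metis

lemma d_left_cancel: "d_left A p 0 (d_left A (- p) p v) = v" "d_left A (- p) p (d_left A p 0 v) = v"
  using d_left_add[of p "- p" p v] d_left_add[of "- p" p 0 v] by (simp_all add: d_left_0)

text \<open>The adjoint representation, in the preferred chart at the identity.\<close>

definition Ad :: "'g \<Rightarrow> 'e \<Rightarrow> 'e" where
  "Ad g = frechet_derivative (\<lambda>y. \<phi> (g + \<psi> y - g)) (at x0)"

lemma chart_derivative_Ad: "chart_derivative c0 c0 (\<lambda>x. g + x - g) 0 (Ad g)"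
proof -
  obtain L where L: "chart_derivative c0 (pref_chart A g) (\<lambda>x. g + x) 0 L"
    using chart_derivative_left_translation[of c0 "pref_chart A g" 0 g] pref_chart by auto
  obtain M where M: "chart_derivative (pref_chart A g) c0 (\<lambda>x. x + - g) g M"
    using chart_derivative_right_translation[of "pref_chart A g" c0 g "- g"] pref_chart by auto
  have *: "chart_derivative c0 c0 (\<lambda>x. g + x - g) 0 (\<lambda>v. M (L v))"
    using chart_derivative_compose[OF L, of c0 "\<lambda>x. x + - g" M] M by simp
  then have "Ad g = (\<lambda>v. M (L v))"
    unfolding Ad_def chart_derivative_def using frechet_derivative_at by metis
  with * show ?thesis by simp
qed

lemma linear_Ad: "linear (Ad g)" using chart_derivative_Ad chart_derivative_linear by blast

lemma Ad_add: "Ad (g + h) v = Ad g (Ad h v)"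
proof -
  have "chart_derivative c0 c0 (\<lambda>x. g + (h + x - h) - g) 0 (\<lambda>v. Ad g (Ad h v))"
    using chart_derivative_compose[OF chart_derivative_Ad[of h], of c0 "\<lambda>x. g + x - g" "Ad g"] chart_derivative_Ad[of g] by simp
  moreover have "(\<lambda>x. g + (h + x - h) - g) = (\<lambda>x. (g + h) + x - (g + h))"
    by (simp add: fun_eq_iff diff_conv_add_uminus minus_add add.assoc del: add_uminus_conv_diff)
  ultimately show ?thesis using chart_derivative_unique[OF chart_derivative_Ad[of "g + h"]] by metis
qed

lemma Ad_0: "Ad 0 v = v"
  using chart_derivative_unique[OF chart_derivative_Ad[of 0]] chart_derivative_id[OF pref_chart, of 0] by auto

text \<open>The velocity of \<open>\<gamma>\<close> at \<open>t\<close>, translated to the identity.\<close>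

definition left_velocity :: "(real \<Rightarrow> 'g) \<Rightarrow> 'e \<Rightarrow> real \<Rightarrow> real set \<Rightarrow> bool" where
  "left_velocity \<gamma> u t S \<longleftrightarrow> continuous (at t within S) \<gamma> \<and>
     ((\<lambda>s. \<phi> (- \<gamma> t + \<gamma> s)) has_vector_derivative u) (at t within S)"

lemma chart_derivative_curve:
  assumes f: "chart_derivative c c' f (\<gamma> t) L" and \<gamma>: "continuous (at t within S) \<gamma>" and t: "t \<in> S"
    and d: "((\<lambda>s. snd c (\<gamma> s)) has_vector_derivative v) (at t within S)"
  shows "((\<lambda>s. snd c' (f (\<gamma> s))) has_vector_derivative L v) (at t within S)"
proof -
  have c: "c \<in> A" "\<gamma> t \<in> fst c" and L: "((\<lambda>y. snd c' (f (cinv c y))) has_derivative L) (at (snd c (\<gamma> t)))"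
    using f by (auto simp: chart_derivative_def)
  have lin: "linear L" by (rule chart_derivative_linear[OF f])
  have "((\<lambda>s. snd c' (f (cinv c (snd c (\<gamma> s))))) has_derivative (\<lambda>h. L (h *\<^sub>R v))) (at t within S)"
    by (rule has_derivative_compose[OF d[unfolded has_vector_derivative_def] L])
  moreover have "\<forall>\<^sub>F s in at t within S. \<gamma> s \<in> fst c"
    using \<gamma> c chart_homeomorphism(1) topological_tendstoD unfolding continuous_within by metis
  then have "\<forall>\<^sub>F s in at t within S. snd c' (f (cinv c (snd c (\<gamma> s)))) = snd c' (f (\<gamma> s))"
    by eventually_elim (simp add: chart_inverse c)
  ultimately have "((\<lambda>s. snd c' (f (\<gamma> s))) has_derivative (\<lambda>h. L (h *\<^sub>R v))) (at t within S)"
    by (rule has_derivative_transform_eventually) (auto simp: chart_inverse c t)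
  then show ?thesis by (simp add: has_vector_derivative_def linear_scale[OF lin])
qed

lemma left_velocity_of_chart_velocity:
  assumes "continuous (at t within S) \<gamma>" "t \<in> S"
    "((chart_at A (\<gamma> t) \<circ> \<gamma>) has_vector_derivative v) (at t within S)"
  shows "left_velocity \<gamma> (d_left A (- \<gamma> t) (\<gamma> t) v) t S"
  using chart_derivative_curve[of _ _ "\<lambda>x. - \<gamma> t + x" \<gamma> t, OF chart_derivative_d_left[of "\<gamma> t" "- \<gamma> t"] assms(1,2)] assms
  by (simp add: left_velocity_def o_def)

lemma chart_velocity_of_left_velocity:
  assumes l: "left_velocity \<gamma> u t S" and t: "t \<in> S"
  shows "((chart_at A (\<gamma> t) \<circ> \<gamma>) has_vector_derivative d_left A (\<gamma> t) 0 u) (at t within S)"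
proof -
  have c: "continuous (at t within S) (\<lambda>s. - \<gamma> t + \<gamma> s)"
    using l unfolding left_velocity_def continuous_within by (intro group_tendsto tendsto_intros) auto
  have m: "chart_derivative c0 (pref_chart A (\<gamma> t)) (\<lambda>x. \<gamma> t + x) (- \<gamma> t + \<gamma> t) (d_left A (\<gamma> t) 0)"
    using chart_derivative_d_left[of 0 "\<gamma> t"] by simp
  have "((\<lambda>s. chart_at A (\<gamma> t) (\<gamma> t + (- \<gamma> t + \<gamma> s))) has_vector_derivative d_left A (\<gamma> t) 0 u) (at t within S)"
    using chart_derivative_curve[OF m c t] l by (simp add: left_velocity_def)
  then show ?thesis by (simp add: o_def add.assoc[symmetric])
qed

lemma left_velocity_unique:
  assumes "left_velocity \<gamma> u t {a..b}" "left_velocity \<gamma> v t {a..b}" "t \<in> {a..b}" "a < b"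
  shows "u = v"
  using assms vector_derivative_unique_within_closed_interval[of a b t "\<lambda>s. \<phi> (- \<gamma> t + \<gamma> s)" u v]
  by (auto simp: left_velocity_def cbox_interval)

lemma add_chart_derivative_at_identity:
  "(add_chart c0 c0 c0 has_derivative (\<lambda>(v, w). v + w)) (at (x0, x0))"
proof -
  let ?D = "frechet_derivative (add_chart c0 c0 c0) (at (x0, x0))"
  have c: "c0 \<in> A" "0 \<in> fst c0" using pref_chart by auto
  have D: "(add_chart c0 c0 c0 has_derivative ?D) (at (x0, x0))"
    by (rule smooth_on_has_derivative[OF smooth_on_add_chart]) (use add_dom_mem c in auto)
  have o: "open (snd c0 ` fst c0)" "x0 \<in> snd c0 ` fst c0" using c chart_homeomorphism(2) by auto
  have "((\<lambda>y. add_chart c0 c0 c0 (x0, y)) has_derivative (\<lambda>v. ?D (0, v))) (at x0)"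
    by (rule has_derivative_compose[where f = "\<lambda>y. (x0, y)", OF _ D]) (auto intro!: derivative_eq_intros)
  moreover have "((\<lambda>y. add_chart c0 c0 c0 (x0, y)) has_derivative (\<lambda>v. v)) (at x0)"
    by (rule has_derivative_transform_within_open[OF has_derivative_ident o])
       (auto simp: add_chart_def chart_inverse c)
  ultimately have 1: "?D (0, v) = v" for v using has_derivative_unique by metis
  have "((\<lambda>y. add_chart c0 c0 c0 (y, x0)) has_derivative (\<lambda>v. ?D (v, 0))) (at x0)"
    by (rule has_derivative_compose[where f = "\<lambda>y. (y, x0)", OF _ D]) (auto intro!: derivative_eq_intros)
  moreover have "((\<lambda>y. add_chart c0 c0 c0 (y, x0)) has_derivative (\<lambda>v. v)) (at x0)"
    by (rule has_derivative_transform_within_open[OF has_derivative_ident o])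
       (auto simp: add_chart_def chart_inverse c)
  ultimately have 2: "?D (v, 0) = v" for v using has_derivative_unique by metis
  have "?D (v, w) = v + w" for v w
    using linear_add[OF has_derivative_linear[OF D], of "(v, 0)" "(0, w)"] 1 2 by simp
  then have "?D = (\<lambda>(v, w). v + w)" by (auto simp: fun_eq_iff)
  with D show ?thesis by simp
qed

text \<open>Up to left translation the product is \<open>(- \<beta> t - \<alpha> t + \<alpha> s + \<beta> t) + (- \<beta> t + \<beta> s)\<close>: a conjugate of the first curve
followed by the second one, both passing through the identity, where velocities add up.\<close>

lemma left_velocity_add:
  assumes a: "left_velocity \<alpha> a t S" and b: "left_velocity \<beta> b t S" and t: "t \<in> S"
  shows "left_velocity (\<lambda>s. \<alpha> s + \<beta> s) (Ad (- \<beta> t) a + b) t S"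
proof -
  let ?a = "\<lambda>s. - \<alpha> t + \<alpha> s" and ?b = "\<lambda>s. - \<beta> t + \<beta> s"
  let ?a' = "\<lambda>s. - \<beta> t + ?a s - - \<beta> t"
  have ca: "(\<alpha> \<longlongrightarrow> \<alpha> t) (at t within S)" and cb: "(\<beta> \<longlongrightarrow> \<beta> t) (at t within S)"
    using a b by (auto simp: left_velocity_def continuous_within)
  have cab: "continuous (at t within S) ?a" "continuous (at t within S) ?b" "continuous (at t within S) ?a'"
    unfolding continuous_within by (intro group_tendsto tendsto_intros ca cb)+
  have da: "((\<lambda>s. \<phi> (?a' s)) has_vector_derivative Ad (- \<beta> t) a) (at t within S)"
    using chart_derivative_curve[of c0 c0 "\<lambda>x. - \<beta> t + x - - \<beta> t" ?a t "Ad (- \<beta> t)" S a] chart_derivative_Ad[of "- \<beta> t"] cab(1) t a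
    by (simp add: left_velocity_def)
  have db: "((\<lambda>s. \<phi> (?b s)) has_vector_derivative b) (at t within S)" using b by (simp add: left_velocity_def)
  have c: "c0 \<in> A" "0 \<in> fst c0" using pref_chart by auto
  have 1: "((\<lambda>s. add_chart c0 c0 c0 (\<phi> (?a' s), \<phi> (?b s))) has_derivative
      (\<lambda>h. (\<lambda>(v, w). v + w) (h *\<^sub>R Ad (- \<beta> t) a, h *\<^sub>R b))) (at t within S)"
    by (rule has_derivative_compose[OF has_derivative_Pair[OF da[unfolded has_vector_derivative_def] db[unfolded has_vector_derivative_def]]])
       (simp add: add_chart_derivative_at_identity)
  have "\<forall>\<^sub>F s in at t within S. ?a' s \<in> fst c0"
    using cab(3)[unfolded continuous_within] topological_tendstoD[OF _ chart_homeomorphism(1)[OF c(1)]] c by fastforce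
  moreover have "\<forall>\<^sub>F s in at t within S. ?b s \<in> fst c0"
    using cab(2)[unfolded continuous_within] topological_tendstoD[OF _ chart_homeomorphism(1)[OF c(1)]] c by fastforce
  ultimately have 2: "\<forall>\<^sub>F s in at t within S. ?a' s \<in> fst c0 \<and> ?b s \<in> fst c0" by (rule eventually_conj)
  have eq: "- (\<alpha> t + \<beta> t) + (\<alpha> s + \<beta> s) = ?a' s + ?b s" for s
    by (simp add: minus_add add.assoc diff_conv_add_uminus del: add_uminus_conv_diff)
  have "\<forall>\<^sub>F s in at t within S. add_chart c0 c0 c0 (\<phi> (?a' s), \<phi> (?b s)) = \<phi> (- (\<alpha> t + \<beta> t) + (\<alpha> s + \<beta> s))"
    using 2 by eventually_elim (simp only: eq add_chart_def chart_inverse[OF c(1)] fst_conv snd_conv)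
  with 1 have "((\<lambda>s. \<phi> (- (\<alpha> t + \<beta> t) + (\<alpha> s + \<beta> s))) has_derivative
      (\<lambda>h. (\<lambda>(v, w). v + w) (h *\<^sub>R Ad (- \<beta> t) a, h *\<^sub>R b))) (at t within S)"
    by (rule has_derivative_transform_eventually) (use t c in \<open>auto simp: add_chart_def chart_inverse\<close>)
  then show ?thesis
    using ca cb by (simp add: left_velocity_def has_vector_derivative_def continuous_within group_tendsto scaleR_add_right)
qed

end

section \<open>The bracket as the derivative of the adjoint representation\<close>

lemma has_vector_derivative_iff_tendsto:
  "(f has_vector_derivative D) (at t within S) \<longleftrightarrow> ((\<lambda>s. (f s - f t) /\<^sub>R (s - t)) \<longlongrightarrow> D) (at t within S)"
proof -
  have "((\<lambda>s. (f s - f t) /\<^sub>R (s - t)) \<longlongrightarrow> D) (at t within S) \<longleftrightarrow>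
      ((\<lambda>s. norm ((f s - f t) /\<^sub>R (s - t) - D)) \<longlongrightarrow> 0) (at t within S)"
    by (simp add: tendsto_norm_zero_iff LIM_zero_iff)
  also have "\<dots> \<longleftrightarrow> ((\<lambda>s. norm (f s - f t - (s - t) *\<^sub>R D) / norm (s - t)) \<longlongrightarrow> 0) (at t within S)"
  proof (rule tendsto_cong)
    show "\<forall>\<^sub>F s in at t within S. norm ((f s - f t) /\<^sub>R (s - t) - D) = norm (f s - f t - (s - t) *\<^sub>R D) / norm (s - t)"
      unfolding eventually_at_filter
    proof (rule always_eventually, intro allI impI)
      fix s assume s: "s \<noteq> t"
      have "(f s - f t) /\<^sub>R (s - t) - D = (f s - f t - (s - t) *\<^sub>R D) /\<^sub>R (s - t)"
        using s by (simp add: scaleR_diff_right)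
      then show "norm ((f s - f t) /\<^sub>R (s - t) - D) = norm (f s - f t - (s - t) *\<^sub>R D) / norm (s - t)"
        by (simp add: divide_inverse mult.commute)
    qed
  qed
  also have "\<dots> \<longleftrightarrow> (f has_vector_derivative D) (at t within S)"
    unfolding has_vector_derivative_def has_derivative_iff_norm by (simp add: bounded_linear_scaleR_left)
  finally show ?thesis by simp
qed

text \<open>Linear maps that converge to the identity on a basis converge uniformly on bounded sets, and \<open>q\<close> is eventually
bounded by \<open>2 * norm (R s (q s))\<close>.\<close>

lemma tendsto_of_linear_perturbation_of_identity:
  fixes R :: "'x \<Rightarrow> 'e::euclidean_space \<Rightarrow> 'e"
  assumes lin: "\<forall>\<^sub>F s in F. linear (R s)" and R: "\<And>b. b \<in> Basis \<Longrightarrow> ((\<lambda>s. R s b) \<longlongrightarrow> b) F"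
    and q: "((\<lambda>s. R s (q s)) \<longlongrightarrow> L) F"
  shows "(q \<longlongrightarrow> L) F"
proof -
  define \<epsilon> where "\<epsilon> s = (\<Sum>b\<in>Basis. norm (R s b - b))" for s
  have "(\<epsilon> \<longlongrightarrow> (\<Sum>b\<in>(Basis :: 'e set). norm (b - b))) F"
    unfolding \<epsilon>_def by (intro tendsto_sum tendsto_norm tendsto_diff R tendsto_const)
  then have \<epsilon>0: "(\<epsilon> \<longlongrightarrow> 0) F" by simp
  have small: "\<forall>\<^sub>F s in F. \<epsilon> s < 1/2" using order_tendstoD(2)[OF \<epsilon>0, of "1/2"] by simp
  have dom: "\<forall>\<^sub>F s in F. norm (q s - R s (q s)) \<le> \<epsilon> s * (2 * norm (R s (q s)))"
    using lin small
  proof eventually_elim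
    case (elim s)
    have e: "norm (R s v - v) \<le> \<epsilon> s * norm v" for v
    proof -
      have "R s v - v = R s (\<Sum>b\<in>Basis. (v \<bullet> b) *\<^sub>R b) - (\<Sum>b\<in>Basis. (v \<bullet> b) *\<^sub>R b)"
        by (simp add: euclidean_representation)
      also have "\<dots> = (\<Sum>b\<in>Basis. (v \<bullet> b) *\<^sub>R (R s b - b))"
        using elim(1) by (simp add: linear_sum linear_scale sum_subtractf scaleR_diff_right)
      also have "norm \<dots> \<le> (\<Sum>b\<in>Basis. norm (R s b - b) * norm v)"
        by (rule sum_norm_le) (auto simp: mult.commute Basis_le_norm intro: mult_right_mono)
      finally show ?thesis by (simp add: \<epsilon>_def sum_distrib_right)
    qed
    have "\<epsilon> s \<ge> 0" by (auto simp: \<epsilon>_def intro: sum_nonneg)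
    have "norm (q s) \<le> norm (R s (q s)) + norm (R s (q s) - q s)"
      by (metis norm_minus_commute norm_triangle_sub)
    also have "norm (R s (q s) - q s) \<le> 1/2 * norm (q s)"
      using e[of "q s"] elim(2) by (meson less_imp_le mult_right_mono norm_ge_zero order_trans)
    finally have "norm (q s) \<le> 2 * norm (R s (q s))" by simp
    then have "\<epsilon> s * norm (q s) \<le> \<epsilon> s * (2 * norm (R s (q s)))"
      using \<open>\<epsilon> s \<ge> 0\<close> by (rule mult_left_mono)
    then show ?case using e[of "q s"] by (simp add: norm_minus_commute)
  qed
  have "((\<lambda>s. \<epsilon> s * (2 * norm (R s (q s)))) \<longlongrightarrow> 0 * (2 * norm L)) F"
    by (intro tendsto_intros \<epsilon>0 q)
  then have "((\<lambda>s. \<epsilon> s * (2 * norm (R s (q s)))) \<longlongrightarrow> 0) F" by simp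
  from Lim_null_comparison[OF dom this] have "((\<lambda>s. q s - R s (q s)) \<longlongrightarrow> 0) F" .
  from tendsto_add[OF this q] show ?thesis by simp
qed

context lie_group_atlas
begin

abbreviation m0 :: "'e \<times> 'e \<Rightarrow> 'e" where "m0 \<equiv> add_chart c0 c0 c0"
abbreviation O0 :: "('e \<times> 'e) set" where "O0 \<equiv> add_dom c0 c0 c0"

text \<open>The differentials at the identity of the left and right translation by the point with coordinate \<open>x\<close>, and the
mixed second derivative of the product at the identity.\<close>

definition Dleft :: "'e \<Rightarrow> 'e \<Rightarrow> 'e" where "Dleft x v = frechet_derivative m0 (at (x, x0)) (0, v)"
definition Dright :: "'e \<Rightarrow> 'e \<Rightarrow> 'e" where "Dright x v = frechet_derivative m0 (at (x0, x)) (v, 0)"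
definition Dmix :: "'e \<Rightarrow> 'e \<Rightarrow> 'e" where
  "Dmix v w = frechet_derivative (\<lambda>z. frechet_derivative m0 (at z) (0, w)) (at (x0, x0)) (v, 0)"

lemma c0: "c0 \<in> A" "0 \<in> fst c0" "open O0" "smooth_on O0 m0" "(x0, x0) \<in> O0"
  using pref_chart by (auto intro: open_add_dom smooth_on_add_chart add_dom_mem)

lemma chart_derivative_Dleft:
  assumes g: "g \<in> fst c0"
  shows "chart_derivative c0 c0 (\<lambda>x. g + x) 0 (Dleft (\<phi> g))"
proof -
  have "(m0 has_derivative frechet_derivative m0 (at (\<phi> g, x0))) (at (\<phi> g, x0))"
    by (rule smooth_on_has_derivative[OF c0(4)]) (use add_dom_mem c0 g in auto)
  then have "((\<lambda>y. m0 (\<phi> g, y)) has_derivative (\<lambda>v. frechet_derivative m0 (at (\<phi> g, x0)) (0, v))) (at x0)"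
    by (rule has_derivative_compose[where f = "\<lambda>y. (\<phi> g, y)", rotated]) (auto intro!: derivative_eq_intros)
  moreover have "isCont (\<lambda>x. g + x) 0" unfolding isCont_def by (intro group_tendsto tendsto_intros)
  ultimately show ?thesis
    using c0 g by (auto simp: chart_derivative_def add_chart_def chart_inverse Dleft_def[abs_def])
qed

lemma chart_derivative_Dright:
  assumes g: "g \<in> fst c0"
  shows "chart_derivative c0 c0 (\<lambda>x. x + g) 0 (Dright (\<phi> g))"
proof -
  have "(m0 has_derivative frechet_derivative m0 (at (x0, \<phi> g))) (at (x0, \<phi> g))"
    by (rule smooth_on_has_derivative[OF c0(4)]) (use add_dom_mem c0 g in auto)
  then have "((\<lambda>y. m0 (y, \<phi> g)) has_derivative (\<lambda>v. frechet_derivative m0 (at (x0, \<phi> g)) (v, 0))) (at x0)"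
    by (rule has_derivative_compose[where f = "\<lambda>y. (y, \<phi> g)", rotated]) (auto intro!: derivative_eq_intros)
  moreover have "isCont (\<lambda>x. x + g) 0" unfolding isCont_def by (intro group_tendsto tendsto_intros)
  ultimately show ?thesis
    using c0 g by (auto simp: chart_derivative_def add_chart_def chart_inverse Dright_def[abs_def])
qed

lemma Dright_Ad: "g \<in> fst c0 \<Longrightarrow> Dright (\<phi> g) (Ad g u) = Dleft (\<phi> g) u"
  using chart_derivative_unique[OF chart_derivative_compose[OF chart_derivative_Ad[of g], of c0 "\<lambda>x. x + g" "Dright (\<phi> g)"] , of "Dleft (\<phi> g)"]
    chart_derivative_Dright[of g] chart_derivative_Dleft[of g] by (simp add: fun_eq_iff)

lemma Dleft_x0: "Dleft x0 v = v"
  using chart_derivative_unique[OF chart_derivative_Dleft[OF c0(2)]] chart_derivative_id[OF c0(1,2)] by auto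

lemma Dright_x0: "Dright x0 v = v"
  using chart_derivative_unique[OF chart_derivative_Dright[OF c0(2)]] chart_derivative_id[OF c0(1,2)] by auto

lemma Dleft_has_derivative: "((\<lambda>x. Dleft x w) has_derivative (\<lambda>v. Dmix v w)) (at x0)"
  unfolding Dleft_def Dmix_def
  by (rule has_derivative_compose[where f = "\<lambda>x. (x, x0)",
        OF _ smooth_on_has_derivative[OF smooth_on_directional_derivative[OF c0(4)] c0(5)]])
     (auto intro!: derivative_eq_intros)

text \<open>By the symmetry of second derivatives \<open>Dmix\<close> also governs the right translations, with its arguments exchanged.\<close>

lemma Dright_has_derivative: "((\<lambda>x. Dright x u) has_derivative (\<lambda>v. Dmix u v)) (at x0)"
proof -
  have "Dmix u v = frechet_derivative (\<lambda>z. frechet_derivative m0 (at z) (u, 0)) (at (x0, x0)) (0, v)" for v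
    unfolding Dmix_def by (rule smooth_on_second_derivative_symmetric[OF c0(4,3,5)])
  then show ?thesis
    unfolding Dright_def
    by (simp only:) (rule has_derivative_compose[where f = "\<lambda>x. (x0, x)",
        OF _ smooth_on_has_derivative[OF smooth_on_directional_derivative[OF c0(4)] c0(5)]],
     auto intro!: derivative_eq_intros)
qed

text \<open>The preferred chart at \<open>q\<close>, in which the vector field is given, cancels against the change of coordinates.\<close>

lemma vf_coord_left_inv_field:
  assumes x: "x \<in> \<phi> ` fst c0"
  shows "vf_coord A 0 (left_inv_field A w) x = Dleft x w"
proof -
  define q where "q = \<psi> x"
  have q: "q \<in> fst c0" "\<phi> q = x" using x c0 by (auto simp: q_def chart_inverse)
  obtain T where T: "chart_derivative (pref_chart A q) c0 (\<lambda>x. x) q T"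
    using chart_derivative_left_translation[of "pref_chart A q" c0 q 0] pref_chart q c0 by auto
  have "T = frechet_derivative (\<lambda>y. \<phi> (cinv (pref_chart A q) y)) (at (chart_at A q q))"
    using T unfolding chart_derivative_def using frechet_derivative_at by metis
  then have "vf_coord A 0 (left_inv_field A w) x = T (d_left A q 0 w)"
    by (simp add: vf_coord_def left_inv_field_def chart_inv_def o_def Let_def q_def)
  also have "\<dots> = Dleft x w"
  proof -
    have "chart_derivative c0 (pref_chart A q) (\<lambda>x. q + x) 0 (d_left A q 0)" using chart_derivative_d_left[of 0 q] by simp
    from chart_derivative_compose[OF this, of c0 "\<lambda>x. x" T] T
    have "chart_derivative c0 c0 (\<lambda>x. q + x) 0 (\<lambda>v. T (d_left A q 0 v))" by simp
    from chart_derivative_unique[OF this chart_derivative_Dleft[OF q(1)]] show ?thesis using q(2) by (simp add: fun_eq_iff)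
  qed
  finally show ?thesis .
qed

lemma lie_bracket_eq: "lie_bracket A v w = Dmix v w - Dmix w v"
proof -
  have "frechet_derivative (vf_coord A 0 (left_inv_field A w)) (at x0) v = Dmix v w" for v w
  proof -
    have "(vf_coord A 0 (left_inv_field A w) has_derivative (\<lambda>v. Dmix v w)) (at x0)"
      by (rule has_derivative_transform_within_open[OF Dleft_has_derivative chart_homeomorphism(2)[OF c0(1)]])
         (use c0 in \<open>auto simp: vf_coord_left_inv_field\<close>)
    from frechet_derivative_at[OF this] show ?thesis by metis
  qed
  then show ?thesis by (simp add: lie_bracket_def vf_bracket_def left_inv_field_def d_left_0)
qed

lemma linear_Dmix: "linear (\<lambda>v. Dmix v w)" "linear (Dmix v)"
  using has_derivative_linear[OF Dleft_has_derivative] has_derivative_linear[OF Dright_has_derivative] by auto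

lemma bilinear_lie_bracket: "bilinear (lie_bracket A)"
proof -
  have "linear (lie_bracket A v)" for v
    unfolding lie_bracket_eq[abs_def] by (intro linear_compose_sub linear_Dmix)
  moreover have "linear (\<lambda>v. lie_bracket A v w)" for w
    unfolding lie_bracket_eq by (intro linear_compose_sub linear_Dmix)
  ultimately show ?thesis by (simp add: bilinear_def)
qed

lemma lie_bracket_antisym: "lie_bracket A v w = - lie_bracket A w v" by (simp add: lie_bracket_eq)

text \<open>Left translation is conjugation followed by right translation, hence \<open>Dright (\<phi> g) (Ad g u) = Dleft (\<phi> g) u\<close>.
Differentiating this at the identity shows that the derivative of \<open>Ad\<close> is the difference of the derivatives of \<open>Dleft\<close>
and \<open>Dright\<close>, which is the bracket.\<close>

lemma Ad_has_vector_derivative: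
  assumes k: "k t = 0" "t \<in> S" "continuous (at t within S) k"
    and d: "((\<lambda>s. \<phi> (k s)) has_vector_derivative X) (at t within S)"
  shows "((\<lambda>s. Ad (k s) u) has_vector_derivative lie_bracket A X u) (at t within S)"
proof -
  let ?F = "at t within S"
  have near: "\<forall>\<^sub>F s in ?F. k s \<in> fst c0"
    using k(1,3) c0 topological_tendstoD[OF _ chart_homeomorphism(1)[OF c0(1)]] unfolding continuous_within by metis
  have xc: "((\<lambda>s. \<phi> (k s)) \<longlongrightarrow> x0) ?F"
    using has_vector_derivative_continuous[OF d] k(1) by (simp add: continuous_within)
  have dL: "((\<lambda>s. Dleft (\<phi> (k s)) u) has_vector_derivative Dmix X u) ?F"
  proof -
    have "((\<lambda>s. Dleft (\<phi> (k s)) u) has_derivative (\<lambda>h. Dmix (h *\<^sub>R X) u)) ?F"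
      by (rule has_derivative_compose[OF d[unfolded has_vector_derivative_def], of "\<lambda>x. Dleft x u"])
         (simp add: k Dleft_has_derivative)
    then show ?thesis by (simp add: has_vector_derivative_def linear_scale[OF linear_Dmix(1)])
  qed
  have dR: "((\<lambda>s. Dright (\<phi> (k s)) u) has_vector_derivative Dmix u X) ?F"
  proof -
    have "((\<lambda>s. Dright (\<phi> (k s)) u) has_derivative (\<lambda>h. Dmix u (h *\<^sub>R X))) ?F"
      by (rule has_derivative_compose[OF d[unfolded has_vector_derivative_def], of "\<lambda>x. Dright x u"])
         (simp add: k Dright_has_derivative)
    then show ?thesis by (simp add: has_vector_derivative_def linear_scale[OF linear_Dmix(2)])
  qed
  have "((\<lambda>s. Dleft (\<phi> (k s)) u - Dright (\<phi> (k s)) u) has_vector_derivative lie_bracket A X u) ?F"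
    unfolding lie_bracket_eq by (rule has_vector_derivative_diff[OF dL dR])
  then have lim: "((\<lambda>s. (Dleft (\<phi> (k s)) u - Dright (\<phi> (k s)) u) /\<^sub>R (s - t)) \<longlongrightarrow> lie_bracket A X u) ?F"
    by (simp add: has_vector_derivative_iff_tendsto k Dleft_x0 Dright_x0)
  have lin: "\<forall>\<^sub>F s in ?F. linear (Dright (\<phi> (k s)))"
    using near by eventually_elim (rule chart_derivative_linear[OF chart_derivative_Dright])
  have "((\<lambda>s. (Ad (k s) u - u) /\<^sub>R (s - t)) \<longlongrightarrow> lie_bracket A X u) ?F"
  proof (rule tendsto_of_linear_perturbation_of_identity[OF lin])
    fix b :: 'e
    have "isCont (\<lambda>x. Dright x b) x0" using has_derivative_continuous[OF Dright_has_derivative] .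
    from isCont_tendsto_compose[OF this xc] show "((\<lambda>s. Dright (\<phi> (k s)) b) \<longlongrightarrow> b) ?F" by (simp add: Dright_x0)
  next
    have "\<forall>\<^sub>F s in ?F. (Dleft (\<phi> (k s)) u - Dright (\<phi> (k s)) u) /\<^sub>R (s - t) = Dright (\<phi> (k s)) ((Ad (k s) u - u) /\<^sub>R (s - t))"
      using near
    proof eventually_elim
      case (elim s)
      have l: "linear (Dright (\<phi> (k s)))" by (rule chart_derivative_linear[OF chart_derivative_Dright[OF elim]])
      show ?case by (simp add: linear_scale[OF l] linear_diff[OF l] Dright_Ad[OF elim])
    qed
    with lim show "((\<lambda>s. Dright (\<phi> (k s)) ((Ad (k s) u - u) /\<^sub>R (s - t))) \<longlongrightarrow> lie_bracket A X u) ?F"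
      by (rule Lim_transform_eventually)
  qed
  then show ?thesis by (simp add: has_vector_derivative_iff_tendsto k Ad_0)
qed

text \<open>In the chart at the identity this is the differential equation with right-hand side \<open>Dleft y X\<close>. The Lipschitz
bound serves to compose \<open>E\<close> with absolutely continuous parameter changes.\<close>

lemma local_integral_curve:
  obtains r E K where "0 < r" "E 0 = 0" "0 \<le> K" "continuous_on {-r..r} E"
    "\<And>s. s \<in> {-r..r} \<Longrightarrow> E s \<in> fst c0" "\<And>s. s \<in> {-r..r} \<Longrightarrow> left_velocity E X s {-r..r}"
    "\<And>s t. s \<in> {-r..r} \<Longrightarrow> t \<in> {-r..r} \<Longrightarrow> norm (\<phi> (E s) - \<phi> (E t)) \<le> K * \<bar>s - t\<bar>"
proof -
  have opU: "open (\<phi> ` fst c0)" "x0 \<in> \<phi> ` fst c0" using chart_homeomorphism(2)[OF c0(1)] c0(2) by auto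
  obtain e1 where e1: "0 < e1" "cball x0 e1 \<subseteq> \<phi> ` fst c0" using opU open_contains_cball by blast
  obtain K e2 where e2: "0 < e2" "0 \<le> K" "cball (x0, x0) e2 \<subseteq> O0"
    "\<And>y z. y \<in> cball (x0, x0) e2 \<Longrightarrow> z \<in> cball (x0, x0) e2 \<Longrightarrow>
      norm (frechet_derivative m0 (at y) (0, X) - frechet_derivative m0 (at z) (0, X)) \<le> K * norm (y - z)"
    by (rule smooth_on_locally_lipschitz[OF smooth_on_directional_derivative[OF c0(4)] c0(3,5), of "(0, X)"]) (rule that, assumption+)
  define \<rho> where "\<rho> = min e1 e2"
  have \<rho>: "0 < \<rho>" using e1 e2 by (simp add: \<rho>_def)
  have in2: "(y, x0) \<in> cball (x0, x0) e2" if "y \<in> cball x0 \<rho>" for y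
    using that by (simp add: \<rho>_def dist_Pair_Pair)
  have lip: "norm (Dleft y X - Dleft z X) \<le> K * norm (y - z)" if "y \<in> cball x0 \<rho>" "z \<in> cball x0 \<rho>" for y z
    using e2(4)[OF in2 in2, OF that] by (simp add: Dleft_def norm_Pair)
  obtain r y where r: "0 < r" "y 0 = x0" "\<And>t. y t \<in> cball x0 \<rho>"
    "\<And>t. t \<in> {-r..r} \<Longrightarrow> (y has_vector_derivative Dleft (y t) X) (at t within {-r..r})"
    using picard_lindelof_autonomous[OF \<rho> e2(2) lip] by blast
  have yU: "y t \<in> \<phi> ` fst c0" for t using r(3)[of t] e1 by (auto simp: \<rho>_def)
  define E where "E t = \<psi> (y t)" for t
  have E: "E t \<in> fst c0" "\<phi> (E t) = y t" for t using yU c0 by (auto simp: E_def chart_inverse)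
  have ycont: "continuous_on {-r..r} y"
    unfolding continuous_on_eq_continuous_within using r(4) has_vector_derivative_continuous by blast
  have Econt: "continuous_on {-r..r} E"
    unfolding E_def by (rule continuous_on_compose2[OF chart_continuous(2)[OF c0(1)] ycont]) (use yU in auto)
  define M where "M = norm (Dleft x0 X) + K * \<rho>"
  have bound: "norm (Dleft (y t) X) \<le> M" for t
  proof -
    have "norm (Dleft (y t) X) \<le> norm (Dleft x0 X) + norm (Dleft (y t) X - Dleft x0 X)"
      by (metis norm_triangle_sub)
    also have "norm (Dleft (y t) X - Dleft x0 X) \<le> K * norm (y t - x0)" using lip r(3) \<rho> by simp
    also have "K * norm (y t - x0) \<le> K * \<rho>"
      using r(3)[of t] e2(2) by (intro mult_left_mono) (auto simp: dist_norm norm_minus_commute)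
    finally show ?thesis by (simp add: M_def)
  qed
  have M0: "0 \<le> M" unfolding M_def using e2(2) \<rho> by (intro add_nonneg_nonneg mult_nonneg_nonneg) auto
  show thesis
  proof (rule that[OF r(1) _ M0 Econt])
    show "E 0 = 0" using r(2) c0 by (simp add: E_def chart_inverse)
    show "E s \<in> fst c0" for s by (rule E)
    show "norm (\<phi> (E s) - \<phi> (E t)) \<le> M * \<bar>s - t\<bar>" if "s \<in> {-r..r}" "t \<in> {-r..r}" for s t
    proof -
      have "norm (y s - y t) \<le> M * norm (s - t)"
      proof (rule differentiable_bound[of "{-r..r}" y "\<lambda>t h. h *\<^sub>R Dleft (y t) X"])
        show "onorm (\<lambda>h. h *\<^sub>R Dleft (y u) X) \<le> M" for u
          by (rule onorm_le) (use mult_right_mono[OF bound[of u] abs_ge_zero] in \<open>simp add: mult.commute\<close>)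
      qed (use r(4) that in \<open>auto simp: has_vector_derivative_def\<close>)
      then show ?thesis by (simp add: E)
    qed
    fix s assume s: "s \<in> {-r..r}"
    have cE: "continuous (at s within {-r..r}) E" using Econt s by (simp add: continuous_on_eq_continuous_within)
    obtain L where L: "chart_derivative c0 c0 (\<lambda>x. - E s + x) (E s) L"
      using chart_derivative_left_translation[of c0 c0 "E s" "- E s"] c0 E by auto
    have "chart_derivative c0 c0 (\<lambda>x. - E s + (E s + x)) 0 (\<lambda>v. L (Dleft (\<phi> (E s)) v))"
      using chart_derivative_compose[OF chart_derivative_Dleft[OF E(1)], of c0 "\<lambda>x. - E s + x" s L] L by simp
    then have "L (Dleft (y s) X) = X"
      using chart_derivative_unique[OF chart_derivative_id[OF c0(1,2)]] E(2) by (fastforce simp: add.assoc[symmetric] fun_eq_iff)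
    moreover have "((\<lambda>t. \<phi> (- E s + E t)) has_vector_derivative L (Dleft (y s) X)) (at s within {-r..r})"
      by (rule chart_derivative_curve[OF L cE s]) (use r(4)[OF s] in \<open>simp add: E(2)\<close>)
    ultimately show "left_velocity E X s {-r..r}" using cE by (simp add: left_velocity_def)
  qed
qed

end

locale two_step_lie_group = lie_group_atlas A
  for A :: "('g::{group_add, t2_space, second_countable_topology}, 'e::euclidean_space) chart set" +
  assumes two_step: "two_step_nilpotent A"
begin

lemma lie_bracket_in_derived: "lie_bracket A v w \<in> derived_algebra A"
  unfolding bracket_space_def by (rule span_base) auto

lemma lie_bracket_derived: "z \<in> derived_algebra A \<Longrightarrow> lie_bracket A v z = 0"
proof -
  assume "z \<in> derived_algebra A"
  then have "lie_bracket A v z \<in> bracket_space A UNIV (derived_algebra A)"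
    unfolding bracket_space_def[of A UNIV "derived_algebra A"] by (intro span_base) blast
  then show ?thesis using two_step by (simp add: two_step_nilpotent_def)
qed

text \<open>The derivative of \<open>Ad (E s) u\<close> is \<open>Ad (E s) [X, u]\<close>. For \<open>u\<close> in the derived algebra it vanishes, so \<open>Ad (E s)\<close> fixes the
derived algebra; therefore the derivative is \<open>[X, u]\<close> for every \<open>u\<close>.\<close>

lemma Ad_integral_curve:
  assumes r: "0 < r" and E: "E 0 = 0" "\<And>s. s \<in> {-r..r} \<Longrightarrow> left_velocity E X s {-r..r}" and s: "s \<in> {-r..r}"
  shows "Ad (- E s) u = u - s *\<^sub>R lie_bracket A X u"
proof -
  have d: "((\<lambda>s. Ad (E s) u) has_vector_derivative Ad (E s) (lie_bracket A X u)) (at s within {-r..r})"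
    if s: "s \<in> {-r..r}" for s u
  proof -
    have c: "continuous (at s within {-r..r}) (\<lambda>t. - E s + E t)"
      using E(2)[OF s] unfolding left_velocity_def continuous_within by (intro group_tendsto tendsto_intros) auto
    have "((\<lambda>t. Ad (- E s + E t) u) has_vector_derivative lie_bracket A X u) (at s within {-r..r})"
      by (rule Ad_has_vector_derivative[OF _ s c]) (use E(2)[OF s] in \<open>auto simp: left_velocity_def\<close>)
    then have "((\<lambda>t. Ad (E s) (Ad (- E s + E t) u)) has_vector_derivative Ad (E s) (lie_bracket A X u)) (at s within {-r..r})"
      by (rule bounded_linear.has_vector_derivative[OF linear_conv_bounded_linear[THEN iffD1, OF linear_Ad]])
    then show ?thesis by (simp add: Ad_add[symmetric] add.assoc[symmetric])
  qed
  have 0: "0 \<in> {-r..r}" using r by simp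
  have cent: "Ad (E s) z = z" if z: "z \<in> derived_algebra A" and s: "s \<in> {-r..r}" for s z
  proof -
    have "((\<lambda>s. Ad (E s) z) has_derivative (\<lambda>h. 0)) (at s within {-r..r})" if "s \<in> {-r..r}" for s
      using d[OF that, of z] lie_bracket_derived[OF z] by (simp add: has_vector_derivative_def linear_0[OF linear_Ad])
    from has_derivative_zero_unique[OF convex_real_interval(5) this s 0] show ?thesis
      by (simp add: E Ad_0)
  qed
  have E_Ad: "Ad (E s) u = u + s *\<^sub>R lie_bracket A X u" for u
  proof -
    have "((\<lambda>s. Ad (E s) u - s *\<^sub>R lie_bracket A X u) has_derivative (\<lambda>h. 0)) (at s within {-r..r})" if "s \<in> {-r..r}" for s
    proof -
      have "((\<lambda>s. Ad (E s) u - s *\<^sub>R lie_bracket A X u) has_vector_derivative lie_bracket A X u - lie_bracket A X u) (at s within {-r..r})"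
        using d[OF that, of u] cent[OF lie_bracket_in_derived that]
        by (intro has_vector_derivative_diff) (auto intro!: derivative_eq_intros)
      then show ?thesis by (simp add: has_vector_derivative_def)
    qed
    from has_derivative_zero_unique[OF convex_real_interval(5) this s 0] show ?thesis
      by (simp add: E Ad_0 algebra_simps)
  qed
  let ?v = "u - s *\<^sub>R lie_bracket A X u"
  have "lie_bracket A X ?v = lie_bracket A X u"
    using bilinear_rsub[OF bilinear_lie_bracket] bilinear_rmul[OF bilinear_lie_bracket]
      lie_bracket_derived[OF lie_bracket_in_derived] by simp
  then have "Ad (E s) ?v = u" using E_Ad[of ?v] by simp
  then have "Ad (- E s) u = Ad (- E s + E s) ?v" by (simp only: Ad_add)
  then show ?thesis by (simp add: Ad_0)
qed

end

section \<open>Absolutely continuous curves and their controls\<close>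

text \<open>Translates between the measure-theoretic notion of almost everywhere in the definition of horizontal curves and
exceptional null sets.\<close>

lemma AE_lebesgue_on_iff_negligible:
  fixes S :: "'a::euclidean_space set"
  assumes "S \<in> sets lebesgue"
  shows "(AE x in lebesgue_on S. P x) \<longleftrightarrow> (\<exists>N. negligible N \<and> (\<forall>x\<in>S - N. P x))"
proof -
  have "(AE x in lebesgue_on S. P x) \<longleftrightarrow> (AE x in lebesgue. x \<in> S \<longrightarrow> P x)"
    using assms by (simp add: AE_restrict_space_iff)
  also have "\<dots> \<longleftrightarrow> (\<exists>N. negligible N \<and> (\<forall>x\<in>S - N. P x))"
  proof
    assume "AE x in lebesgue. x \<in> S \<longrightarrow> P x"
    then obtain N where "N \<in> null_sets lebesgue" "{x \<in> space lebesgue. \<not> (x \<in> S \<longrightarrow> P x)} \<subseteq> N"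
      by (auto simp: eventually_ae_filter)
    then show "\<exists>N. negligible N \<and> (\<forall>x\<in>S - N. P x)"
      by (intro exI[of _ N]) (auto simp: negligible_iff_null_sets)
  next
    assume "\<exists>N. negligible N \<and> (\<forall>x\<in>S - N. P x)"
    then obtain N where "N \<in> null_sets lebesgue" "\<forall>x\<in>S - N. P x" by (auto simp: negligible_iff_null_sets)
    then show "AE x in lebesgue. x \<in> S \<longrightarrow> P x" by (intro AE_I'[of N]) auto
  qed
  finally show ?thesis .
qed

context lie_group_atlas
begin

text \<open>Controls are only determined almost everywhere.\<close>

definition control :: "(real \<Rightarrow> 'g) \<Rightarrow> (real \<Rightarrow> 'e) \<Rightarrow> bool" where
  "control \<gamma> u \<longleftrightarrow> abs_cont_curve A \<gamma> \<and> (\<exists>N. negligible N \<and> (\<forall>t\<in>{0..1} - N. left_velocity \<gamma> (u t) t {0..1}))"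

lemma abs_cont_curve_continuous: "abs_cont_curve A \<gamma> \<Longrightarrow> continuous_on {0..1} \<gamma>"
  by (simp add: abs_cont_curve_def)

lemma abs_cont_curve_chart:
  assumes "abs_cont_curve A \<gamma>" "c \<in> A" "0 \<le> a" "a \<le> b" "b \<le> 1" "\<gamma> ` {a..b} \<subseteq> fst c"
  shows "abs_cont_on a b (snd c \<circ> \<gamma>)"
proof -
  have "\<forall>(U, f)\<in>A. \<forall>a b. 0 \<le> a \<and> a \<le> b \<and> b \<le> 1 \<and> \<gamma> ` {a..b} \<subseteq> U \<longrightarrow> abs_cont_on a b (f \<circ> \<gamma>)"
    using assms(1) unfolding abs_cont_curve_def by (elim conjE)
  from bspec[OF this assms(2)] show ?thesis using assms by (simp add: split_beta)
qed

lemma abs_cont_curveI: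
  assumes "continuous_on {0..1} \<gamma>"
    "\<And>c a b. c \<in> A \<Longrightarrow> 0 \<le> a \<Longrightarrow> a \<le> b \<Longrightarrow> b \<le> 1 \<Longrightarrow> \<gamma> ` {a..b} \<subseteq> fst c \<Longrightarrow> abs_cont_on a b (snd c \<circ> \<gamma>)"
  shows "abs_cont_curve A \<gamma>"
  unfolding abs_cont_curve_def
proof (intro conjI assms(1) ballI)
  fix c assume "c \<in> A"
  then show "case c of (U, f) \<Rightarrow> \<forall>a b. 0 \<le> a \<and> a \<le> b \<and> b \<le> 1 \<and> \<gamma> ` {a..b} \<subseteq> U \<longrightarrow> abs_cont_on a b (f \<circ> \<gamma>)"
    using assms(2)[of c] by (simp add: split_beta)
qed

lemma continuous_curve_nearby:
  fixes \<gamma> :: "real \<Rightarrow> 'b::topological_space"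
  assumes "continuous_on {0..1} \<gamma>" "t \<in> {0..1}" "open W" "\<gamma> t \<in> W"
  obtains e where "0 < e" "\<And>s. s \<in> {0..1} \<Longrightarrow> \<bar>s - t\<bar> \<le> e \<Longrightarrow> \<gamma> s \<in> W"
proof -
  obtain V where V: "open V" "V \<inter> {0..1} = \<gamma> -` W \<inter> {0..1}"
    using assms(1,3) unfolding continuous_on_open_invariant by blast
  then have "t \<in> V" using assms by blast
  then obtain e where "0 < e" "cball t e \<subseteq> V" using V(1) open_contains_cball by blast
  then show thesis using V(2) by (intro that[of e]) (auto simp: dist_real_def abs_minus_commute subset_iff)
qed

text \<open>Near each time the product is a Lipschitz function of the coordinates of both factors.\<close>

lemma abs_cont_curve_add:
  assumes \<gamma>: "abs_cont_curve A \<gamma>" and x: "abs_cont_on 0 1 x" "continuous_on {0..1} x" "x ` {0..1} \<subseteq> {-r..r}"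
    and E: "continuous_on {-r..r} E" "\<And>s. s \<in> {-r..r} \<Longrightarrow> E s \<in> fst c0"
    and lip: "0 \<le> K" "\<And>s t. s \<in> {-r..r} \<Longrightarrow> t \<in> {-r..r} \<Longrightarrow> norm (\<phi> (E s) - \<phi> (E t)) \<le> K * \<bar>s - t\<bar>"
  shows "abs_cont_curve A (\<lambda>t. \<gamma> t + E (x t))"
proof (rule abs_cont_curveI)
  have g: "continuous_on {0..1} \<gamma>" by (rule abs_cont_curve_continuous[OF \<gamma>])
  have Ex: "continuous_on {0..1} (\<lambda>t. E (x t))"
    by (rule continuous_on_compose2[OF E(1) x(2,3)])
  show "continuous_on {0..1} (\<lambda>t. \<gamma> t + E (x t))"
    using g Ex unfolding continuous_on_def by (auto intro: group_tendsto)
  fix c a b assume c: "c \<in> A" and ab: "0 \<le> a" "a \<le> b" "b \<le> 1" and im: "(\<lambda>t. \<gamma> t + E (x t)) ` {a..b} \<subseteq> fst c"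
  show "abs_cont_on a b (snd c \<circ> (\<lambda>t. \<gamma> t + E (x t)))"
  proof (rule abs_cont_on_local)
    fix t assume t: "t \<in> {a..b}"
    then have t01: "t \<in> {0..1}" using ab by auto
    then have xt: "x t \<in> {-r..r}" using x(3) by blast
    define cp where "cp = pref_chart A (\<gamma> t)"
    have cp: "cp \<in> A" "\<gamma> t \<in> fst cp" using pref_chart by (auto simp: cp_def)
    have mem: "(snd cp (\<gamma> t), \<phi> (E (x t))) \<in> add_dom cp c0 c"
      using im t by (intro add_dom_mem cp c0 E(2) xt) auto
    obtain M e where M: "0 < e" "0 \<le> M"
      "\<And>y z. y \<in> cball (snd cp (\<gamma> t), \<phi> (E (x t))) e \<Longrightarrow> z \<in> cball (snd cp (\<gamma> t), \<phi> (E (x t))) e \<Longrightarrow>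
         norm (add_chart cp c0 c y - add_chart cp c0 c z) \<le> M * norm (y - z)"
      by (rule smooth_on_locally_lipschitz[OF smooth_on_add_chart[OF cp(1) c0(1) c] open_add_dom[OF cp(1) c0(1) c] mem])
         (rule that, assumption+)
    obtain e1 where e1: "0 < e1" "\<And>s. s \<in> {0..1} \<Longrightarrow> \<bar>s - t\<bar> \<le> e1 \<Longrightarrow> \<gamma> s \<in> fst cp"
      using continuous_curve_nearby[OF g t01 chart_homeomorphism(1)[OF cp(1)] cp(2)] by blast
    have "continuous_on {max 0 (t-e1)..min 1 (t+e1)} (\<lambda>s. (snd cp (\<gamma> s), \<phi> (E (x s))))"
    proof (intro continuous_on_Pair)
      show "continuous_on {max 0 (t-e1)..min 1 (t+e1)} (\<lambda>s. snd cp (\<gamma> s))"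
        by (rule continuous_on_compose2[OF chart_continuous(1)[OF cp(1)] continuous_on_subset[OF g]])
           (auto intro!: e1(2))
      show "continuous_on {max 0 (t-e1)..min 1 (t+e1)} (\<lambda>s. \<phi> (E (x s)))"
        by (rule continuous_on_compose2[OF chart_continuous(1)[OF c0(1)] continuous_on_subset[OF Ex]])
           (use x(3) in \<open>auto intro!: E(2) simp: image_subset_iff\<close>)
    qed
    moreover have "t \<in> {max 0 (t-e1)..min 1 (t+e1)}" using t01 e1(1) by auto
    ultimately obtain e2 where e2: "0 < e2" "\<And>s. s \<in> {max 0 (t-e1)..min 1 (t+e1)} \<Longrightarrow> \<bar>s - t\<bar> < e2 \<Longrightarrow>
        dist (snd cp (\<gamma> s), \<phi> (E (x s))) (snd cp (\<gamma> t), \<phi> (E (x t))) < e"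
      unfolding continuous_on_iff dist_real_def using M(1) by blast
    define d where "d = min e1 (e2 / 2)"
    have d: "0 < d" using e1 e2 by (simp add: d_def)
    have in_ball: "(snd cp (\<gamma> s), \<phi> (E (x s))) \<in> cball (snd cp (\<gamma> t), \<phi> (E (x t))) e" "s \<in> {0..1}" "\<gamma> s \<in> fst cp" "x s \<in> {-r..r}"
      if "s \<in> {max a (t - d)..min b (t + d)}" for s
    proof -
      show s01: "s \<in> {0..1}" using that ab by auto
      then show "x s \<in> {-r..r}" using x(3) by blast
      have sd: "\<bar>s - t\<bar> \<le> d" using that by auto
      then show "\<gamma> s \<in> fst cp" using e1 s01 by (auto simp: d_def)
      have "s \<in> {max 0 (t-e1)..min 1 (t+e1)}" "\<bar>s - t\<bar> < e2" using sd s01 e2(1) by (auto simp: d_def)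
      then show "(snd cp (\<gamma> s), \<phi> (E (x s))) \<in> cball (snd cp (\<gamma> t), \<phi> (E (x t))) e"
        using e2(2)[of s] by (simp add: dist_commute)
    qed
    have "abs_cont_on (max a (t - d)) (min b (t + d)) (snd c \<circ> (\<lambda>t. \<gamma> t + E (x t)))"
    proof (rule abs_cont_on_dominated)
      show "abs_cont_on (max a (t - d)) (min b (t + d)) (snd cp \<circ> \<gamma>)"
        by (rule abs_cont_curve_chart[OF \<gamma> cp(1)]) (use ab t d in_ball(3) in auto)
      show "abs_cont_on (max a (t - d)) (min b (t + d)) x"
        by (rule abs_cont_on_subset[OF x(1)]) (use ab in auto)
      show "0 \<le> M * (1 + K)" using M(2) lip(1) by simp
      fix s s' assume s: "s \<in> {max a (t - d)..min b (t + d)}" "s' \<in> {max a (t - d)..min b (t + d)}"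
      have eq: "snd c (\<gamma> s + E (x s)) = add_chart cp c0 c (snd cp (\<gamma> s), \<phi> (E (x s)))"
        if "s \<in> {max a (t - d)..min b (t + d)}" for s
        using in_ball(3,4)[OF that] E(2) by (simp add: add_chart_def chart_inverse cp c0)
      have "norm ((snd c \<circ> (\<lambda>t. \<gamma> t + E (x t))) s - (snd c \<circ> (\<lambda>t. \<gamma> t + E (x t))) s') \<le>
          M * norm ((snd cp (\<gamma> s), \<phi> (E (x s))) - (snd cp (\<gamma> s'), \<phi> (E (x s'))))"
        unfolding o_def eq[OF s(1)] eq[OF s(2)] by (rule M(3)[OF in_ball(1)[OF s(1)] in_ball(1)[OF s(2)]])
      also have "norm ((snd cp (\<gamma> s), \<phi> (E (x s))) - (snd cp (\<gamma> s'), \<phi> (E (x s')))) \<le>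
          norm (snd cp (\<gamma> s) - snd cp (\<gamma> s')) + norm (\<phi> (E (x s)) - \<phi> (E (x s')))"
        by (simp add: norm_Pair_le)
      also have "norm (\<phi> (E (x s)) - \<phi> (E (x s'))) \<le> K * \<bar>x s - x s'\<bar>"
        by (rule lip(2)[OF in_ball(4)[OF s(1)] in_ball(4)[OF s(2)]])
      also have "norm (snd cp (\<gamma> s) - snd cp (\<gamma> s')) + K * \<bar>x s - x s'\<bar> \<le>
          (1 + K) * (norm ((snd cp \<circ> \<gamma>) s - (snd cp \<circ> \<gamma>) s') + norm (x s - x s'))"
        using lip(1) by (simp add: algebra_simps)
      finally show "norm ((snd c \<circ> (\<lambda>t. \<gamma> t + E (x t))) s - (snd c \<circ> (\<lambda>t. \<gamma> t + E (x t))) s') \<le>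
          M * (1 + K) * (norm ((snd cp \<circ> \<gamma>) s - (snd cp \<circ> \<gamma>) s') + norm (x s - x s'))"
        using M(2) by (simp add: mult_left_mono mult.assoc)
    qed
    with d show "\<exists>e>0. abs_cont_on (max a (t - e)) (min b (t + e)) (snd c \<circ> (\<lambda>t. \<gamma> t + E (x t)))" by blast
  qed
qed

lemma left_velocity_integral_curve_reparametrized:
  assumes E: "left_velocity E X (x t) {-r..r}" and x: "(x has_vector_derivative f) (at t within S)" "x ` S \<subseteq> {-r..r}" and t: "t \<in> S"
  shows "left_velocity (\<lambda>s. E (x s)) (f *\<^sub>R X) t S"
proof -
  have "((\<lambda>h. \<phi> (- E (x t) + E h)) has_vector_derivative X) (at (x t) within x ` S)"
    using E x(2) unfolding left_velocity_def by (blast intro: has_vector_derivative_within_subset)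
  from vector_diff_chain_within[OF x(1) this]
  have "((\<lambda>s. \<phi> (- E (x t) + E (x s))) has_vector_derivative f *\<^sub>R X) (at t within S)" by (simp add: o_def)
  moreover have "continuous (at (x t) within x ` S) E"
    using E x(2) unfolding left_velocity_def by (blast intro: continuous_within_subset)
  then have "continuous (at t within S) (\<lambda>s. E (x s))"
    using continuous_within_compose2[OF has_vector_derivative_continuous[OF x(1)]] by blast
  ultimately show ?thesis by (simp add: left_velocity_def)
qed

text \<open>In a chart the control is a continuous, linear function of the coordinate velocity, and the latter is integrable
because the coordinates are absolutely continuous. The coefficients are the partial derivatives of
\<open>add_chart\<close> in its second argument, at the coordinates of \<open>- \<gamma> s\<close> and \<open>\<gamma> s\<close>.\<close>

lemma control_absolutely_integrable:
  assumes "control \<gamma> u"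
  shows "u absolutely_integrable_on {0..1}"
proof (rule absolutely_integrable_on_little_subintervals)
  obtain N where ac: "abs_cont_curve A \<gamma>" and N: "negligible N" "\<And>t. t \<in> {0..1} - N \<Longrightarrow> left_velocity \<gamma> (u t) t {0..1}"
    using assms by (auto simp: control_def)
  have g: "continuous_on {0..1} \<gamma>" by (rule abs_cont_curve_continuous[OF ac])
  fix t assume t: "t \<in> {0..1::real}"
  define cp where "cp = pref_chart A (\<gamma> t)"
  have cp: "cp \<in> A" "\<gamma> t \<in> fst cp" using pref_chart by (auto simp: cp_def)
  define cm where "cm = pref_chart A (- \<gamma> t)"
  have cm: "cm \<in> A" "- \<gamma> t \<in> fst cm" using pref_chart by (auto simp: cm_def)
  have gm: "continuous_on {0..1} (\<lambda>s. - \<gamma> s)"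
    using g unfolding continuous_on_def by (auto intro: group_tendsto)
  obtain e1 where e1: "0 < e1" "\<And>s. s \<in> {0..1} \<Longrightarrow> \<bar>s - t\<bar> \<le> e1 \<Longrightarrow> \<gamma> s \<in> fst cp"
    using continuous_curve_nearby[OF g t chart_homeomorphism(1)[OF cp(1)] cp(2)] by blast
  obtain e2 where e2: "0 < e2" "\<And>s. s \<in> {0..1} \<Longrightarrow> \<bar>s - t\<bar> \<le> e2 \<Longrightarrow> - \<gamma> s \<in> fst cm"
    using continuous_curve_nearby[OF gm t chart_homeomorphism(1)[OF cm(1)] cm(2)] by blast
  let ?G = "\<lambda>b z. frechet_derivative (add_chart cm cp c0) (at z) (0, b)"
  have "u absolutely_integrable_on {c..d}" if cd: "c \<le> d" "{c..d} \<subseteq> {0..1} \<inter> ball t (min e1 e2)" for c d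
  proof -
    have in_cd: "s \<in> {0..1}" "\<gamma> s \<in> fst cp" "- \<gamma> s \<in> fst cm" if "s \<in> {c..d}" for s
    proof -
      have s: "s \<in> {0..1}" "\<bar>s - t\<bar> < min e1 e2" using cd(2) that by (auto simp: dist_real_def abs_minus_commute)
      then show "s \<in> {0..1}" "\<gamma> s \<in> fst cp" "- \<gamma> s \<in> fst cm" using e1(2)[of s] e2(2)[of s] by auto
    qed
    have cd01: "0 \<le> c" "d \<le> 1" using in_cd(1)[of c] in_cd(1)[of d] cd(1) by auto
    define f' where "f' s = vector_derivative (snd cp \<circ> \<gamma>) (at s within {c..d})" for s
    define z where "z s = (snd cm (- \<gamma> s), snd cp (\<gamma> s))" for s
    have zdom: "z s \<in> add_dom cm cp c0" if "s \<in> {c..d}" for s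
      unfolding z_def using in_cd[OF that] by (intro add_dom_mem cm cp) (auto simp: c0)
    have cz: "continuous_on {c..d} z"
      unfolding z_def
      by (intro continuous_on_Pair continuous_on_compose2[OF chart_continuous(1)[OF cm(1)] continuous_on_subset[OF gm]]
          continuous_on_compose2[OF chart_continuous(1)[OF cp(1)] continuous_on_subset[OF g]])
         (use in_cd in \<open>auto simp: image_subset_iff\<close>)
    have key: "((snd cp \<circ> \<gamma>) has_vector_derivative f' s) (at s within {c..d}) \<and> u s = (\<Sum>b\<in>Basis. (f' s \<bullet> b) *\<^sub>R ?G b (z s))"
      if s: "s \<in> {c..d} - (N \<union> {c, d})" for s
    proof -
      have s01: "s \<in> {0..1} - N" "s \<in> {c..d}" "s \<in> {c<..<d}" using s in_cd(1) by auto
      have l: "left_velocity \<gamma> (u s) s {c..d}"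
        using N(2)[OF s01(1)] cd01 unfolding left_velocity_def
        by (auto intro: has_vector_derivative_within_subset continuous_within_subset)
      obtain L where L: "chart_derivative c0 cp (\<lambda>x. \<gamma> s + x) 0 L"
        using chart_derivative_left_translation[of c0 cp 0 "\<gamma> s"] c0 cp in_cd(2)[OF s01(2)] by auto
      have cont: "continuous (at s within {c..d}) \<gamma>" using l by (simp add: left_velocity_def)
      then have "((\<lambda>t. - \<gamma> s + \<gamma> t) \<longlongrightarrow> - \<gamma> s + \<gamma> s) (at s within {c..d})"
        unfolding continuous_within by (intro group_tendsto tendsto_const)
      then have cont2: "continuous (at s within {c..d}) (\<lambda>t. - \<gamma> s + \<gamma> t)" by (simp add: continuous_within)
      have "((\<lambda>t. snd cp (\<gamma> s + (- \<gamma> s + \<gamma> t))) has_vector_derivative L (u s)) (at s within {c..d})"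
        by (rule chart_derivative_curve[OF _ cont2 s01(2)]) (use L l in \<open>auto simp: left_velocity_def\<close>)
      then have dL: "((snd cp \<circ> \<gamma>) has_vector_derivative L (u s)) (at s within {c..d})"
        by (simp add: o_def add.assoc[symmetric])
      then have f's: "((snd cp \<circ> \<gamma>) has_vector_derivative f' s) (at s within {c..d})"
        unfolding f'_def using vector_derivative_works differentiableI_vector by blast
      have D: "(add_chart cm cp c0 has_derivative frechet_derivative (add_chart cm cp c0) (at (z s))) (at (z s))"
        by (rule smooth_on_has_derivative[OF smooth_on_add_chart[OF cm(1) cp(1) c0(1)] zdom[OF s01(2)]])
      let ?M = "\<lambda>v. frechet_derivative (add_chart cm cp c0) (at (z s)) (0, v)"
      have "((\<lambda>y. add_chart cm cp c0 (snd cm (- \<gamma> s), y)) has_derivative ?M) (at (snd cp (\<gamma> s)))"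
        by (rule has_derivative_compose[where f = "\<lambda>y. (snd cm (- \<gamma> s), y)", OF _ D[unfolded z_def], folded z_def])
           (auto intro!: derivative_eq_intros)
      moreover have "isCont (\<lambda>x. - \<gamma> s + x) (\<gamma> s)" unfolding isCont_def by (intro group_tendsto tendsto_intros)
      ultimately have M: "chart_derivative cp c0 (\<lambda>x. - \<gamma> s + x) (\<gamma> s) ?M"
        using cp cm c0 in_cd[OF s01(2)] by (auto simp: chart_derivative_def add_chart_def chart_inverse)
      have "((\<lambda>t. \<phi> (- \<gamma> s + \<gamma> t)) has_vector_derivative ?M (f' s)) (at s within {c..d})"
        by (rule chart_derivative_curve[OF M cont s01(2)]) (use f's in \<open>simp add: o_def\<close>)
      then have "u s = ?M (f' s)"
        using l s01(3) left_velocity_unique[of \<gamma> "u s" s c d "?M (f' s)"] cont by (auto simp: left_velocity_def)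
      also have "\<dots> = ?M (\<Sum>b\<in>Basis. (f' s \<bullet> b) *\<^sub>R b)" by (simp add: euclidean_representation)
      also have "\<dots> = (\<Sum>b\<in>Basis. (f' s \<bullet> b) *\<^sub>R ?M b)"
        using linear_sum[OF chart_derivative_linear[OF M], of "\<lambda>b. (f' s \<bullet> b) *\<^sub>R b" Basis]
        by (simp only: linear_scale[OF chart_derivative_linear[OF M]])
      finally show ?thesis using f's by blast
    qed
    have "abs_cont_on c d (snd cp \<circ> \<gamma>)"
      by (rule abs_cont_curve_chart[OF ac cp(1)]) (use cd01 cd(1) in_cd in auto)
    then have f'int: "f' absolutely_integrable_on {c..d}"
      by (rule derivative_of_abs_cont_absolutely_integrable[where N = "N \<union> {c, d}"]) (use N(1) key in auto)
    have "(\<lambda>s. \<Sum>b\<in>Basis. (f' s \<bullet> b) *\<^sub>R ?G b (z s)) absolutely_integrable_on {c..d}"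
    proof (rule absolutely_integrable_sum)
      fix b :: 'e assume b: "b \<in> Basis"
      have fb: "(\<lambda>s. f' s \<bullet> b) absolutely_integrable_on {c..d}"
        using absolutely_integrable_component[OF f'int] .
      have cG: "continuous_on {c..d} (\<lambda>s. ?G b (z s))"
        by (rule continuous_on_compose2[OF smooth_on_continuous[OF smooth_on_directional_derivative[OF smooth_on_add_chart[OF cm(1) cp(1) c0(1)]]] cz])
           (use zdom in auto)
      have "(\<lambda>s. (\<lambda>v r. r *\<^sub>R v) (?G b (z s)) (f' s \<bullet> b)) absolutely_integrable_on {c..d}"
      proof (rule absolutely_integrable_bounded_measurable_product[where h = "\<lambda>v r. r *\<^sub>R v" and f = "\<lambda>s. ?G b (z s)", OF _ _ _ _ fb])
        show "bilinear (\<lambda>v r. r *\<^sub>R v :: 'e)" by (simp add: bilinear_def linear_iff scaleR_add_left scaleR_add_right)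
        show "(\<lambda>s. ?G b (z s)) \<in> borel_measurable (lebesgue_on {c..d})"
          by (rule continuous_imp_measurable_on_sets_lebesgue[OF cG]) simp
        show "bounded ((\<lambda>s. ?G b (z s)) ` {c..d})"
          by (intro compact_imp_bounded compact_continuous_image cG) simp
      qed simp
      then show "(\<lambda>s. (f' s \<bullet> b) *\<^sub>R ?G b (z s)) absolutely_integrable_on {c..d}" by simp
    qed simp
    then show ?thesis
      by (rule absolutely_integrable_spike[where S = "N \<union> {c, d}"]) (use N(1) key in auto)
  qed
  then show "\<exists>e>0. \<forall>c d. c \<le> d \<and> {c..d} \<subseteq> {0..1} \<inter> ball t e \<longrightarrow> u absolutely_integrable_on {c..d}"
    using e1(1) e2(1) by (intro exI[of _ "min e1 e2"]) simp
qed

text \<open>Resting outside \<open>{t1..t2}\<close> makes any two points of a curve its end points, and spares a change of speed.\<close>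

lemma control_clamp:
  assumes c: "control \<gamma> u" and t: "0 \<le> t1" "t1 \<le> t2" "t2 \<le> 1"
  shows "control (\<lambda>t. \<gamma> (max t1 (min t2 t))) (\<lambda>t. if t \<in> {t1..t2} then u t else 0)"
proof -
  obtain N where ac: "abs_cont_curve A \<gamma>" and N: "negligible N" "\<And>t. t \<in> {0..1} - N \<Longrightarrow> left_velocity \<gamma> (u t) t {0..1}"
    using c by (auto simp: control_def)
  have g: "continuous_on {0..1} \<gamma>" by (rule abs_cont_curve_continuous[OF ac])
  let ?\<theta> = "\<lambda>t. max t1 (min t2 t)"
  have \<theta>c: "continuous_on S ?\<theta>" for S by (intro continuous_intros)
  have gc: "continuous_on {0..1} (\<lambda>t. \<gamma> (?\<theta> t))"
    by (rule continuous_on_compose2[OF g \<theta>c]) (use t in auto)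
  have "abs_cont_curve A (\<lambda>t. \<gamma> (?\<theta> t))"
  proof (rule abs_cont_curveI[OF gc])
    fix c a b assume c: "c \<in> A" and ab: "0 \<le> a" "a \<le> b" "b \<le> 1" and im: "(\<lambda>t. \<gamma> (?\<theta> t)) ` {a..b} \<subseteq> fst c"
    have "\<gamma> ` {?\<theta> a..?\<theta> b} \<subseteq> fst c"
    proof
      fix p assume "p \<in> \<gamma> ` {?\<theta> a..?\<theta> b}"
      then obtain y where y: "y \<in> {?\<theta> a..?\<theta> b}" "p = \<gamma> y" by blast
      have "?\<theta> (max a (min b y)) = y" "max a (min b y) \<in> {a..b}" using y(1) t ab by auto
      then have "\<gamma> y \<in> (\<lambda>t. \<gamma> (?\<theta> t)) ` {a..b}" by (intro image_eqI[of _ _ "max a (min b y)"]) simp_all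
      then show "p \<in> fst c" using im y(2) by blast
    qed
    then have "abs_cont_on (?\<theta> a) (?\<theta> b) (snd c \<circ> \<gamma>)"
      using t ab by (intro abs_cont_curve_chart[OF ac c]) auto
    then have "abs_cont_on a b ((snd c \<circ> \<gamma>) \<circ> ?\<theta>)"
      by (rule abs_cont_on_reparametrize) (auto simp: mono_on_def)
    then show "abs_cont_on a b (snd c \<circ> (\<lambda>t. \<gamma> (?\<theta> t)))" by (simp add: o_def)
  qed
  moreover have "left_velocity (\<lambda>t. \<gamma> (?\<theta> t)) (if s \<in> {t1..t2} then u s else 0) s {0..1}" if s: "s \<in> {0..1} - (N \<union> {t1, t2})" for s
  proof -
    have cs: "continuous (at s within {0..1}) (\<lambda>t. \<gamma> (?\<theta> t))"
      using gc s by (simp add: continuous_on_eq_continuous_within)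
    show ?thesis
    proof (cases "s \<in> {t1..t2}")
      case True
      then have s': "s \<in> {t1<..<t2}" using s by auto
      have "((\<lambda>t. \<phi> (- \<gamma> s + \<gamma> t)) has_vector_derivative u s) (at s within {0..1})"
        using N(2)[of s] s by (simp add: left_velocity_def)
      then have "((\<lambda>t. \<phi> (- \<gamma> s + \<gamma> (?\<theta> t))) has_vector_derivative u s) (at s within {0..1})"
        unfolding has_vector_derivative_def
        by (rule has_derivative_transform_within_open[where s = "{t1<..<t2}"]) (use s' in auto)
      moreover have "?\<theta> s = s" using True by auto
      ultimately show ?thesis using cs True by (simp only: left_velocity_def if_True)
    next
      case False
      define W where "W = (if s < t1 then {..<t1} else {t2<..})"
      have W: "open W" "s \<in> W" "\<And>x. x \<in> W \<Longrightarrow> ?\<theta> x = ?\<theta> s" using False t by (auto simp: W_def)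
      have "((\<lambda>t. \<phi> 0) has_vector_derivative 0) (at s within {0..1})" by simp
      then have "((\<lambda>t. \<phi> (- \<gamma> (?\<theta> s) + \<gamma> (?\<theta> t))) has_vector_derivative 0) (at s within {0..1})"
        unfolding has_vector_derivative_def
        by (rule has_derivative_transform_within_open[OF _ W(1,2)]) (simp add: W(3))
      then show ?thesis using cs False by (auto simp: left_velocity_def)
    qed
  qed
  ultimately show ?thesis
    unfolding control_def using N(1) by (intro conjI exI[of _ "N \<union> {t1, t2}"]) auto
qed

lemma horizontal_imp_control:
  assumes D: "\<And>p. D p = d_left A p 0 ` D 0" "0 \<in> D 0"
    and \<rho>: "\<And>p v w. v \<in> D 0 \<Longrightarrow> w \<in> D 0 \<Longrightarrow> \<rho> p (d_left A p 0 v) (d_left A p 0 w) = \<rho> 0 v w"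
    and h: "horizontal A D \<gamma>"
  obtains u where "control \<gamma> u" "\<And>t. u t \<in> D 0" "curve_length A \<rho> \<gamma> = integral {0..1} (\<lambda>t. sqrt (\<rho> 0 (u t) (u t)))"
proof -
  have ac: "abs_cont_curve A \<gamma>" using h by (simp add: horizontal_def)
  have g: "continuous_on {0..1} \<gamma>" by (rule abs_cont_curve_continuous[OF ac])
  let ?P = "\<lambda>t. (chart_at A (\<gamma> t) \<circ> \<gamma>) differentiable (at t within {0..1}) \<and> velocity A \<gamma> t \<in> D (\<gamma> t)"
  have "AE t in lebesgue_on {0..1}. ?P t" using h unfolding horizontal_def by (elim conjE)
  then have "\<exists>N. negligible N \<and> (\<forall>t\<in>{0..1} - N. ?P t)"
    by (subst (asm) AE_lebesgue_on_iff_negligible) auto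
  then obtain N where N: "negligible N" "\<And>t. t \<in> {0..1} - N \<Longrightarrow> ?P t" by blast
  define u where "u t = (if t \<in> {0..1} - N then d_left A (- \<gamma> t) (\<gamma> t) (velocity A \<gamma> t) else 0)" for t
  have good: "left_velocity \<gamma> (u t) t {0..1}" "u t \<in> D 0" "velocity A \<gamma> t = d_left A (\<gamma> t) 0 (u t)" if t: "t \<in> {0..1} - N" for t
  proof -
    have "continuous (at t within {0..1}) \<gamma>" using g t by (simp add: continuous_on_eq_continuous_within)
    moreover have "((chart_at A (\<gamma> t) \<circ> \<gamma>) has_vector_derivative velocity A \<gamma> t) (at t within {0..1})"
      using N(2)[OF t] unfolding velocity_def by (simp add: vector_derivative_works)
    ultimately show "left_velocity \<gamma> (u t) t {0..1}" using left_velocity_of_chart_velocity t by (auto simp: u_def)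
    obtain w where w: "w \<in> D 0" "velocity A \<gamma> t = d_left A (\<gamma> t) 0 w" using N(2)[OF t] D(1)[of "\<gamma> t"] by blast
    then have "u t = w" using t by (simp add: u_def d_left_cancel)
    with w show "u t \<in> D 0" "velocity A \<gamma> t = d_left A (\<gamma> t) 0 (u t)" by auto
  qed
  show thesis
  proof (rule that)
    show "control \<gamma> u" using ac N(1) good(1) by (auto simp: control_def)
    show "u t \<in> D 0" for t using good(2)[of t] D(2) by (cases "t \<in> {0..1} - N") (auto simp: u_def)
    show "curve_length A \<rho> \<gamma> = integral {0..1} (\<lambda>t. sqrt (\<rho> 0 (u t) (u t)))"
      unfolding curve_length_def by (rule integral_spike[OF N(1)]) (use good(2,3) \<rho> in auto)
  qed
qed

lemma control_imp_horizontal: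
  assumes D: "\<And>p. D p = d_left A p 0 ` D 0"
    and \<rho>: "\<And>p v w. v \<in> D 0 \<Longrightarrow> w \<in> D 0 \<Longrightarrow> \<rho> p (d_left A p 0 v) (d_left A p 0 w) = \<rho> 0 v w"
    and u: "control \<gamma> u" "\<And>t. u t \<in> D 0"
  shows "horizontal A D \<gamma>" "curve_length A \<rho> \<gamma> = integral {0..1} (\<lambda>t. sqrt (\<rho> 0 (u t) (u t)))"
proof -
  obtain N where ac: "abs_cont_curve A \<gamma>" and N: "negligible N" "\<And>t. t \<in> {0..1} - N \<Longrightarrow> left_velocity \<gamma> (u t) t {0..1}"
    using u by (auto simp: control_def)
  have good: "(chart_at A (\<gamma> t) \<circ> \<gamma>) differentiable (at t within {0..1})" "velocity A \<gamma> t = d_left A (\<gamma> t) 0 (u t)"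
    if t: "t \<in> {0..1} - N" for t
  proof -
    have d: "((chart_at A (\<gamma> t) \<circ> \<gamma>) has_vector_derivative d_left A (\<gamma> t) 0 (u t)) (at t within {0..1})"
      by (rule chart_velocity_of_left_velocity[OF N(2)[OF t]]) (use t in auto)
    then show "(chart_at A (\<gamma> t) \<circ> \<gamma>) differentiable (at t within {0..1})" by (rule differentiableI_vector)
    show "velocity A \<gamma> t = d_left A (\<gamma> t) 0 (u t)"
      unfolding velocity_def
      by (rule vector_derivative_within_closed_interval[OF _ _ d, unfolded cbox_interval]) (use t in auto)
  qed
  have "AE t in lebesgue_on {0..1}. (chart_at A (\<gamma> t) \<circ> \<gamma>) differentiable (at t within {0..1}) \<and> velocity A \<gamma> t \<in> D (\<gamma> t)"
  proof (subst AE_lebesgue_on_iff_negligible)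
    have "velocity A \<gamma> t \<in> D (\<gamma> t)" if "t \<in> {0..1} - N" for t
      unfolding good(2)[OF that] D[of "\<gamma> t"] by (rule imageI[OF u(2)])
    then show "\<exists>N. negligible N \<and> (\<forall>t\<in>{0..1} - N.
        (chart_at A (\<gamma> t) \<circ> \<gamma>) differentiable (at t within {0..1}) \<and> velocity A \<gamma> t \<in> D (\<gamma> t))"
      using N(1) good(1) by blast
  qed simp
  with ac show "horizontal A D \<gamma>" by (simp add: horizontal_def)
  show "curve_length A \<rho> \<gamma> = integral {0..1} (\<lambda>t. sqrt (\<rho> 0 (u t) (u t)))"
    unfolding curve_length_def by (rule integral_spike[OF N(1)]) (use good(2) \<rho> u(2) in auto)
qed

end

context two_step_lie_group
begin

text \<open>The new curve is \<open>\<gamma> t + E (x t)\<close> for an integral curve \<open>E\<close> of \<open>X\<close>. Since \<open>E\<close> exists only for short time, \<open>x\<close> is divided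
by a large \<open>n\<close> and the step is repeated \<open>n\<close> times; the increments of the control add up because the bracket of \<open>X\<close> with each of them
vanishes.\<close>

theorem control_perturbation:
  assumes \<gamma>: "control \<gamma> u" and f: "f absolutely_integrable_on {0..1}"
  defines "x \<equiv> \<lambda>t. integral {0..t} f :: real"
  obtains \<eta> where "control \<eta> (\<lambda>t. u t - x t *\<^sub>R lie_bracket A X (u t) + f t *\<^sub>R X)"
    "\<eta> 0 = \<gamma> 0" "x 1 = 0 \<Longrightarrow> \<eta> 1 = \<gamma> 1"
proof -
  obtain r E K where r: "0 < r" and E: "E 0 = 0" "0 \<le> K" "continuous_on {-r..r} E"
    "\<And>s. s \<in> {-r..r} \<Longrightarrow> E s \<in> fst c0" "\<And>s. s \<in> {-r..r} \<Longrightarrow> left_velocity E X s {-r..r}"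
    "\<And>s t. s \<in> {-r..r} \<Longrightarrow> t \<in> {-r..r} \<Longrightarrow> norm (\<phi> (E s) - \<phi> (E t)) \<le> K * \<bar>s - t\<bar>"
    by (rule local_integral_curve[of X]) (rule that, assumption+)
  have fi: "f integrable_on {0..1}" using f by (simp add: absolutely_integrable_on_def)
  have xac: "abs_cont_on 0 1 x" unfolding x_def by (rule abs_cont_on_integral[OF f])
  have xc: "continuous_on {0..1} x" unfolding x_def by (rule indefinite_integral_continuous_1[OF fi])
  obtain Nx where Nx: "negligible Nx" "\<And>t. t \<in> {0..1} - Nx \<Longrightarrow> (x has_vector_derivative f t) (at t within {0..1})"
    using indefinite_integral_has_vector_derivative_ae[OF fi] unfolding x_def by blast
  have "bounded (x ` {0..1})" by (intro compact_imp_bounded compact_continuous_image xc) simp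
  then obtain B where "\<forall>v\<in>x ` {0..1}. norm v \<le> B" unfolding bounded_iff by blast
  then have B: "\<bar>x t\<bar> \<le> B" if "t \<in> {0..1}" for t using that by auto
  obtain n where n: "B / r < real n" using reals_Archimedean2 by blast
  have B0: "0 \<le> B" using B[of 0] by (auto intro: order_trans[OF abs_ge_zero])
  then have n0: "0 < real n" using n r by (meson divide_nonneg_pos order_le_less_trans)
  define y where "y t = x t / n" for t
  have yr: "y ` {0..1} \<subseteq> {-r..r}"
  proof
    fix v assume "v \<in> y ` {0..1}"
    then obtain t where t: "t \<in> {0..1}" "v = x t / n" by (auto simp: y_def)
    have "\<bar>x t\<bar> \<le> r * n" using B[OF t(1)] n r by (simp add: divide_less_eq mult.commute)
    then have "\<bar>v\<bar> \<le> r" using n0 t(2) by (simp add: divide_le_eq)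
    then show "v \<in> {-r..r}" by auto
  qed
  have yac: "abs_cont_on 0 1 y"
    by (rule abs_cont_on_dominated[OF xac xac, of "1 / n"])
       (use n0 in \<open>auto simp: y_def diff_divide_distrib[symmetric] divide_right_mono\<close>)
  have yc: "continuous_on {0..1} y" unfolding y_def by (intro continuous_intros xc) (use n0 in auto)
  have y0: "y 0 = 0" by (simp add: y_def x_def)
  let ?u = "\<lambda>k t. u t - (real k * y t) *\<^sub>R lie_bracket A X (u t) + (real k * (f t / n)) *\<^sub>R X"
  have step: "\<exists>\<eta>. control \<eta> (?u k) \<and> \<eta> 0 = \<gamma> 0 \<and> (x 1 = 0 \<longrightarrow> \<eta> 1 = \<gamma> 1)" for k
  proof (induction k)
    case 0
    then show ?case using \<gamma> by (intro exI[of _ \<gamma>]) simp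
  next
    case (Suc k)
    then obtain \<eta> where \<eta>: "control \<eta> (?u k)" "\<eta> 0 = \<gamma> 0" "x 1 = 0 \<Longrightarrow> \<eta> 1 = \<gamma> 1" by blast
    obtain N where ac: "abs_cont_curve A \<eta>" and N: "negligible N" "\<And>t. t \<in> {0..1} - N \<Longrightarrow> left_velocity \<eta> (?u k t) t {0..1}"
      using \<eta>(1) by (auto simp: control_def)
    let ?\<eta> = "\<lambda>t. \<eta> t + E (y t)"
    have "abs_cont_curve A ?\<eta>"
      by (rule abs_cont_curve_add[OF ac yac yc yr E(3,4) E(2) E(6)])
    moreover have "left_velocity ?\<eta> (?u (Suc k) t) t {0..1}" if t: "t \<in> {0..1} - (N \<union> Nx)" for t
    proof -
      have yt: "y t \<in> {-r..r}" using yr t by blast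
      have "(y has_vector_derivative f t / n) (at t within {0..1})"
        using has_vector_derivative_mult_right[OF Nx(2), of t "1 / n"] t
        by (simp add: y_def[abs_def] mult.commute divide_inverse)
      then have "left_velocity (\<lambda>s. E (y s)) ((f t / n) *\<^sub>R X) t {0..1}"
        by (rule left_velocity_integral_curve_reparametrized[OF E(5)[OF yt] _ yr]) (use t in auto)
      then have "left_velocity ?\<eta> (Ad (- E (y t)) (?u k t) + (f t / n) *\<^sub>R X) t {0..1}"
        by (intro left_velocity_add N(2)) (use t in auto)
      also have "Ad (- E (y t)) (?u k t) = ?u k t - y t *\<^sub>R lie_bracket A X (?u k t)"
        by (rule Ad_integral_curve[OF r E(1,5) yt])
      also have "lie_bracket A X (?u k t) = lie_bracket A X (u t)"
      proof -
        have "lie_bracket A X X = 0" by (simp add: lie_bracket_eq)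
        then show ?thesis
          by (simp add: bilinear_radd[OF bilinear_lie_bracket] bilinear_rsub[OF bilinear_lie_bracket]
              bilinear_rmul[OF bilinear_lie_bracket] lie_bracket_derived[OF lie_bracket_in_derived])
      qed
      also have "?u k t - y t *\<^sub>R lie_bracket A X (u t) + (f t / n) *\<^sub>R X = ?u (Suc k) t"
        by (simp add: algebra_simps add_divide_distrib)
      finally show ?thesis .
    qed
    ultimately have "control ?\<eta> (?u (Suc k))"
      unfolding control_def using N(1) Nx(1) by (intro conjI exI[of _ "N \<union> Nx"]) auto
    moreover have "?\<eta> 0 = \<gamma> 0" using \<eta>(2) y0 E(1) by simp
    moreover have "?\<eta> 1 = \<gamma> 1" if "x 1 = 0" using \<eta>(3)[OF that] that E(1) by (simp add: y_def)
    ultimately show ?case by blast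
  qed
  have un: "?u n = (\<lambda>t. u t - x t *\<^sub>R lie_bracket A X (u t) + f t *\<^sub>R X)"
    using n0 by (simp add: y_def fun_eq_iff)
  obtain \<eta> where \<eta>: "control \<eta> (?u n)" "\<eta> 0 = \<gamma> 0" "x 1 = 0 \<longrightarrow> \<eta> 1 = \<gamma> 1" using step[of n] by blast
  show thesis
    by (rule that[OF \<eta>(1)[unfolded un] \<eta>(2)]) (use \<eta>(3) in blast)
qed

end

section \<open>Weighted integrals and loops\<close>

text \<open>Integrate \<open>0 \<le> (f - \<theta> w)\<^sup>2 / w\<close> for the optimal number \<open>\<theta>\<close>.\<close>

lemma cauchy_schwarz_weighted:
  fixes f w :: "real \<Rightarrow> real"
  assumes f: "f integrable_on {0..1}" and w: "w integrable_on {0..1}" "\<And>t. 0 < w t" "0 < integral {0..1} w"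
    and q: "(\<lambda>t. (f t)\<^sup>2 / w t) integrable_on {0..1}"
  shows "(integral {0..1} f)\<^sup>2 \<le> integral {0..1} w * integral {0..1} (\<lambda>t. (f t)\<^sup>2 / w t)"
proof -
  let ?F = "integral {0..1} f" and ?W = "integral {0..1} w" and ?Q = "integral {0..1} (\<lambda>t. (f t)\<^sup>2 / w t)"
  \<comment> \<open>The minimiser of the quadratic polynomial obtained by integration.\<close>
  define \<theta> where "\<theta> = ?F / ?W"
  have i: "(\<lambda>t. 2 * \<theta> * f t) integrable_on {0..1}" "(\<lambda>t. \<theta>\<^sup>2 * w t) integrable_on {0..1}"
    using integrable_cmul[OF f, of "2 * \<theta>"] integrable_cmul[OF w(1), of "\<theta>\<^sup>2"] by simp_all
  have 1: "(\<lambda>t. 2 * \<theta> * f t - \<theta>\<^sup>2 * w t) integrable_on {0..1}"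
    by (intro integrable_diff i)
  have "integral {0..1} (\<lambda>t. 2 * \<theta> * f t - \<theta>\<^sup>2 * w t) \<le> ?Q"
  proof (rule integral_le[OF 1 q])
    fix t :: real
    have "0 \<le> (f t - \<theta> * w t)\<^sup>2 / w t" using w(2)[of t] by (simp add: less_imp_le)
    also have "\<dots> = (f t)\<^sup>2 / w t - (2 * \<theta> * f t - \<theta>\<^sup>2 * w t)"
      using w(2)[of t] by (simp add: power2_eq_square field_simps)
    finally show "2 * \<theta> * f t - \<theta>\<^sup>2 * w t \<le> (f t)\<^sup>2 / w t" by simp
  qed
  moreover have "integral {0..1} (\<lambda>t. 2 * \<theta> * f t - \<theta>\<^sup>2 * w t) = 2 * \<theta> * ?F - \<theta>\<^sup>2 * ?W"
    by (simp add: integral_diff[OF i])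
  moreover have "2 * \<theta> * ?F - \<theta>\<^sup>2 * ?W = ?F\<^sup>2 / ?W"
    using w(3) by (simp add: \<theta>_def power2_eq_square)
  ultimately have "?F\<^sup>2 / ?W \<le> ?Q" by simp
  then show ?thesis using w(3) by (simp add: divide_le_eq mult.commute)
qed

lemma absolutely_integrable_bounded_scaleR:
  fixes h :: "real \<Rightarrow> real" and F :: "real \<Rightarrow> 'a::euclidean_space"
  assumes h: "h \<in> borel_measurable (lebesgue_on {0..1})" "\<And>t. t \<in> {0..1} \<Longrightarrow> \<bar>h t\<bar> \<le> B"
    and F: "F absolutely_integrable_on {0..1}"
  shows "(\<lambda>t. h t *\<^sub>R F t) absolutely_integrable_on {0..1}"
  by (rule absolutely_integrable_bounded_measurable_product[where h = "\<lambda>r v. r *\<^sub>R v", OF _ h(1) _ _ F])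
     (use h(2) in \<open>auto simp: bilinear_def linear_iff scaleR_add_left scaleR_add_right bounded_iff intro!: exI[of _ B]\<close>)

lemma absolutely_integrable_bounded_mult:
  fixes h F :: "real \<Rightarrow> real"
  assumes h: "h \<in> borel_measurable (lebesgue_on {0..1})" "\<And>t. t \<in> {0..1} \<Longrightarrow> \<bar>h t\<bar> \<le> B"
    and F: "F absolutely_integrable_on {0..1}"
  shows "(\<lambda>t. h t * F t) absolutely_integrable_on {0..1}"
  using absolutely_integrable_bounded_scaleR[OF h F] by simp

lemma continuous_bounded_measurable:
  fixes x :: "real \<Rightarrow> real"
  assumes "continuous_on {0..1} x"
  obtains B where "x \<in> borel_measurable (lebesgue_on {0..1})" "\<And>t. t \<in> {0..1} \<Longrightarrow> \<bar>x t\<bar> \<le> B"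
proof -
  have "bounded (x ` {0..1})" by (intro compact_imp_bounded compact_continuous_image assms) simp
  then obtain B where "\<forall>v\<in>x ` {0..1}. norm v \<le> B" unfolding bounded_iff by blast
  moreover have "x \<in> borel_measurable (lebesgue_on {0..1})"
    by (rule continuous_imp_measurable_on_sets_lebesgue[OF assms]) simp
  ultimately show thesis by (intro that[of B]) auto
qed

lemma linear_dependence_of_many:
  fixes F :: "nat \<Rightarrow> 'v::euclidean_space"
  assumes "DIM('v) < M"
  obtains \<alpha> where "(\<Sum>j<M. \<alpha> j *\<^sub>R F j) = 0" "\<exists>j<M. \<alpha> j \<noteq> (0::real)"
proof (cases "inj_on F {..<M}")
  case True
  have "dependent (F ` {..<M})"
    by (rule dependent_biggerset) (use assms in \<open>simp add: card_image[OF True]\<close>)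
  then obtain g where g: "(\<Sum>v\<in>F ` {..<M}. g v *\<^sub>R v) = 0" "\<exists>v\<in>F ` {..<M}. g v \<noteq> 0"
    using dependent_finite[of "F ` {..<M}"] by auto
  show thesis
    by (rule that[of "\<lambda>j. g (F j)"]) (use g in \<open>auto simp: sum.reindex[OF True]\<close>)
next
  case False
  then obtain i j where ij: "i < M" "j < M" "i \<noteq> j" "F i = F j" by (auto simp: inj_on_def)
  define \<alpha> :: "nat \<Rightarrow> real" where "\<alpha> = (\<lambda>k. if k = i then 1 else if k = j then -1 else 0)"
  have "(\<Sum>k<M. \<alpha> k *\<^sub>R F k) = (\<Sum>k\<in>{i, j}. \<alpha> k *\<^sub>R F k)"
    by (rule sum.mono_neutral_right) (use ij in \<open>auto simp: \<alpha>_def\<close>)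
  also have "\<dots> = 0" using ij by (simp add: \<alpha>_def)
  finally show thesis by (rule that) (use ij in \<open>auto simp: \<alpha>_def intro: exI[of _ i]\<close>)
qed

text \<open>Here \<open>step i\<close> is the indicator of the \<open>i\<close>-th of \<open>n\<close> consecutive intervals of equal \<open>w\<close>-mass, and \<open>ramp i\<close> is the
primitive of \<open>w * step i\<close>. These are the building blocks of polygonal loops whose speed is proportional to \<open>w\<close>.\<close>

lemma equal_mass_steps:
  fixes w :: "real \<Rightarrow> real"
  assumes w: "w absolutely_integrable_on {0..1}" "\<And>t. 0 < w t" and n: "0 < n"
  defines "m \<equiv> integral {0..1} w / real n"
  obtains step ramp :: "nat \<Rightarrow> real \<Rightarrow> real"
  where "\<And>i t. i < n \<Longrightarrow> step i t \<in> {0, 1}"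
    "\<And>i. i < n \<Longrightarrow> step i \<in> borel_measurable (lebesgue_on {0..1})"
    "\<And>i t. i < n \<Longrightarrow> t \<in> {0..1} \<Longrightarrow> integral {0..t} (\<lambda>s. w s * step i s) = ramp i t"
    "\<And>i. i < n \<Longrightarrow> ramp i 1 = m"
    "\<And>i j t. i < n \<Longrightarrow> j < n \<Longrightarrow> t \<in> {0..1} \<Longrightarrow> i < j \<Longrightarrow> step j t = 1 \<Longrightarrow> ramp i t = m"
    "\<And>i j t. i < n \<Longrightarrow> j < n \<Longrightarrow> t \<in> {0..1} \<Longrightarrow> j < i \<Longrightarrow> step j t = 1 \<Longrightarrow> ramp i t = 0"
proof -
  have wi: "w integrable_on {0..1}" using w by (simp add: absolutely_integrable_on_def)
  have wint: "w integrable_on {a..b}" if "0 \<le> a" "b \<le> 1" for a b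
    by (rule integrable_on_subinterval[OF wi]) (use that in auto)
  define \<sigma> where "\<sigma> t = integral {0..t} w" for t
  have \<sigma>c: "continuous_on {0..1} \<sigma>" unfolding \<sigma>_def by (rule indefinite_integral_continuous_1[OF wi])
  have \<sigma>d: "integral {a..b} w = \<sigma> b - \<sigma> a" if "0 \<le> a" "a \<le> b" "b \<le> 1" for a b
  proof -
    have "integral {0..a} w + integral {a..b} w = integral {0..b} w"
      by (rule Henstock_Kurzweil_Integration.integral_combine) (use that wint in auto)
    then show ?thesis by (simp add: \<sigma>_def)
  qed
  have \<sigma>mono: "\<sigma> a \<le> \<sigma> b" if "0 \<le> a" "a \<le> b" "b \<le> 1" for a b
  proof -
    have "0 \<le> integral {a..b} w" by (rule integral_nonneg) (use wint that w(2) in \<open>auto intro: less_imp_le\<close>)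
    then show ?thesis using \<sigma>d[OF that] by simp
  qed
  have m: "\<sigma> 0 = 0" "\<sigma> 1 = n * m" using n by (simp_all add: \<sigma>_def m_def)
  have m0: "0 \<le> m" using \<sigma>mono[of 0 1] m n by (simp add: zero_le_mult_iff)
  have "\<exists>t\<in>{0..1}. \<sigma> t = real i * m" if "i \<le> n" for i
  proof -
    have "\<sigma> 0 \<le> real i * m" "real i * m \<le> \<sigma> 1" using that m0 by (auto simp: m intro: mult_right_mono)
    from IVT'[OF this _ \<sigma>c] show ?thesis by auto
  qed
  then obtain \<tau>0 where \<tau>0: "\<And>i. i \<le> n \<Longrightarrow> \<tau>0 i \<in> {0..1}" "\<And>i. i \<le> n \<Longrightarrow> \<sigma> (\<tau>0 i) = real i * m" by metis
  \<comment> \<open>Taking maxima makes the division points monotone in case that \<open>\<tau>0\<close> is not.\<close>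
  define \<tau> where "\<tau> i = Max (\<tau>0 ` {..i})" for i
  have \<tau>: "\<tau> i \<in> {0..1}" "\<sigma> (\<tau> i) = real i * m" if "i \<le> n" for i
  proof -
    have "\<tau> i \<in> \<tau>0 ` {..i}" unfolding \<tau>_def by (rule Max_in) auto
    then obtain k where k: "k \<le> i" "\<tau> i = \<tau>0 k" by auto
    then show 1: "\<tau> i \<in> {0..1}" using \<tau>0(1)[of k] that by simp
    have "\<tau>0 i \<le> \<tau> i" unfolding \<tau>_def by (rule Max_ge) auto
    then have "\<sigma> (\<tau>0 i) \<le> \<sigma> (\<tau> i)" using \<tau>0(1)[OF that] 1 by (intro \<sigma>mono) auto
    moreover have "\<sigma> (\<tau> i) \<le> real i * m" using k \<tau>0(2)[of k] that m0 by (auto intro: mult_right_mono)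
    ultimately show "\<sigma> (\<tau> i) = real i * m" using \<tau>0(2)[OF that] by simp
  qed
  have \<tau>mono: "\<tau> i \<le> \<tau> j" if "i \<le> j" for i j
    unfolding \<tau>_def by (rule Max_mono) (use that in auto)
  define step :: "nat \<Rightarrow> real \<Rightarrow> real" where "step i t = indicator {\<tau> i<..\<tau> (Suc i)} t" for i t
  define ramp where "ramp i t = \<sigma> (max (\<tau> i) (min t (\<tau> (Suc i)))) - \<sigma> (\<tau> i)" for i t
  show thesis
  proof (rule that[of step ramp])
    fix i assume i: "i < n"
    have \<tau>i: "\<tau> i \<in> {0..1}" "\<tau> (Suc i) \<in> {0..1}" "\<sigma> (\<tau> i) = real i * m" "\<sigma> (\<tau> (Suc i)) = real (Suc i) * m"
      "\<tau> i \<le> \<tau> (Suc i)" using \<tau>[of i] \<tau>[of "Suc i"] \<tau>mono[of i "Suc i"] i by auto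
    show "step i t \<in> {0, 1}" for t by (auto simp: step_def indicator_def)
    show "step i \<in> borel_measurable (lebesgue_on {0..1})"
    proof -
      have "step i = indicator {\<tau> i<..\<tau> (Suc i)}" by (simp add: step_def fun_eq_iff)
      moreover have "indicat_real {\<tau> i<..\<tau> (Suc i)} \<in> borel_measurable (lebesgue_on {0..1})"
        by (intro measurable_restrict_space1 borel_measurable_indicator) auto
      ultimately show ?thesis by simp
    qed
    show ramp: "integral {0..t} (\<lambda>s. w s * step i s) = ramp i t" if t: "t \<in> {0..1}" for t
    proof -
      let ?J = "{\<tau> i..min t (\<tau> (Suc i))}"
      have "integral {0..t} (\<lambda>s. w s * step i s) = integral {0..t} (\<lambda>s. if s \<in> ?J then w s else 0)"
        by (rule integral_spike[of "{\<tau> i}"]) (auto simp: step_def indicator_def)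
      also have "\<dots> = integral ({0..t} \<inter> ?J) w"
        by (subst integral_restrict_Int) (simp add: Int_commute)
      also have "{0..t} \<inter> ?J = ?J" using \<tau>i(1) by auto
      also have "integral ?J w = ramp i t"
        using \<sigma>d[of "\<tau> i" "min t (\<tau> (Suc i))"] \<tau>i t by (cases "\<tau> i \<le> t") (auto simp: ramp_def max_def min_def)
      finally show ?thesis .
    qed
    show "ramp i 1 = m" using \<tau>i by (auto simp: ramp_def algebra_simps)
    fix j t assume j: "j < n" and t: "t \<in> {0..1::real}" and s: "step j t = 1"
    then have jt: "\<tau> j < t" "t \<le> \<tau> (Suc j)" by (auto simp: step_def indicator_def split: if_splits)
    show "ramp i t = m" if "i < j"
    proof -
      have "\<tau> (Suc i) \<le> t" using \<tau>mono[of "Suc i" j] that jt by simp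
      then show ?thesis using \<tau>i by (simp add: ramp_def algebra_simps)
    qed
    show "ramp i t = 0" if "j < i"
    proof -
      have "t \<le> \<tau> i" using \<tau>mono[of "Suc j" i] that jt by simp
      then show ?thesis using \<tau>i by (simp add: ramp_def)
    qed
  qed
qed

lemma sum_abs_squared_le:
  fixes \<alpha> :: "nat \<Rightarrow> real"
  shows "(\<Sum>j<M. \<bar>\<alpha> j\<bar>)\<^sup>2 \<le> real M * (\<Sum>j<M. (\<alpha> j)\<^sup>2)"
  using Cauchy_Schwarz_ineq_sum[of "\<lambda>_. 1" "\<lambda>j. \<bar>\<alpha> j\<bar>" "{..<M}"] by simp

section \<open>Replacing a control at bounded cost\<close>

text \<open>The property of the set of controls steering between two given points that is used from here on. It detaches the
estimates from the group.\<close>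

definition perturbation_closed :: "('e::euclidean_space \<Rightarrow> 'e \<Rightarrow> 'e) \<Rightarrow> ((real \<Rightarrow> 'e) \<Rightarrow> bool) \<Rightarrow> bool" where
  "perturbation_closed br R \<longleftrightarrow> (\<forall>u f X. R u \<longrightarrow> u absolutely_integrable_on {0..1} \<longrightarrow> f absolutely_integrable_on {0..1} \<longrightarrow>
     integral {0..1} f = 0 \<longrightarrow> R (\<lambda>t. u t - integral {0..t} f *\<^sub>R br X (u t) + f t *\<^sub>R X))"

lemma perturbation_closedD:
  "perturbation_closed br R \<Longrightarrow> R u \<Longrightarrow> u absolutely_integrable_on {0..1} \<Longrightarrow> f absolutely_integrable_on {0..1} \<Longrightarrow>
     integral {0..1} f = 0 \<Longrightarrow> R (\<lambda>t. u t - integral {0..t} f *\<^sub>R br X (u t) + f t *\<^sub>R X)"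
  by (simp add: perturbation_closed_def)

text \<open>The algebraic data that remain: \<open>Z\<close> is the derived algebra, and \<open>\<beta>\<close> is the metric, extended to the whole space and
therefore only semidefinite.\<close>

locale two_step_control =
  fixes br :: "'e::euclidean_space \<Rightarrow> 'e \<Rightarrow> 'e" and Z V :: "'e set" and \<beta> :: "'e \<Rightarrow> 'e \<Rightarrow> real"
  assumes br: "bilinear br" and br_antisym: "\<And>x y. br x y = - br y x"
    and br_Z: "\<And>x y. br x y \<in> Z" and br_central: "\<And>x z. z \<in> Z \<Longrightarrow> br x z = 0"
    and Z: "subspace Z" and V: "subspace V"
    and \<beta>: "bilinear \<beta>" and \<beta>_sym: "\<And>x y. \<beta> x y = \<beta> y x" and \<beta>_nonneg: "\<And>x. 0 \<le> \<beta> x x"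
    and generate: "Z \<subseteq> span {br X Y |X Y. X \<in> V \<and> Y \<in> V}"
begin

lemmas br_simps = bilinear_radd[OF br] bilinear_rsub[OF br] bilinear_rmul[OF br] bilinear_rzero[OF br]
lemmas \<beta>_simps = bilinear_radd[OF \<beta>] bilinear_ladd[OF \<beta>] bilinear_rmul[OF \<beta>] bilinear_lmul[OF \<beta>]

lemma absolutely_integrable_br: "u absolutely_integrable_on S \<Longrightarrow> (\<lambda>t. br X (u t)) absolutely_integrable_on S"
  using absolutely_integrable_linear[where f = u and h = "br X"] br
  by (simp add: o_def bilinear_def linear_conv_bounded_linear)

lemma absolutely_integrable_\<beta>: "u absolutely_integrable_on S \<Longrightarrow> (\<lambda>t. \<beta> (u t) X) absolutely_integrable_on S"
  using absolutely_integrable_linear[where f = u and h = "\<lambda>v. \<beta> v X"] \<beta>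
  by (simp add: o_def bilinear_def linear_conv_bounded_linear)

text \<open>Perturbations in central directions do not create brackets, so \<open>g\<close> can be added one component at a time.\<close>

lemma add_central:
  assumes R: "perturbation_closed br R" "R u" and u: "u absolutely_integrable_on {0..1}"
    and g: "g absolutely_integrable_on {0..1}" "\<And>t. g t \<in> Z" "integral {0..1} g = 0"
  shows "R (\<lambda>t. u t + g t)"
proof -
  obtain B where B: "B \<subseteq> Z" "pairwise orthogonal B" "\<And>x. x \<in> B \<Longrightarrow> norm x = 1" "independent B" "span B = Z"
    using orthonormal_basis_subspace[OF Z] by metis
  have fB: "finite B" by (rule independent_imp_finite[OF B(4)])
  have comp: "(\<lambda>t. g t \<bullet> b) absolutely_integrable_on {0..1}" for b
    using absolutely_integrable_component[OF g(1)] .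
  have "R (\<lambda>t. u t + (\<Sum>b\<in>F. (g t \<bullet> b) *\<^sub>R b))" if "F \<subseteq> B" for F
    using finite_subset[OF that fB] that
  proof (induction F rule: finite_induct)
    case empty
    then show ?case using R(2) by simp
  next
    case (insert b F)
    let ?u = "\<lambda>t. u t + (\<Sum>b\<in>F. (g t \<bullet> b) *\<^sub>R b)"
    have bZ: "b \<in> Z" using insert.prems B(1) by auto
    have "?u absolutely_integrable_on {0..1}"
      by (intro set_integral_add(1) u absolutely_integrable_sum insert.hyps absolutely_integrable_scaleR_right comp)
    moreover have "integral {0..1} (\<lambda>t. g t \<bullet> b) = 0"
      using integral_component_eq[of g "{0..1}" b] g(1,3) by (simp add: absolutely_integrable_on_def)
    ultimately have "R (\<lambda>t. ?u t - integral {0..t} (\<lambda>t. g t \<bullet> b) *\<^sub>R br b (?u t) + (g t \<bullet> b) *\<^sub>R b)"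
      using insert by (intro perturbation_closedD[OF R(1)] comp) auto
    moreover have "br b x = 0" for x using br_antisym[of b x] br_central[OF bZ] by simp
    ultimately show ?case using insert.hyps by (simp add: algebra_simps)
  qed
  from this[of B] show ?thesis
    using orthonormal_basis_expand[OF B(2,3) _ fB] B(5) g(2) by simp
qed

text \<open>The control \<open>a + k\<close> steers as desired and is correct up to the constant \<open>k\<close>.\<close>

definition admissible :: "((real \<Rightarrow> 'e) \<Rightarrow> bool) \<Rightarrow> (real \<Rightarrow> real) \<Rightarrow> (real \<Rightarrow> 'e) \<Rightarrow> 'e \<Rightarrow> bool" where
  "admissible R w a k \<longleftrightarrow> a absolutely_integrable_on {0..1} \<and> (\<forall>t. a t \<in> V) \<and> k \<in> Z \<and>
     (\<lambda>t. \<beta> (a t) (a t) / w t) integrable_on {0..1} \<and> R (\<lambda>t. a t + k)"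

text \<open>An upper bound for the squared length, with equality if \<open>w\<close> is the speed of the control \<open>a\<close>. For fixed \<open>w\<close> it is a
quadratic form in the control, so that the cost of a perturbation can be expanded.\<close>

definition energy :: "(real \<Rightarrow> real) \<Rightarrow> (real \<Rightarrow> 'e) \<Rightarrow> real" where
  "energy w a = integral {0..1} w * integral {0..1} (\<lambda>t. \<beta> (a t) (a t) / w t)"

definition weight :: "(real \<Rightarrow> real) \<Rightarrow> bool" where
  "weight w \<longleftrightarrow> w absolutely_integrable_on {0..1} \<and> (\<forall>t. 0 < w t) \<and> 0 < integral {0..1} w"

text \<open>The perturbation runs through \<open>M\<close> disjoint loops, the \<open>j\<close>-th of them moving by \<open>\<alpha> j\<close> along \<open>X\<close>, \<open>Y\<close>, \<open>-X\<close>, \<open>-Y\<close> in four intervals of equal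
mass. The enclosed areas add up to a multiple of the sum of the squares of the \<open>\<alpha> j\<close>, and the energy of the loops
is at most a multiple of the same sum. The cross terms with \<open>a\<close> are linear in \<open>\<alpha>\<close> and take values in a space of dimension less than \<open>M\<close>, so some nonzero
\<open>\<alpha>\<close> makes them vanish; it is then scaled to enclose the area \<open>c\<close>.\<close>

lemma cancel_positive_multiple_of_bracket:
  assumes X: "X \<in> V" and Y: "Y \<in> V"
  obtains K where "0 \<le> K" "\<And>R w a k c. perturbation_closed br R \<Longrightarrow> weight w \<Longrightarrow> 0 \<le> c \<Longrightarrow> admissible R w a k \<Longrightarrow>
     \<exists>a'. admissible R w a' (k - c *\<^sub>R br X Y) \<and> energy w a' \<le> energy w a + K * c"
proof -
  \<comment> \<open>One more loop than there are cross terms: a scalar one in the energy and a vector in the central part.\<close>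
  define M where "M = DIM('e) + 2"
  define n where "n = 4 * M"
  define K2 where "K2 = \<beta> X X + 2 * \<bar>\<beta> X Y\<bar> + \<beta> Y Y"
  define K where "K = real M * (real n)\<^sup>2 * K2"
  have n0: "0 < n" by (simp add: n_def M_def)
  have K20: "0 \<le> K2" by (simp add: K2_def \<beta>_nonneg)
  show thesis
  proof (rule that)
    show "0 \<le> K" by (simp add: K_def K20)
    fix R :: "(real \<Rightarrow> 'e) \<Rightarrow> bool" and w :: "real \<Rightarrow> real" and a :: "real \<Rightarrow> 'e" and k :: 'e and c :: real
    assume R: "perturbation_closed br R" and w': "weight w" and c: "0 \<le> c" and adm: "admissible R w a k"
    define W where "W = integral {0..1} w"
    have w: "w absolutely_integrable_on {0..1}" "\<And>t. 0 < w t" and W: "0 < W"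
      using w' by (auto simp: weight_def W_def)
    have a: "a absolutely_integrable_on {0..1}" "\<And>t. a t \<in> V" and kZ: "k \<in> Z"
      and ea: "(\<lambda>t. \<beta> (a t) (a t) / w t) integrable_on {0..1}" and Ra: "R (\<lambda>t. a t + k)"
      using adm by (auto simp: admissible_def)
    define m where "m = W / real n"
    have m0: "0 < m" using W n0 by (simp add: m_def)
    obtain step ramp :: "nat \<Rightarrow> real \<Rightarrow> real" where
      step01: "\<And>i t. i < n \<Longrightarrow> step i t \<in> {0, 1}"
      and stepm: "\<And>i. i < n \<Longrightarrow> step i \<in> borel_measurable (lebesgue_on {0..1})"
      and rampI: "\<And>i t. i < n \<Longrightarrow> t \<in> {0..1} \<Longrightarrow> integral {0..t} (\<lambda>s. w s * step i s) = ramp i t"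
      and ramp1: "\<And>i. i < n \<Longrightarrow> ramp i 1 = m"
      and before: "\<And>i j t. i < n \<Longrightarrow> j < n \<Longrightarrow> t \<in> {0..1} \<Longrightarrow> i < j \<Longrightarrow> step j t = 1 \<Longrightarrow> ramp i t = m"
      and after: "\<And>i j t. i < n \<Longrightarrow> j < n \<Longrightarrow> t \<in> {0..1} \<Longrightarrow> j < i \<Longrightarrow> step j t = 1 \<Longrightarrow> ramp i t = 0"
      by (rule equal_mass_steps[OF w n0]) (unfold W_def[symmetric] m_def[symmetric], rule that)
    have ix: "4 * j < n" "4 * j + 1 < n" "4 * j + 2 < n" "4 * j + 3 < n" if "j < M" for j
      using that by (auto simp: n_def)
    \<comment> \<open>Up to the factor \<open>\<alpha> j\<close>, the \<open>j\<close>-th loop has the velocity \<open>w * p j\<close> along \<open>X\<close> and \<open>w * q j\<close> along \<open>Y\<close>, and the coordinates \<open>P j\<close> and \<open>Q j\<close>.\<close>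
    define p where "p j t = step (4*j) t - step (4*j+2) t" for j t
    define q where "q j t = step (4*j+1) t - step (4*j+3) t" for j t
    define P where "P j t = ramp (4*j) t - ramp (4*j+2) t" for j t
    define Q where "Q j t = ramp (4*j+1) t - ramp (4*j+3) t" for j t
    have pq_bound: "\<bar>p j t\<bar> \<le> 1" "\<bar>q j t\<bar> \<le> 1" if "j < M" for j t
      using step01[of "4*j" t] step01[of "4*j+1" t] step01[of "4*j+2" t] step01[of "4*j+3" t] ix[OF that]
      by (auto simp: p_def q_def)
    have pq_meas: "p j \<in> borel_measurable (lebesgue_on {0..1})" "q j \<in> borel_measurable (lebesgue_on {0..1})" if "j < M" for j
      unfolding p_def q_def using stepm ix[OF that] by (auto intro!: borel_measurable_diff)
    have wstep: "(\<lambda>s. w s * step i s) absolutely_integrable_on {0..1}" if "i < n" for i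
    proof -
      have "\<bar>step i t\<bar> \<le> 1" for t using step01[OF that, of t] by auto
      then show ?thesis using absolutely_integrable_bounded_mult[OF stepm[OF that] _ w(1), of 1] by (simp add: mult.commute)
    qed
    have wstepI: "(\<lambda>s. w s * step i s) integrable_on {0..t}" if "i < n" "t \<in> {0..1}" for i t
      using wstep[OF that(1)] that(2)
      by (auto simp: absolutely_integrable_on_def intro: integrable_on_subinterval)
    have PI: "integral {0..t} (\<lambda>s. w s * p j s) = P j t" "integral {0..t} (\<lambda>s. w s * q j s) = Q j t"
      if "j < M" "t \<in> {0..1}" for j t
      using ix[OF that(1)] that(2) by (simp_all add: p_def q_def P_def Q_def right_diff_distrib integral_diff wstepI rampI)
    have wpq: "(\<lambda>s. w s * p j s) absolutely_integrable_on {0..1}" "(\<lambda>s. w s * q j s) absolutely_integrable_on {0..1}" if "j < M" for j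
      using absolutely_integrable_bounded_mult[OF pq_meas(1)[OF that] _ w(1), of 1]
        absolutely_integrable_bounded_mult[OF pq_meas(2)[OF that] _ w(1), of 1] pq_bound[OF that]
      by (simp_all add: mult.commute)
    have PQ_cont: "continuous_on {0..1} (P j)" "continuous_on {0..1} (Q j)" if "j < M" for j
    proof -
      have "continuous_on {0..1} (\<lambda>t. integral {0..t} (\<lambda>s. w s * p j s))" "continuous_on {0..1} (\<lambda>t. integral {0..t} (\<lambda>s. w s * q j s))"
        using wpq[OF that] by (auto simp: absolutely_integrable_on_def intro!: indefinite_integral_continuous_1)
      then show "continuous_on {0..1} (P j)" "continuous_on {0..1} (Q j)"
        using PI[OF that] by (auto elim: continuous_on_eq)
    qed
    have P1: "P j 1 = 0" "Q j 1 = 0" if "j < M" for j using ix[OF that] by (simp_all add: P_def Q_def ramp1)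
    \<comment> \<open>While a loop moves along \<open>X\<close> its \<open>Y\<close>-coordinate is zero, while it returns along \<open>-X\<close> it is \<open>m\<close>, and all other loops rest at their base point.\<close>
    have QQ: "Q j t * (w t * p l t) = (if j = l then - m * (w t * step (4*l+2) t) else 0)"
      if "j < M" "l < M" "t \<in> {0..1}" for j l t
    proof -
      have z: "Q j t * step (4*l) t = 0"
      proof (cases "step (4*l) t = 1")
        case True
        have "Q j t = 0"
        proof (cases "j < l")
          case True' : True
          have "ramp (4*j+1) t = m" by (rule before[OF _ _ that(3) _ True]) (use ix[OF that(1)] ix[OF that(2)] True' in auto)
          moreover have "ramp (4*j+3) t = m" by (rule before[OF _ _ that(3) _ True]) (use ix[OF that(1)] ix[OF that(2)] True' in auto)
          ultimately show ?thesis by (simp add: Q_def)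
        next
          case False
          have "ramp (4*j+1) t = 0" by (rule after[OF _ _ that(3) _ True]) (use ix[OF that(1)] ix[OF that(2)] False in auto)
          moreover have "ramp (4*j+3) t = 0" by (rule after[OF _ _ that(3) _ True]) (use ix[OF that(1)] ix[OF that(2)] False in auto)
          ultimately show ?thesis by (simp add: Q_def)
        qed
        then show ?thesis by simp
      next
        case False
        then have "step (4*l) t = 0" using step01[OF ix(1)[OF that(2)], of t] by auto
        then show ?thesis by simp
      qed
      have z2: "Q j t * step (4*l+2) t = (if j = l then m * step (4*l+2) t else 0)"
      proof (cases "step (4*l+2) t = 1")
        case True
        consider "j < l" | "j = l" | "l < j" by linarith
        then have "Q j t = (if j = l then m else 0)"
        proof cases
          case 1
          have "ramp (4*j+1) t = m" by (rule before[OF _ _ that(3) _ True]) (use ix[OF that(1)] ix[OF that(2)] 1 in auto)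
          moreover have "ramp (4*j+3) t = m" by (rule before[OF _ _ that(3) _ True]) (use ix[OF that(1)] ix[OF that(2)] 1 in auto)
          ultimately show ?thesis using 1 by (simp add: Q_def)
        next
          case 2
          have "ramp (4*j+1) t = m" by (rule before[OF _ _ that(3) _ True]) (use ix[OF that(1)] ix[OF that(2)] 2 in auto)
          moreover have "ramp (4*j+3) t = 0" by (rule after[OF _ _ that(3) _ True]) (use ix[OF that(1)] ix[OF that(2)] 2 in auto)
          ultimately show ?thesis using 2 by (simp add: Q_def)
        next
          case 3
          have "ramp (4*j+1) t = 0" by (rule after[OF _ _ that(3) _ True]) (use ix[OF that(1)] ix[OF that(2)] 3 in auto)
          moreover have "ramp (4*j+3) t = 0" by (rule after[OF _ _ that(3) _ True]) (use ix[OF that(1)] ix[OF that(2)] 3 in auto)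
          ultimately show ?thesis using 3 by (simp add: Q_def)
        qed
        then show ?thesis using True by simp
      next
        case False
        then have "step (4*l+2) t = 0" using step01[OF ix(3)[OF that(2)], of t] by auto
        then show ?thesis by simp
      qed
      have "Q j t * (w t * p l t) = w t * (Q j t * step (4*l) t) - w t * (Q j t * step (4*l+2) t)"
        by (simp add: p_def algebra_simps)
      then show ?thesis unfolding z z2 by simp
    qed
    \<comment> \<open>The cross terms: in the energy, and in the integral of the central part of the control.\<close>
    define F where "F j = (integral {0..1} (\<lambda>t. p j t * \<beta> (a t) X + q j t * \<beta> (a t) Y),
      integral {0..1} (\<lambda>t. P j t *\<^sub>R br X (a t) + Q j t *\<^sub>R br Y (a t)))" for j
    have F1: "(\<lambda>t. p j t * \<beta> (a t) X + q j t * \<beta> (a t) Y) absolutely_integrable_on {0..1}" if "j < M" for j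
      by (intro set_integral_add(1) absolutely_integrable_bounded_mult[where B = 1] pq_meas[OF that] pq_bound[OF that]
          absolutely_integrable_\<beta> a(1))
    have F2: "(\<lambda>t. P j t *\<^sub>R br X (a t) + Q j t *\<^sub>R br Y (a t)) absolutely_integrable_on {0..1}" if j: "j < M" for j
    proof -
      obtain B1 where B1: "P j \<in> borel_measurable (lebesgue_on {0..1})" "\<And>t. t \<in> {0..1} \<Longrightarrow> \<bar>P j t\<bar> \<le> B1"
        using continuous_bounded_measurable[OF PQ_cont(1)[OF j]] by blast
      obtain B2 where B2: "Q j \<in> borel_measurable (lebesgue_on {0..1})" "\<And>t. t \<in> {0..1} \<Longrightarrow> \<bar>Q j t\<bar> \<le> B2"
        using continuous_bounded_measurable[OF PQ_cont(2)[OF j]] by blast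
      show ?thesis
        by (intro set_integral_add(1) absolutely_integrable_bounded_scaleR[OF B1] absolutely_integrable_bounded_scaleR[OF B2]
            absolutely_integrable_br a(1))
    qed
    have "DIM(real \<times> 'e) < M" by (simp add: M_def)
    then obtain \<alpha>0 where \<alpha>0: "(\<Sum>j<M. \<alpha>0 j *\<^sub>R F j) = 0" "\<exists>j<M. \<alpha>0 j \<noteq> 0"
      by (rule linear_dependence_of_many)
    define S where "S = (\<Sum>j<M. (\<alpha>0 j)\<^sup>2)"
    obtain j0 where j0: "j0 < M" "\<alpha>0 j0 \<noteq> 0" using \<alpha>0(2) by blast
    have S0: "0 < S" unfolding S_def by (rule sum_pos2[of _ j0]) (use j0 in auto)
    define \<kappa> where "\<kappa> = sqrt (c / (m\<^sup>2 * S))"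
    define \<alpha> where "\<alpha> j = \<kappa> * \<alpha>0 j" for j
    have \<alpha>F: "(\<Sum>j<M. \<alpha> j *\<^sub>R F j) = 0"
    proof -
      have "(\<Sum>j<M. \<alpha> j *\<^sub>R F j) = \<kappa> *\<^sub>R (\<Sum>j<M. \<alpha>0 j *\<^sub>R F j)" by (simp add: \<alpha>_def scaleR_sum_right)
      then show ?thesis using \<alpha>0(1) by simp
    qed
    have \<alpha>c: "m\<^sup>2 * (\<Sum>j<M. (\<alpha> j)\<^sup>2) = c"
    proof -
      have "(\<Sum>j<M. (\<alpha> j)\<^sup>2) = \<kappa>\<^sup>2 * S" by (simp add: \<alpha>_def S_def power_mult_distrib sum_distrib_left)
      moreover have "\<kappa>\<^sup>2 = c / (m\<^sup>2 * S)" using c m0 S0 by (simp add: \<kappa>_def)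
      ultimately show ?thesis using m0 S0 by simp
    qed
    define \<Phi> where "\<Phi> t = (\<Sum>j<M. \<alpha> j * p j t)" for t
    define \<Psi> where "\<Psi> t = (\<Sum>j<M. \<alpha> j * q j t)" for t
    define x where "x t = (\<Sum>j<M. \<alpha> j * P j t)" for t
    define y where "y t = (\<Sum>j<M. \<alpha> j * Q j t)" for t
    define f where "f t = w t * \<Phi> t" for t
    define g where "g t = w t * \<Psi> t" for t
    define N1 where "N1 = (\<Sum>j<M. \<bar>\<alpha> j\<bar>)"
    have N10: "0 \<le> N1" by (simp add: N1_def sum_nonneg)
    have \<Phi>: "\<Phi> \<in> borel_measurable (lebesgue_on {0..1})" "\<Psi> \<in> borel_measurable (lebesgue_on {0..1})"
      unfolding \<Phi>_def \<Psi>_def using pq_meas by (auto intro!: borel_measurable_sum borel_measurable_times)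
    have \<Phi>b: "\<bar>\<Phi> t\<bar> \<le> N1" "\<bar>\<Psi> t\<bar> \<le> N1" for t
    proof -
      have "\<bar>\<Phi> t\<bar> \<le> (\<Sum>j<M. \<bar>\<alpha> j * p j t\<bar>)" unfolding \<Phi>_def by (rule sum_abs)
      also have "\<dots> \<le> N1" unfolding N1_def
        by (rule sum_mono) (use pq_bound in \<open>auto simp: abs_mult intro: mult_left_le\<close>)
      finally show "\<bar>\<Phi> t\<bar> \<le> N1" .
      have "\<bar>\<Psi> t\<bar> \<le> (\<Sum>j<M. \<bar>\<alpha> j * q j t\<bar>)" unfolding \<Psi>_def by (rule sum_abs)
      also have "\<dots> \<le> N1" unfolding N1_def
        by (rule sum_mono) (use pq_bound in \<open>auto simp: abs_mult intro: mult_left_le\<close>)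
      finally show "\<bar>\<Psi> t\<bar> \<le> N1" .
    qed
    have fint: "f absolutely_integrable_on {0..1}" "g absolutely_integrable_on {0..1}"
      using absolutely_integrable_bounded_mult[OF \<Phi>(1) _ w(1), of N1] absolutely_integrable_bounded_mult[OF \<Phi>(2) _ w(1), of N1] \<Phi>b
      by (auto simp: f_def[abs_def] g_def[abs_def] mult.commute)
    have xI: "integral {0..t} f = x t" and yI: "integral {0..t} g = y t" if t: "t \<in> {0..1}" for t
    proof -
      have i: "(\<lambda>s. w s * p j s) integrable_on {0..t}" "(\<lambda>s. w s * q j s) integrable_on {0..t}" if "j < M" for j
        using wpq[OF that] t by (auto simp: absolutely_integrable_on_def intro: integrable_on_subinterval)
      have "integral {0..t} f = integral {0..t} (\<lambda>s. \<Sum>j<M. \<alpha> j * (w s * p j s))"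
        by (rule arg_cong[where f = "integral {0..t}"]) (simp add: fun_eq_iff f_def \<Phi>_def sum_distrib_left mult.left_commute)
      also have "\<dots> = (\<Sum>j<M. integral {0..t} (\<lambda>s. \<alpha> j * (w s * p j s)))"
        by (rule integral_sum) (auto intro!: integrable_on_mult_right i)
      also have "\<dots> = x t" unfolding x_def by (rule sum.cong) (simp_all add: PI(1)[OF _ t])
      finally show "integral {0..t} f = x t" .
      have "integral {0..t} g = integral {0..t} (\<lambda>s. \<Sum>j<M. \<alpha> j * (w s * q j s))"
        by (rule arg_cong[where f = "integral {0..t}"]) (simp add: fun_eq_iff g_def \<Psi>_def sum_distrib_left mult.left_commute)
      also have "\<dots> = (\<Sum>j<M. integral {0..t} (\<lambda>s. \<alpha> j * (w s * q j s)))"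
        by (rule integral_sum) (auto intro!: integrable_on_mult_right i)
      also have "\<dots> = y t" unfolding y_def by (rule sum.cong) (simp_all add: PI(2)[OF _ t])
      finally show "integral {0..t} g = y t" .
    qed
    have xy1: "x 1 = 0" "y 1 = 0" by (simp_all add: x_def y_def P1)
    let ?x = "\<lambda>t. integral {0..t} f" and ?y = "\<lambda>t. integral {0..t} g"
    have xyc: "continuous_on {0..1} ?x" "continuous_on {0..1} ?y"
      using fint by (auto simp: absolutely_integrable_on_def intro!: indefinite_integral_continuous_1)
    obtain Bx where Bx: "?x \<in> borel_measurable (lebesgue_on {0..1})" "\<And>t. t \<in> {0..1} \<Longrightarrow> \<bar>?x t\<bar> \<le> Bx"
      using continuous_bounded_measurable[OF xyc(1)] by blast
    obtain By where By: "?y \<in> borel_measurable (lebesgue_on {0..1})" "\<And>t. t \<in> {0..1} \<Longrightarrow> \<bar>?y t\<bar> \<le> By"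
      using continuous_bounded_measurable[OF xyc(2)] by blast
    have yf: "(\<lambda>t. ?y t * f t) absolutely_integrable_on {0..1}"
      by (rule absolutely_integrable_bounded_mult[OF By fint(1)])
    have yfI: "integral {0..1} (\<lambda>t. ?y t * f t) = - c"
    proof -
      have "integral {0..1} (\<lambda>t. ?y t * f t) = integral {0..1} (\<lambda>t. \<Sum>l<M. (- m * (\<alpha> l)\<^sup>2) * (w t * step (4*l+2) t))"
      proof (rule integral_cong)
        fix t assume t: "t \<in> {0..1::real}"
        have "?y t * f t = (\<Sum>j<M. \<alpha> j * Q j t) * (\<Sum>l<M. w t * (\<alpha> l * p l t))"
          by (simp only: yI[OF t] y_def f_def \<Phi>_def sum_distrib_left)
        also have "\<dots> = (\<Sum>j<M. \<Sum>l<M. (\<alpha> j * Q j t) * (w t * (\<alpha> l * p l t)))" by (rule sum_product)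
        also have "\<dots> = (\<Sum>l<M. \<Sum>j<M. (\<alpha> j * Q j t) * (w t * (\<alpha> l * p l t)))" by (rule sum.swap)
        also have "\<dots> = (\<Sum>l<M. \<Sum>j<M. \<alpha> l * \<alpha> j * (Q j t * (w t * p l t)))"
          by (intro sum.cong refl) simp
        also have "\<dots> = (\<Sum>l<M. \<Sum>j<M. if j = l then - m * (\<alpha> l)\<^sup>2 * (w t * step (4*l+2) t) else 0)"
        proof (intro sum.cong refl)
          fix l j assume "l \<in> {..<M}" "j \<in> {..<M}"
          then have "Q j t * (w t * p l t) = (if j = l then - m * (w t * step (4*l+2) t) else 0)"
            by (intro QQ[OF _ _ t]) auto
          then show "\<alpha> l * \<alpha> j * (Q j t * (w t * p l t)) = (if j = l then - m * (\<alpha> l)\<^sup>2 * (w t * step (4*l+2) t) else 0)"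
            by (simp only:) (simp add: power2_eq_square)
        qed
        also have "\<dots> = (\<Sum>l<M. (- m * (\<alpha> l)\<^sup>2) * (w t * step (4*l+2) t))"
          by simp
        finally show "?y t * f t = (\<Sum>l<M. (- m * (\<alpha> l)\<^sup>2) * (w t * step (4*l+2) t))" .
      qed
      also have "\<dots> = (\<Sum>l<M. (- m * (\<alpha> l)\<^sup>2) * m)"
      proof (subst integral_sum)
        show "(\<Sum>l<M. integral {0..1} (\<lambda>t. (- m * (\<alpha> l)\<^sup>2) * (w t * step (4*l+2) t))) = (\<Sum>l<M. (- m * (\<alpha> l)\<^sup>2) * m)"
        proof (rule sum.cong[OF refl])
          fix l assume "l \<in> {..<M}"
          then have l: "4*l+2 < n" using ix(3) by simp
          have "integral {0..1} (\<lambda>t. w t * step (4*l+2) t) = m" using rampI[OF l, of 1] ramp1[OF l] by simp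
          then show "integral {0..1} (\<lambda>t. (- m * (\<alpha> l)\<^sup>2) * (w t * step (4*l+2) t)) = (- m * (\<alpha> l)\<^sup>2) * m"
            by (simp only: integral_mult_right)
        qed
        fix l assume "l \<in> {..<M}"
        then have l: "4*l+2 < n" using ix(3) by simp
        show "(\<lambda>t. (- m * (\<alpha> l)\<^sup>2) * (w t * step (4*l+2) t)) integrable_on {0..1}"
          by (rule integrable_on_mult_right, rule wstepI[OF l]) simp
      qed simp
      also have "\<dots> = - (m\<^sup>2 * (\<Sum>l<M. (\<alpha> l)\<^sup>2))"
        by (simp add: sum_distrib_left sum_negf[symmetric] power2_eq_square algebra_simps)
      finally show ?thesis by (simp add: \<alpha>c)
    qed
    define u1 where "u1 t = a t + k - ?x t *\<^sub>R br X (a t) + f t *\<^sub>R X" for t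
    \<comment> \<open>The central part that the two perturbations create.\<close>
    define h where "h t = (?y t * f t) *\<^sub>R br X Y - (?x t *\<^sub>R br X (a t) + ?y t *\<^sub>R br Y (a t))" for t
    define a' where "a' t = a t + f t *\<^sub>R X + g t *\<^sub>R Y" for t
    have ak: "(\<lambda>t. a t + k) absolutely_integrable_on {0..1}"
      by (intro set_integral_add(1) a(1) absolutely_integrable_on_const) simp
    note xbr = absolutely_integrable_bounded_scaleR[OF Bx absolutely_integrable_br[OF a(1), of X]]
      absolutely_integrable_bounded_scaleR[OF By absolutely_integrable_br[OF a(1), of Y]]
    have u1int: "u1 absolutely_integrable_on {0..1}" unfolding u1_def
      by (intro set_integral_add(1) set_integral_diff(1) ak xbr absolutely_integrable_scaleR_right fint)
    have "R u1"
      using perturbation_closedD[OF R Ra ak fint(1), of X] xI[of 1] xy1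
      by (simp add: u1_def[abs_def] br_simps br_central[OF kZ])
    then have R2: "R (\<lambda>t. u1 t - ?y t *\<^sub>R br Y (u1 t) + g t *\<^sub>R Y)"
      using perturbation_closedD[OF R _ u1int fint(2), of Y] yI[of 1] xy1 by simp
    have u2: "(\<lambda>t. u1 t - ?y t *\<^sub>R br Y (u1 t) + g t *\<^sub>R Y) = (\<lambda>t. a' t + k + h t)"
    proof
      fix t
      have brY: "br Y (u1 t) = br Y (a t) - f t *\<^sub>R br X Y"
        using br_antisym[of Y X] by (simp add: u1_def br_simps br_central[OF kZ] br_central[OF br_Z])
      show "u1 t - ?y t *\<^sub>R br Y (u1 t) + g t *\<^sub>R Y = a' t + k + h t"
        unfolding brY by (simp add: u1_def a'_def h_def algebra_simps)
    qed
    have a'int: "a' absolutely_integrable_on {0..1}" unfolding a'_def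
      by (intro set_integral_add(1) a(1) absolutely_integrable_scaleR_right fint)
    have hint: "h absolutely_integrable_on {0..1}" unfolding h_def
      by (intro set_integral_add(1) set_integral_diff(1) xbr absolutely_integrable_scaleR_right yf)
    have hZ: "h t \<in> Z" for t unfolding h_def by (intro subspace_diff subspace_add subspace_scale Z br_Z)
    have hI: "integral {0..1} h = - c *\<^sub>R br X Y"
    proof -
      have "integral {0..1} (\<lambda>t. ?x t *\<^sub>R br X (a t) + ?y t *\<^sub>R br Y (a t)) =
          integral {0..1} (\<lambda>t. \<Sum>j<M. \<alpha> j *\<^sub>R (P j t *\<^sub>R br X (a t) + Q j t *\<^sub>R br Y (a t)))"
        by (rule integral_cong) (simp add: xI yI x_def y_def scaleR_sum_left scaleR_add_right sum.distrib)
      also have "\<dots> = (\<Sum>j<M. \<alpha> j *\<^sub>R snd (F j))"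
        by (subst integral_sum) (use F2 in \<open>auto simp: F_def absolutely_integrable_on_def intro!: integrable_cmul\<close>)
      also have "\<dots> = snd (\<Sum>j<M. \<alpha> j *\<^sub>R F j)" by (simp add: snd_sum)
      finally have z: "integral {0..1} (\<lambda>t. ?x t *\<^sub>R br X (a t) + ?y t *\<^sub>R br Y (a t)) = 0" by (simp add: \<alpha>F)
      have yfb: "((\<lambda>t. (?y t * f t) *\<^sub>R br X Y) has_integral (- c) *\<^sub>R br X Y) {0..1}"
        using has_integral_scaleR_left[of "\<lambda>t. ?y t * f t" "- c" "{0..1}" "br X Y"] yf yfI
        by (simp add: absolutely_integrable_on_def has_integral_iff)
      have xyb: "((\<lambda>t. ?x t *\<^sub>R br X (a t) + ?y t *\<^sub>R br Y (a t)) has_integral 0) {0..1}"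
        using set_integral_add(1)[OF xbr] z by (simp add: absolutely_integrable_on_def has_integral_iff)
      from has_integral_diff[OF yfb xyb] show ?thesis by (simp add: h_def[abs_def] has_integral_iff)
    qed
    have "R (\<lambda>t. (a' t + k + h t) + (- c *\<^sub>R br X Y - h t))"
    proof (rule add_central[OF R])
      show "R (\<lambda>t. a' t + k + h t)" using R2 unfolding u2 .
      show "(\<lambda>t. a' t + k + h t) absolutely_integrable_on {0..1}"
        by (intro set_integral_add(1) a'int hint absolutely_integrable_on_const) simp
      show "(\<lambda>t. - c *\<^sub>R br X Y - h t) absolutely_integrable_on {0..1}"
        by (intro set_integral_diff(1) hint absolutely_integrable_on_const) simp
      show "- c *\<^sub>R br X Y - h t \<in> Z" for t by (intro subspace_diff subspace_scale Z br_Z hZ)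
      show "integral {0..1} (\<lambda>t. - c *\<^sub>R br X Y - h t) = 0"
        using hint hI by (subst integral_diff) (auto simp: absolutely_integrable_on_def)
    qed
    then have Ra': "R (\<lambda>t. a' t + (k - c *\<^sub>R br X Y))" by (simp add: algebra_simps)
    define \<Theta> where "\<Theta> t = (\<Phi> t)\<^sup>2 * \<beta> X X + 2 * (\<Phi> t * \<Psi> t) * \<beta> X Y + (\<Psi> t)\<^sup>2 * \<beta> Y Y" for t
    have \<Theta>m: "\<Theta> \<in> borel_measurable (lebesgue_on {0..1})" unfolding \<Theta>_def using \<Phi> by measurable
    have \<Theta>b: "\<bar>\<Theta> t\<bar> \<le> N1\<^sup>2 * K2" for t
    proof -
      have sq: "(\<Phi> t)\<^sup>2 \<le> N1\<^sup>2" "(\<Psi> t)\<^sup>2 \<le> N1\<^sup>2" using \<Phi>b N10 by (auto simp: abs_le_square_iff[symmetric])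
      have pr: "\<bar>\<Phi> t * \<Psi> t\<bar> \<le> N1\<^sup>2" unfolding abs_mult power2_eq_square by (rule mult_mono) (use \<Phi>b N10 in auto)
      have "\<bar>\<Theta> t\<bar> \<le> \<bar>(\<Phi> t)\<^sup>2 * \<beta> X X\<bar> + \<bar>2 * (\<Phi> t * \<Psi> t) * \<beta> X Y\<bar> + \<bar>(\<Psi> t)\<^sup>2 * \<beta> Y Y\<bar>"
        unfolding \<Theta>_def by linarith
      also have "\<dots> = (\<Phi> t)\<^sup>2 * \<beta> X X + 2 * (\<bar>\<Phi> t * \<Psi> t\<bar> * \<bar>\<beta> X Y\<bar>) + (\<Psi> t)\<^sup>2 * \<beta> Y Y"
        by (simp add: abs_mult \<beta>_nonneg)
      also have "\<dots> \<le> N1\<^sup>2 * \<beta> X X + 2 * (N1\<^sup>2 * \<bar>\<beta> X Y\<bar>) + N1\<^sup>2 * \<beta> Y Y"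
        by (intro add_mono mult_right_mono mult_left_mono sq pr \<beta>_nonneg) auto
      also have "\<dots> = N1\<^sup>2 * K2" by (simp add: K2_def algebra_simps)
      finally show ?thesis .
    qed
    have \<Theta>w: "(\<lambda>t. \<Theta> t * w t) absolutely_integrable_on {0..1}"
      by (rule absolutely_integrable_bounded_mult[OF \<Theta>m \<Theta>b w(1)])
    have crossI: "((\<lambda>t. \<Phi> t * \<beta> (a t) X + \<Psi> t * \<beta> (a t) Y) has_integral 0) {0..1}"
    proof -
      have eq: "(\<lambda>t. \<Phi> t * \<beta> (a t) X + \<Psi> t * \<beta> (a t) Y) = (\<lambda>t. \<Sum>j<M. \<alpha> j * (p j t * \<beta> (a t) X + q j t * \<beta> (a t) Y))"
        by (simp add: fun_eq_iff \<Phi>_def \<Psi>_def sum_distrib_right sum.distrib distrib_left mult.assoc)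
      have "((\<lambda>t. \<Sum>j<M. \<alpha> j * (p j t * \<beta> (a t) X + q j t * \<beta> (a t) Y)) has_integral (\<Sum>j<M. \<alpha> j * fst (F j))) {0..1}"
      proof (rule has_integral_sum)
        fix j assume "j \<in> {..<M}"
        then have "((\<lambda>t. p j t * \<beta> (a t) X + q j t * \<beta> (a t) Y) has_integral fst (F j)) {0..1}"
          using F1[of j] by (simp add: F_def absolutely_integrable_on_def integrable_integral)
        then show "((\<lambda>t. \<alpha> j * (p j t * \<beta> (a t) X + q j t * \<beta> (a t) Y)) has_integral \<alpha> j * fst (F j)) {0..1}"
          by (rule has_integral_mult_right)
      qed simp
      moreover have "(\<Sum>j<M. \<alpha> j * fst (F j)) = fst (\<Sum>j<M. \<alpha> j *\<^sub>R F j)" by (simp add: fst_sum)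
      ultimately show ?thesis unfolding eq by (simp add: \<alpha>F)
    qed
    \<comment> \<open>The middle term integrates to zero by the choice of \<open>\<alpha>\<close>.\<close>
    have expand: "\<beta> (a' t) (a' t) / w t = \<beta> (a t) (a t) / w t + 2 * (\<Phi> t * \<beta> (a t) X + \<Psi> t * \<beta> (a t) Y) + \<Theta> t * w t" for t
    proof -
      have "\<beta> (a' t) (a' t) = \<beta> (a t) (a t) + 2 * (f t * \<beta> (a t) X + g t * \<beta> (a t) Y)
          + ((f t)\<^sup>2 * \<beta> X X + 2 * (f t * g t) * \<beta> X Y + (g t)\<^sup>2 * \<beta> Y Y)"
        by (simp add: a'_def \<beta>_simps \<beta>_sym[of X "a t"] \<beta>_sym[of Y "a t"] \<beta>_sym[of Y X] power2_eq_square algebra_simps)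
      also have "\<dots> = \<beta> (a t) (a t) + w t * (2 * (\<Phi> t * \<beta> (a t) X + \<Psi> t * \<beta> (a t) Y)) + w t * (\<Theta> t * w t)"
        by (simp add: f_def g_def \<Theta>_def power2_eq_square algebra_simps)
      finally show ?thesis using w(2)[of t] by (simp add: add_divide_distrib)
    qed
    have E: "((\<lambda>t. \<beta> (a' t) (a' t) / w t) has_integral
        (integral {0..1} (\<lambda>t. \<beta> (a t) (a t) / w t) + 2 * 0 + integral {0..1} (\<lambda>t. \<Theta> t * w t))) {0..1}"
      unfolding expand
      by (intro has_integral_add has_integral_mult_right crossI integrable_integral ea)
         (use \<Theta>w in \<open>simp add: absolutely_integrable_on_def\<close>)
    have \<Theta>I: "integral {0..1} (\<lambda>t. \<Theta> t * w t) \<le> N1\<^sup>2 * K2 * W"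
    proof -
      have "integral {0..1} (\<lambda>t. \<Theta> t * w t) \<le> integral {0..1} (\<lambda>t. N1\<^sup>2 * K2 * w t)"
      proof (rule integral_le)
        show "(\<lambda>t. \<Theta> t * w t) integrable_on {0..1}" using \<Theta>w by (simp add: absolutely_integrable_on_def)
        show "(\<lambda>t. N1\<^sup>2 * K2 * w t) integrable_on {0..1}"
          using w(1) by (intro integrable_on_mult_right) (simp add: absolutely_integrable_on_def)
        show "\<Theta> t * w t \<le> N1\<^sup>2 * K2 * w t" for t
          using \<Theta>b[of t] w(2)[of t] by (intro mult_right_mono) auto
      qed
      then show ?thesis by (simp add: W_def)
    qed
    have "admissible R w a' (k - c *\<^sub>R br X Y)"
      unfolding admissible_def
    proof (intro conjI allI a'int Ra')
      show "a' t \<in> V" for t unfolding a'_def by (intro subspace_add subspace_scale V a(2) X Y)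
      show "k - c *\<^sub>R br X Y \<in> Z" by (intro subspace_diff subspace_scale Z kZ br_Z)
      show "(\<lambda>t. \<beta> (a' t) (a' t) / w t) integrable_on {0..1}" using E by blast
    qed
    moreover have "energy w a' \<le> energy w a + K * c"
    proof -
      have "energy w a' = energy w a + W * integral {0..1} (\<lambda>t. \<Theta> t * w t)"
        using integral_unique[OF E] by (simp add: energy_def W_def algebra_simps)
      also have "W * integral {0..1} (\<lambda>t. \<Theta> t * w t) \<le> W * (N1\<^sup>2 * K2 * W)"
        using \<Theta>I W by (intro mult_left_mono) auto
      also have "\<dots> = (real n)\<^sup>2 * K2 * (m\<^sup>2 * N1\<^sup>2)"
        using n0 by (simp add: m_def power2_eq_square)
      also have "\<dots> \<le> (real n)\<^sup>2 * K2 * (m\<^sup>2 * (real M * (\<Sum>j<M. (\<alpha> j)\<^sup>2)))"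
        using sum_abs_squared_le[of \<alpha> M] K20 unfolding N1_def by (intro mult_left_mono) auto
      also have "\<dots> = K * c" by (simp add: K_def \<alpha>c[symmetric] algebra_simps)
      finally show ?thesis by simp
    qed
    ultimately show "\<exists>a'. admissible R w a' (k - c *\<^sub>R br X Y) \<and> energy w a' \<le> energy w a + K * c" by blast
  qed
qed

text \<open>Exchanging \<open>X\<close> and \<open>Y\<close> changes the sign of the bracket.\<close>

lemma cancel_multiple_of_bracket:
  assumes X: "X \<in> V" and Y: "Y \<in> V"
  obtains K where "0 \<le> K" "\<And>R w a k c. perturbation_closed br R \<Longrightarrow> weight w \<Longrightarrow> admissible R w a k \<Longrightarrow>
     \<exists>a'. admissible R w a' (k - c *\<^sub>R br X Y) \<and> energy w a' \<le> energy w a + K * \<bar>c\<bar>"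
proof -
  obtain K1 where K1: "0 \<le> K1" "\<And>R w a k c. perturbation_closed br R \<Longrightarrow> weight w \<Longrightarrow> 0 \<le> c \<Longrightarrow> admissible R w a k \<Longrightarrow>
     \<exists>a'. admissible R w a' (k - c *\<^sub>R br X Y) \<and> energy w a' \<le> energy w a + K1 * c"
    by (rule cancel_positive_multiple_of_bracket[OF X Y]) (rule that, assumption+)
  obtain K2 where K2: "0 \<le> K2" "\<And>R w a k c. perturbation_closed br R \<Longrightarrow> weight w \<Longrightarrow> 0 \<le> c \<Longrightarrow> admissible R w a k \<Longrightarrow>
     \<exists>a'. admissible R w a' (k - c *\<^sub>R br Y X) \<and> energy w a' \<le> energy w a + K2 * c"
    by (rule cancel_positive_multiple_of_bracket[OF Y X]) (rule that, assumption+)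
  show thesis
  proof (rule that[of "max K1 K2"])
    show "0 \<le> max K1 K2" using K1(1) by simp
    fix R :: "(real \<Rightarrow> 'e) \<Rightarrow> bool" and w a k and c :: real
    assume R: "perturbation_closed br R" "weight w" "admissible R w a k"
    show "\<exists>a'. admissible R w a' (k - c *\<^sub>R br X Y) \<and> energy w a' \<le> energy w a + max K1 K2 * \<bar>c\<bar>"
    proof (cases "0 \<le> c")
      case True
      then obtain a' where a': "admissible R w a' (k - c *\<^sub>R br X Y)" "energy w a' \<le> energy w a + K1 * c"
        using K1(2)[OF R(1,2) _ R(3)] by blast
      moreover have "K1 * c \<le> max K1 K2 * \<bar>c\<bar>" using True by (auto intro: mult_right_mono)
      ultimately show ?thesis by (intro exI[of _ a']) simp
    next
      case False
      then obtain a' where a': "admissible R w a' (k - (- c) *\<^sub>R br Y X)" "energy w a' \<le> energy w a + K2 * (- c)"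
        using K2(2)[OF R(1,2) _ R(3), of "- c"] by auto
      moreover have "k - (- c) *\<^sub>R br Y X = k - c *\<^sub>R br X Y" using br_antisym[of Y X] by simp
      moreover have "K2 * (- c) \<le> max K1 K2 * \<bar>c\<bar>" using False by (auto intro: mult_right_mono)
      ultimately show ?thesis by (intro exI[of _ a'] conjI) (metis, linarith)
    qed
  qed
qed

text \<open>Some brackets form a basis of a space containing \<open>Z\<close>, and the coordinates of \<open>k\<close> are bounded by its norm.\<close>

lemma cancel_central:
  obtains K where "0 \<le> K" "\<And>R w a k. perturbation_closed br R \<Longrightarrow> weight w \<Longrightarrow> admissible R w a k \<Longrightarrow>
     \<exists>a'. admissible R w a' 0 \<and> energy w a' \<le> energy w a + K * norm k"
proof -
  let ?S = "{br X Y |X Y. X \<in> V \<and> Y \<in> V}"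
  obtain B where B: "B \<subseteq> ?S" "independent B" "?S \<subseteq> span B"
    using maximal_independent_subset[of ?S] by blast
  have fB: "finite B" by (rule independent_imp_finite[OF B(2)])
  have ZB: "Z \<subseteq> span B" using generate span_mono[OF B(3)] by (simp add: span_span)
  have "\<exists>g. linear g \<and> (\<forall>b'\<in>B. g b' = (if b' = b then 1 else 0 :: real))" for b
    using linear_independent_extend[OF B(2), of "\<lambda>b'. if b' = b then 1 else 0 :: real"] by blast
  then obtain g where g: "\<And>b. linear (g b)" "\<And>b b'. b' \<in> B \<Longrightarrow> g b b' = (if b' = b then 1 else 0 :: real)" by metis
  have expand: "(\<Sum>b\<in>B. g b z *\<^sub>R b) = z" if "z \<in> span B" for z
    using that
  proof (induction rule: span_induct)
    show "subspace {z. (\<Sum>b\<in>B. g b z *\<^sub>R b) = z}"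
      by (rule subspaceI) (auto simp: linear_0[OF g(1)] linear_add[OF g(1)] linear_scale[OF g(1)]
          scaleR_add_left sum.distrib scaleR_sum_right[symmetric] scaleR_scaleR[symmetric] simp del: scaleR_scaleR)
    fix b0 assume b0: "b0 \<in> B"
    have "(\<Sum>b\<in>B. g b b0 *\<^sub>R b) = (\<Sum>b\<in>B. if b0 = b then b else 0)"
      by (rule sum.cong) (auto simp: g(2)[OF b0])
    then show "(\<Sum>b\<in>B. g b b0 *\<^sub>R b) = b0" using fB b0 by simp
  qed
  have "\<exists>C. \<forall>z. \<bar>g b z\<bar> \<le> C * norm z" for b
    using linear_bounded[OF g(1), of b] by auto
  then obtain C where C: "\<And>b z. \<bar>g b z\<bar> \<le> C b * norm z" by metis
  have "\<exists>K\<ge>0. \<forall>R w a k c. perturbation_closed br R \<longrightarrow> weight w \<longrightarrow> admissible R w a k \<longrightarrow>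
     (\<exists>a'. admissible R w a' (k - c *\<^sub>R b) \<and> energy w a' \<le> energy w a + K * \<bar>c\<bar>)" if b: "b \<in> B" for b
  proof -
    obtain X Y where XY: "X \<in> V" "Y \<in> V" "b = br X Y" using B(1) b by blast
    obtain K where K: "0 \<le> K" "\<And>R w a k c. perturbation_closed br R \<Longrightarrow> weight w \<Longrightarrow> admissible R w a k \<Longrightarrow>
      \<exists>a'. admissible R w a' (k - c *\<^sub>R br X Y) \<and> energy w a' \<le> energy w a + K * \<bar>c\<bar>"
      by (rule cancel_multiple_of_bracket[OF XY(1,2)]) (rule that, assumption+)
    show ?thesis unfolding XY(3) by (intro exI[of _ K] conjI allI impI K)
  qed
  then have "\<exists>K. \<forall>b\<in>B. 0 \<le> K b \<and> (\<forall>R w a k c. perturbation_closed br R \<longrightarrow> weight w \<longrightarrow> admissible R w a k \<longrightarrow>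
     (\<exists>a'. admissible R w a' (k - c *\<^sub>R b) \<and> energy w a' \<le> energy w a + K b * \<bar>c\<bar>))" by (intro bchoice) blast
  then obtain K where H: "\<forall>b\<in>B. 0 \<le> K b \<and> (\<forall>R w a k c. perturbation_closed br R \<longrightarrow> weight w \<longrightarrow> admissible R w a k \<longrightarrow>
     (\<exists>a'. admissible R w a' (k - c *\<^sub>R b) \<and> energy w a' \<le> energy w a + K b * \<bar>c\<bar>))" by (rule exE)
  have K0: "0 \<le> K b" if "b \<in> B" for b using bspec[OF H that] by (rule conjunct1)
  have K: "\<exists>a'. admissible R w a' (k - c *\<^sub>R b) \<and> energy w a' \<le> energy w a + K b * \<bar>c\<bar>"
    if "b \<in> B" "perturbation_closed br R" "weight w" "admissible R w a k" for b R w a k c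
    using conjunct2[OF bspec[OF H that(1)], rule_format, OF that(2-4)] .
  show thesis
  proof (rule that[of "\<bar>\<Sum>b\<in>B. K b * C b\<bar>"])
    fix R w a k assume R: "perturbation_closed br R" "weight w" "admissible R w a k"
    have "\<exists>a'. admissible R w a' (k - (\<Sum>b\<in>F. g b k *\<^sub>R b)) \<and> energy w a' \<le> energy w a + (\<Sum>b\<in>F. K b * \<bar>g b k\<bar>)"
      if "F \<subseteq> B" for F
      using finite_subset[OF that fB] that
    proof (induction F rule: finite_induct)
      case empty
      then show ?case using R(3) by (intro exI[of _ a]) simp
    next
      case (insert b F)
      then obtain a1 where a1: "admissible R w a1 (k - (\<Sum>b\<in>F. g b k *\<^sub>R b))" "energy w a1 \<le> energy w a + (\<Sum>b\<in>F. K b * \<bar>g b k\<bar>)"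
        by auto
      have "b \<in> B" using insert.prems by simp
      from K[OF this R(1,2) a1(1), of "g b k"] obtain a2 where
        a2: "admissible R w a2 (k - (\<Sum>b\<in>F. g b k *\<^sub>R b) - g b k *\<^sub>R b)" "energy w a2 \<le> energy w a1 + K b * \<bar>g b k\<bar>" by blast
      show ?case
        by (rule exI[of _ a2]) (use a1(2) a2 insert.hyps in \<open>simp add: algebra_simps\<close>)
    qed
    from this[of B] obtain a' where a': "admissible R w a' (k - (\<Sum>b\<in>B. g b k *\<^sub>R b))"
      "energy w a' \<le> energy w a + (\<Sum>b\<in>B. K b * \<bar>g b k\<bar>)" by blast
    have "k \<in> Z" using R(3) by (simp add: admissible_def)
    then have "k - (\<Sum>b\<in>B. g b k *\<^sub>R b) = 0" using expand ZB by auto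
    moreover have "(\<Sum>b\<in>B. K b * \<bar>g b k\<bar>) \<le> \<bar>\<Sum>b\<in>B. K b * C b\<bar> * norm k"
    proof -
      have "(\<Sum>b\<in>B. K b * \<bar>g b k\<bar>) \<le> (\<Sum>b\<in>B. K b * (C b * norm k))"
        by (rule sum_mono) (use K0 C in \<open>auto intro: mult_left_mono\<close>)
      also have "\<dots> = (\<Sum>b\<in>B. K b * C b) * norm k" by (simp add: sum_distrib_right mult.assoc)
      also have "\<dots> \<le> \<bar>\<Sum>b\<in>B. K b * C b\<bar> * norm k" by (intro mult_right_mono) auto
      finally show ?thesis .
    qed
    ultimately show "\<exists>a'. admissible R w a' 0 \<and> energy w a' \<le> energy w a + \<bar>\<Sum>b\<in>B. K b * C b\<bar> * norm k"
      using a' by (intro exI[of _ a']) simp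
  qed simp
qed

lemma continuous_\<beta>: "continuous_on UNIV (\<lambda>x. \<beta> x x)"
proof -
  have "bounded_bilinear \<beta>" using \<beta> by (simp add: bilinear_conv_bounded_bilinear)
  then show ?thesis by (rule bounded_bilinear.continuous_on) (intro continuous_intros)+
qed

lemma \<beta>_measurable:
  assumes "u absolutely_integrable_on {0..1::real}"
  shows "(\<lambda>t. \<beta> (u t) (u t)) \<in> borel_measurable (lebesgue_on {0..1})"
proof -
  have "u \<in> borel_measurable (lebesgue_on {0..1})"
    by (rule absolutely_integrable_imp_borel_measurable[OF assms]) simp
  then show ?thesis
    using measurable_compose[OF _ borel_measurable_continuous_onI[OF continuous_\<beta>]] by blast
qed

lemma sqrt_\<beta>_absolutely_integrable:
  assumes u: "u absolutely_integrable_on {0..1::real}"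
  shows "(\<lambda>t. sqrt (\<beta> (u t) (u t))) absolutely_integrable_on {0..1}"
proof -
  obtain B where B: "0 < B" "\<And>x y. norm (\<beta> x y) \<le> B * norm x * norm y"
    using bilinear_bounded_pos[OF \<beta>] by blast
  have b: "sqrt (\<beta> x x) \<le> sqrt B * norm x" for x
  proof (rule real_le_lsqrt)
    show "\<beta> x x \<le> (sqrt B * norm x)\<^sup>2"
      using B(2)[of x x] B(1) by (simp add: power_mult_distrib power2_eq_square[of "norm x"] mult.assoc)
  qed (use B(1) in auto)
  show ?thesis
  proof (rule measurable_bounded_by_integrable_imp_absolutely_integrable)
    show "(\<lambda>t. sqrt (\<beta> (u t) (u t))) \<in> borel_measurable (lebesgue_on {0..1})"
      using \<beta>_measurable[OF u] by measurable
    show "(\<lambda>t. sqrt B * norm (u t)) integrable_on {0..1}"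
      using u by (intro integrable_on_mult_right) (simp add: absolutely_integrable_on_def)
    show "norm (sqrt (\<beta> (u t) (u t))) \<le> sqrt B * norm (u t)" for t using b[of "u t"] \<beta>_nonneg[of "u t"] by simp
  qed simp
qed

lemma integral_mem_subspace:
  fixes b :: "real \<Rightarrow> 'a::euclidean_space"
  assumes S: "subspace S" and b: "b integrable_on {c..d}" "\<And>t. b t \<in> S"
  shows "integral {c..d} b \<in> S"
proof -
  obtain B where B: "B \<subseteq> S" "pairwise orthogonal B" "\<And>x. x \<in> B \<Longrightarrow> norm x = 1" "independent B" "span B = S"
    using orthonormal_basis_subspace[OF S] by metis
  have fB: "finite B" by (rule independent_imp_finite[OF B(4)])
  have comp: "(\<lambda>t. b t \<bullet> e) integrable_on {c..d}" for e by (rule integrable_component[OF b(1)])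
  have "integral {c..d} b = integral {c..d} (\<lambda>t. \<Sum>e\<in>B. (b t \<bullet> e) *\<^sub>R e)"
    by (rule integral_cong) (use orthonormal_basis_expand[OF B(2,3) _ fB] B(5) b(2) in simp)
  also have "\<dots> = (\<Sum>e\<in>B. integral {c..d} (\<lambda>t. (b t \<bullet> e) *\<^sub>R e))"
    by (rule integral_sum[OF fB]) (intro integrable_on_scaleR_left comp)
  also have "\<dots> \<in> S"
  proof (rule subspace_sum[OF S])
    fix e assume "e \<in> B"
    then have "e \<in> S" using B(1) by blast
    then show "integral {c..d} (\<lambda>t. (b t \<bullet> e) *\<^sub>R e) \<in> S"
      unfolding integral_unique[OF has_integral_scaleR_left[OF integrable_integral[OF comp]]] by (rule subspace_scale[OF S])
  qed
  finally show ?thesis .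
qed

text \<open>Dropping the central part \<open>b\<close> of \<open>u\<close> lowers the energy by a multiple of \<open>(norm k)\<^sup>2\<close>, where \<open>k\<close> is the integral of \<open>b\<close>, while removing
\<open>k\<close> costs at most a multiple of \<open>norm k\<close>. The difference is bounded above. Adding \<open>\<epsilon>\<close> to the speed makes the weight positive.\<close>

theorem replace_control:
  assumes P: "linear P" and DP: "\<And>u. u \<in> D \<Longrightarrow> P u \<in> V" "\<And>u. u \<in> D \<Longrightarrow> u - P u \<in> Z"
    and orth: "\<And>u. u \<in> D \<Longrightarrow> \<beta> (P u) (u - P u) = 0"
    and \<kappa>: "0 < \<kappa>" "\<And>u. u \<in> D \<Longrightarrow> \<kappa> * (norm (u - P u))\<^sup>2 \<le> \<beta> (u - P u) (u - P u)"
  obtains C where "0 \<le> C" "\<And>R u \<epsilon>. perturbation_closed br R \<Longrightarrow> R u \<Longrightarrow> u absolutely_integrable_on {0..1} \<Longrightarrow>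
     (\<And>t. u t \<in> D) \<Longrightarrow> 0 < \<epsilon> \<Longrightarrow> \<exists>v. R v \<and> (\<forall>t. v t \<in> V) \<and>
       (integral {0..1} (\<lambda>t. sqrt (\<beta> (v t) (v t))))\<^sup>2 \<le> (integral {0..1} (\<lambda>t. sqrt (\<beta> (u t) (u t))) + \<epsilon>)\<^sup>2 + C"
proof -
  obtain K where K: "0 \<le> K" "\<And>R w a k. perturbation_closed br R \<Longrightarrow> weight w \<Longrightarrow> admissible R w a k \<Longrightarrow>
     \<exists>a'. admissible R w a' 0 \<and> energy w a' \<le> energy w a + K * norm k" by (rule cancel_central) (rule that, assumption+)
  show thesis
  proof (rule that[of "K\<^sup>2 / (4 * \<kappa>)"])
    show "0 \<le> K\<^sup>2 / (4 * \<kappa>)" using \<kappa>(1) by simp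
    fix R :: "(real \<Rightarrow> 'e) \<Rightarrow> bool" and u :: "real \<Rightarrow> 'e" and \<epsilon> :: real
    assume R: "perturbation_closed br R" "R u" and u: "u absolutely_integrable_on {0..1}" "\<And>t. u t \<in> D" and \<epsilon>: "0 < \<epsilon>"
    define a where "a t = P (u t)" for t
    define b where "b t = u t - P (u t)" for t
    define w where "w t = sqrt (\<beta> (u t) (u t)) + \<epsilon>" for t
    define k where "k = integral {0..1} b"
    define W where "W = integral {0..1} w"
    have a: "a absolutely_integrable_on {0..1}" "\<And>t. a t \<in> V"
      using absolutely_integrable_linear[where f = u and h = P] u P DP(1)
      by (simp_all add: a_def[abs_def] o_def linear_conv_bounded_linear)
    have b: "b absolutely_integrable_on {0..1}" "\<And>t. b t \<in> Z"
      using set_integral_diff(1)[OF u(1) a(1)] DP(2) u(2) by (simp_all add: a_def[abs_def] b_def[abs_def])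
    have split: "\<beta> (u t) (u t) = \<beta> (a t) (a t) + \<beta> (b t) (b t)" for t
    proof -
      have "u t = a t + b t" by (simp add: a_def b_def)
      moreover have "\<beta> (a t) (b t) = 0" using orth[OF u(2)] by (simp add: a_def b_def)
      ultimately show ?thesis by (simp add: \<beta>_simps \<beta>_sym[of "b t" "a t"])
    qed
    have w: "w absolutely_integrable_on {0..1}" "\<And>t. 0 < w t"
      unfolding w_def using sqrt_\<beta>_absolutely_integrable[OF u(1)] \<epsilon> \<beta>_nonneg
      by (auto intro!: set_integral_add(1) absolutely_integrable_on_const add_nonneg_pos)
    have WI: "W = integral {0..1} (\<lambda>t. sqrt (\<beta> (u t) (u t))) + \<epsilon>"
      using sqrt_\<beta>_absolutely_integrable[OF u(1)] unfolding W_def w_def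
      by (subst integral_add) (auto simp: absolutely_integrable_on_def)
    have L0: "0 \<le> integral {0..1} (\<lambda>t. sqrt (\<beta> (u t) (u t)))"
      by (rule integral_nonneg) (use sqrt_\<beta>_absolutely_integrable[OF u(1)] \<beta>_nonneg in \<open>auto simp: absolutely_integrable_on_def\<close>)
    have W: "0 < W" using WI L0 \<epsilon> by simp
    have weight: "weight w" using w W by (simp add: weight_def W_def)
    have ww: "\<beta> (u t) (u t) / w t \<le> w t" for t
    proof -
      have "\<beta> (u t) (u t) = (sqrt (\<beta> (u t) (u t)))\<^sup>2" using \<beta>_nonneg by simp
      also have "\<dots> \<le> (w t)\<^sup>2" unfolding w_def by (rule power_mono) (use \<epsilon> \<beta>_nonneg in auto)
      finally show ?thesis using w(2)[of t] by (simp add: divide_le_eq power2_eq_square)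
    qed
    have wi: "w integrable_on {0..1}" using w(1) by (simp add: absolutely_integrable_on_def)
    have wm: "w \<in> borel_measurable (lebesgue_on {0..1})"
      by (rule absolutely_integrable_imp_borel_measurable[OF w(1)]) simp
    have int: "(\<lambda>t. \<beta> (v t) (v t) / w t) integrable_on {0..1}"
      if v: "v absolutely_integrable_on {0..1}" "\<And>t. \<beta> (v t) (v t) \<le> \<beta> (u t) (u t)" for v
    proof -
      have "(\<lambda>t. \<beta> (v t) (v t) / w t) absolutely_integrable_on {0..1}"
      proof (rule measurable_bounded_by_integrable_imp_absolutely_integrable[OF _ _ wi])
        show "(\<lambda>t. \<beta> (v t) (v t) / w t) \<in> borel_measurable (lebesgue_on {0..1})"
          using \<beta>_measurable[OF v(1)] wm by measurable
        show "norm (\<beta> (v t) (v t) / w t) \<le> w t" for t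
          using ww[of t] v(2)[of t] w(2)[of t] \<beta>_nonneg[of "v t"] divide_right_mono[OF v(2), of "w t" t] by simp
      qed simp
      then show ?thesis by (simp add: absolutely_integrable_on_def)
    qed
    have ia: "(\<lambda>t. \<beta> (a t) (a t) / w t) integrable_on {0..1}" and ib: "(\<lambda>t. \<beta> (b t) (b t) / w t) integrable_on {0..1}"
      using int[OF a(1)] int[OF b(1)] split \<beta>_nonneg by simp_all
    have kZ: "k \<in> Z"
      unfolding k_def by (rule integral_mem_subspace[OF Z _ b(2)]) (use b(1) in \<open>simp add: absolutely_integrable_on_def\<close>)
    have "R (\<lambda>t. u t + (k - b t))"
    proof (rule add_central[OF R u(1)])
      show "(\<lambda>t. k - b t) absolutely_integrable_on {0..1}"
        by (intro set_integral_diff(1) b(1) absolutely_integrable_on_const) simp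
      show "k - b t \<in> Z" for t by (intro subspace_diff Z kZ b(2))
      show "integral {0..1} (\<lambda>t. k - b t) = 0"
        using b(1) by (subst integral_diff) (auto simp: absolutely_integrable_on_def k_def)
    qed
    then have Rak: "R (\<lambda>t. a t + k)" by (simp add: a_def b_def add.commute)
    have adm: "admissible R w a k" using a kZ ia Rak by (simp add: admissible_def)
    obtain a' where a': "admissible R w a' 0" "energy w a' \<le> energy w a + K * norm k"
      using K(2)[OF R(1) weight adm] by blast
    have bn: "(norm k)\<^sup>2 * \<kappa> \<le> W * integral {0..1} (\<lambda>t. \<beta> (b t) (b t) / w t)"
    proof -
      have nb: "(\<lambda>t. norm (b t)) integrable_on {0..1}" using b(1) by (simp add: absolutely_integrable_on_def)
      have le: "\<kappa> * ((norm (b t))\<^sup>2 / w t) \<le> \<beta> (b t) (b t) / w t" for t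
        using divide_right_mono[OF \<kappa>(2)[OF u(2)], of "w t" t] w(2)[of t] by (simp add: b_def)
      have ib2: "(\<lambda>t. (norm (b t))\<^sup>2 / w t) integrable_on {0..1}"
      proof -
        have "(\<lambda>t. (norm (b t))\<^sup>2 / w t) absolutely_integrable_on {0..1}"
        proof (rule measurable_bounded_by_integrable_imp_absolutely_integrable)
          have "b \<in> borel_measurable (lebesgue_on {0..1})"
            by (rule absolutely_integrable_imp_borel_measurable[OF b(1)]) simp
          then show "(\<lambda>t. (norm (b t))\<^sup>2 / w t) \<in> borel_measurable (lebesgue_on {0..1})"
            using wm by measurable
          show "(\<lambda>t. 1 / \<kappa> * (\<beta> (b t) (b t) / w t)) integrable_on {0..1}"
            by (intro integrable_on_mult_right ib)
          show "norm ((norm (b t))\<^sup>2 / w t) \<le> 1 / \<kappa> * (\<beta> (b t) (b t) / w t)" for t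
            using le[of t] \<kappa>(1) w(2)[of t] by (simp add: field_simps)
        qed simp
        then show ?thesis by (simp add: absolutely_integrable_on_def)
      qed
      have "norm k \<le> integral {0..1} (\<lambda>t. norm (b t))"
        unfolding k_def by (rule integral_norm_bound_integral) (use b(1) nb in \<open>auto simp: absolutely_integrable_on_def\<close>)
      then have "(norm k)\<^sup>2 \<le> (integral {0..1} (\<lambda>t. norm (b t)))\<^sup>2" by (rule power_mono) simp
      also have "\<dots> \<le> W * integral {0..1} (\<lambda>t. (norm (b t))\<^sup>2 / w t)"
        unfolding W_def by (rule cauchy_schwarz_weighted[OF nb wi w(2) _ ib2]) (use W in \<open>simp add: W_def\<close>)
      finally have "(norm k)\<^sup>2 * \<kappa> \<le> W * (\<kappa> * integral {0..1} (\<lambda>t. (norm (b t))\<^sup>2 / w t))"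
        using \<kappa>(1) by (simp add: mult.left_commute mult.commute[of _ \<kappa>])
      also have "\<kappa> * integral {0..1} (\<lambda>t. (norm (b t))\<^sup>2 / w t) = integral {0..1} (\<lambda>t. \<kappa> * ((norm (b t))\<^sup>2 / w t))"
        by (rule integral_mult_right[symmetric])
      also have "\<dots> \<le> integral {0..1} (\<lambda>t. \<beta> (b t) (b t) / w t)"
        by (rule integral_le[OF integrable_on_mult_right[OF ib2] ib le])
      finally show ?thesis using W by (simp add: mult_left_mono)
    qed
    have "energy w a \<le> W\<^sup>2 - (norm k)\<^sup>2 * \<kappa>"
    proof -
      have "integral {0..1} (\<lambda>t. \<beta> (a t) (a t) / w t) \<le> integral {0..1} (\<lambda>t. w t - \<beta> (b t) (b t) / w t)"
      proof (rule integral_le[OF ia integrable_diff[OF wi ib]])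
        show "\<beta> (a t) (a t) / w t \<le> w t - \<beta> (b t) (b t) / w t" for t
          using ww[of t] by (simp add: split add_divide_distrib)
      qed
      also have "\<dots> = W - integral {0..1} (\<lambda>t. \<beta> (b t) (b t) / w t)"
        unfolding W_def by (rule integral_diff[OF wi ib])
      finally have "energy w a \<le> W * (W - integral {0..1} (\<lambda>t. \<beta> (b t) (b t) / w t))"
        unfolding energy_def W_def[symmetric] using W by (intro mult_left_mono) auto
      then show ?thesis using bn by (simp add: power2_eq_square algebra_simps)
    qed
    then have "energy w a' \<le> W\<^sup>2 - (norm k)\<^sup>2 * \<kappa> + K * norm k" using a'(2) by simp
    also have "\<dots> \<le> W\<^sup>2 + K\<^sup>2 / (4 * \<kappa>)"
    proof -
      \<comment> \<open>The linear cost is absorbed by the quadratic gain.\<close>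
      have "0 \<le> (K - 2 * \<kappa> * norm k)\<^sup>2 / (4 * \<kappa>)" using \<kappa>(1) by simp
      also have "\<dots> = K\<^sup>2 / (4 * \<kappa>) - K * norm k + (norm k)\<^sup>2 * \<kappa>"
        using \<kappa>(1) by (simp add: power2_eq_square field_simps)
      finally show ?thesis by simp
    qed
    finally have en: "energy w a' \<le> W\<^sup>2 + K\<^sup>2 / (4 * \<kappa>)" .
    have a'': "a' absolutely_integrable_on {0..1}" "\<And>t. a' t \<in> V" "R a'"
      "(\<lambda>t. \<beta> (a' t) (a' t) / w t) integrable_on {0..1}" using a'(1) by (auto simp: admissible_def)
    have "(integral {0..1} (\<lambda>t. sqrt (\<beta> (a' t) (a' t))))\<^sup>2 \<le> integral {0..1} w * integral {0..1} (\<lambda>t. (sqrt (\<beta> (a' t) (a' t)))\<^sup>2 / w t)"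
      by (rule cauchy_schwarz_weighted[OF _ wi w(2)])
         (use sqrt_\<beta>_absolutely_integrable[OF a''(1)] W a''(4) \<beta>_nonneg in \<open>auto simp: absolutely_integrable_on_def W_def\<close>)
    also have "\<dots> = energy w a'" by (simp add: energy_def \<beta>_nonneg)
    finally have "(integral {0..1} (\<lambda>t. sqrt (\<beta> (a' t) (a' t))))\<^sup>2 \<le> W\<^sup>2 + K\<^sup>2 / (4 * \<kappa>)" using en by simp
    then show "\<exists>v. R v \<and> (\<forall>t. v t \<in> V) \<and>
       (integral {0..1} (\<lambda>t. sqrt (\<beta> (v t) (v t))))\<^sup>2 \<le> (integral {0..1} (\<lambda>t. sqrt (\<beta> (u t) (u t))) + \<epsilon>)\<^sup>2 + K\<^sup>2 / (4 * \<kappa>)"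
      using a''(2,3) WI by auto
  qed
qed

end

section \<open>Inner products on a subspace\<close>

text \<open>A linear choice of the first summand, which preserves measurability and integrability.\<close>

lemma linear_map_into_summands:
  fixes D V Z :: "'e::euclidean_space set"
  assumes D: "subspace D" and V: "subspace V" and Z: "subspace Z"
    and dec: "\<And>u. u \<in> D \<Longrightarrow> \<exists>a. a \<in> V \<and> u - a \<in> Z"
  obtains P where "linear P" "\<And>u. u \<in> D \<Longrightarrow> P u \<in> V" "\<And>u. u \<in> D \<Longrightarrow> u - P u \<in> Z"
proof -
  obtain B where B: "B \<subseteq> D" "independent B" "D \<subseteq> span B"
    using maximal_independent_subset by blast
  obtain f where f: "\<And>u. u \<in> D \<Longrightarrow> f u \<in> V" "\<And>u. u \<in> D \<Longrightarrow> u - f u \<in> Z" using dec by metis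
  obtain P where P: "linear P" "\<And>b. b \<in> B \<Longrightarrow> P b = f b" using linear_independent_extend[OF B(2)] by metis
  have "P u \<in> V \<and> u - P u \<in> Z" if "u \<in> span B" for u
    using that
  proof (induction rule: span_induct)
    show "subspace {u. P u \<in> V \<and> u - P u \<in> Z}"
    proof (rule subspaceI)
      show "0 \<in> {u. P u \<in> V \<and> u - P u \<in> Z}"
        using subspace_0[OF V] subspace_0[OF Z] by (simp add: linear_0[OF P(1)])
      fix x y :: 'e and c :: real
      assume x: "x \<in> {u. P u \<in> V \<and> u - P u \<in> Z}"
      then have x': "P x \<in> V" "x - P x \<in> Z" by auto
      have "c *\<^sub>R x - c *\<^sub>R P x = c *\<^sub>R (x - P x)" by (simp add: scaleR_diff_right)
      then show "c *\<^sub>R x \<in> {u. P u \<in> V \<and> u - P u \<in> Z}"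
        using subspace_scale[OF V x'(1), of c] subspace_scale[OF Z x'(2), of c]
        by (simp only: mem_Collect_eq linear_scale[OF P(1)] simp_thms)
      assume "y \<in> {u. P u \<in> V \<and> u - P u \<in> Z}"
      then have y': "P y \<in> V" "y - P y \<in> Z" by auto
      have "x + y - (P x + P y) = (x - P x) + (y - P y)" by simp
      then show "x + y \<in> {u. P u \<in> V \<and> u - P u \<in> Z}"
        using subspace_add[OF V x'(1) y'(1)] subspace_add[OF Z x'(2) y'(2)]
        by (simp only: mem_Collect_eq linear_add[OF P(1)] simp_thms)
    qed
  qed (use B(1) f P(2) in auto)
  then show thesis using B(3) P(1) by (intro that[of P]) auto
qed

lemma linear_projection_onto_subspace:
  fixes D :: "'e::euclidean_space set"
  assumes D: "subspace D"
  obtains \<pi> where "linear \<pi>" "\<And>u. \<pi> u \<in> D" "\<And>u. u \<in> D \<Longrightarrow> \<pi> u = u"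
proof -
  obtain B where B: "B \<subseteq> D" "pairwise orthogonal B" "\<And>x. x \<in> B \<Longrightarrow> norm x = 1" "independent B" "span B = D"
    using orthonormal_basis_subspace[OF D] by metis
  have fB: "finite B" by (rule independent_imp_finite[OF B(4)])
  show thesis
  proof (rule that[of "\<lambda>u. \<Sum>b\<in>B. (u \<bullet> b) *\<^sub>R b"])
    show "linear (\<lambda>u. \<Sum>b\<in>B. (u \<bullet> b) *\<^sub>R b)"
      by (rule linearI) (simp_all add: inner_add_left scaleR_add_left sum.distrib scaleR_sum_right)
    show "(\<Sum>b\<in>B. (u \<bullet> b) *\<^sub>R b) \<in> D" for u
      by (rule subspace_sum[OF D]) (use B(1) in \<open>auto intro: subspace_scale[OF D]\<close>)
    show "(\<Sum>b\<in>B. (u \<bullet> b) *\<^sub>R b) = u" if "u \<in> D" for u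
      using orthonormal_basis_expand[OF B(2,3) _ fB] B(5) that by simp
  qed
qed

lemma positive_definite_bilinear_lower_bound:
  fixes \<beta> :: "'e::euclidean_space \<Rightarrow> 'e \<Rightarrow> real"
  assumes \<beta>: "bilinear \<beta>" and S: "subspace S" and pos: "\<And>u. u \<in> S \<Longrightarrow> u \<noteq> 0 \<Longrightarrow> 0 < \<beta> u u"
  obtains c where "0 < c" "\<And>u. u \<in> S \<Longrightarrow> c * (norm u)\<^sup>2 \<le> \<beta> u u"
proof (cases "S \<subseteq> {0}")
  case True
  then show thesis using \<beta> by (intro that[of 1]) (auto simp: bilinear_lzero)
next
  case False
  let ?K = "S \<inter> sphere 0 1"
  obtain v where v: "v \<in> S" "v \<noteq> 0" using False by blast
  then have "(1 / norm v) *\<^sub>R v \<in> ?K" using subspace_scale[OF S] by simp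
  then have ne: "?K \<noteq> {}" by blast
  have comp: "compact ?K" using closed_subspace[OF S] by (intro closed_Int_compact) auto
  have "bounded_bilinear \<beta>" using \<beta> by (simp add: bilinear_conv_bounded_bilinear)
  then have "continuous_on ?K (\<lambda>x. \<beta> x x)" by (rule bounded_bilinear.continuous_on) (intro continuous_intros)+
  from continuous_attains_inf[OF comp ne this]
  obtain x where x: "x \<in> ?K" "\<And>y. y \<in> ?K \<Longrightarrow> \<beta> x x \<le> \<beta> y y" by blast
  show thesis
  proof (rule that[of "\<beta> x x"])
    show "0 < \<beta> x x" by (rule pos) (use x(1) in auto)
    fix u assume u: "u \<in> S"
    show "\<beta> x x * (norm u)\<^sup>2 \<le> \<beta> u u"
    proof (cases "u = 0")
      case True
      then show ?thesis using \<beta> by (simp add: bilinear_lzero)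
    next
      case False
      define y where "y = (1 / norm u) *\<^sub>R u"
      have "y \<in> ?K" using u False subspace_scale[OF S] by (simp add: y_def)
      then have "\<beta> x x * (norm u)\<^sup>2 \<le> \<beta> y y * (norm u)\<^sup>2" using x(2) by (intro mult_right_mono) auto
      also have "\<dots> = \<beta> (norm u *\<^sub>R y) (norm u *\<^sub>R y)"
        by (simp add: bilinear_lmul[OF \<beta>] bilinear_rmul[OF \<beta>] power2_eq_square del: scaleR_scaleR)
      also have "norm u *\<^sub>R y = u" using False by (simp add: y_def)
      finally show ?thesis .
    qed
  qed
qed

lemma inner_product_onD:
  assumes "inner_product_on S b"
  shows "u \<in> S \<Longrightarrow> v \<in> S \<Longrightarrow> b u v = b v u"
    "u \<in> S \<Longrightarrow> v \<in> S \<Longrightarrow> w \<in> S \<Longrightarrow> b (u + v) w = b u w + b v w"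
    "u \<in> S \<Longrightarrow> v \<in> S \<Longrightarrow> b (r *\<^sub>R u) v = r * b u v"
    "u \<in> S \<Longrightarrow> u \<noteq> 0 \<Longrightarrow> 0 < b u u"
  using assms by (auto simp: inner_product_on_def)

text \<open>Orthogonal projection by the Gram-Schmidt process, as the inner product is merely a function on \<open>D\<close>.\<close>

lemma inner_product_orthogonal_decomposition:
  assumes b: "inner_product_on D b" and D: "subspace D" and W: "subspace W" "W \<subseteq> (D :: 'e::euclidean_space set)" and u: "u \<in> D"
  shows "\<exists>z\<in>W. \<forall>w\<in>W. b (u - z) w = 0"
proof -
  note sym = inner_product_onD(1)[OF b] and add = inner_product_onD(2)[OF b]
    and scale = inner_product_onD(3)[OF b] and pos = inner_product_onD(4)[OF b]
  have diff: "b (x - y) z = b x z - b y z" if "x \<in> D" "y \<in> D" "z \<in> D" for x y z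
    using add[of x "(-1) *\<^sub>R y" z] scale[of y z "-1"] that subspace_scale[OF D, of y "-1"] by simp
  have "\<exists>z\<in>span B. \<forall>w\<in>span B. b (u - z) w = 0" if "finite B" "B \<subseteq> D" "u \<in> D" for B u
    using that
  proof (induction B arbitrary: u rule: finite_induct)
    case empty
    have "b u 0 = 0" using scale[of 0 u 0] sym[of u 0] empty subspace_0[OF D] by simp
    then show ?case by (intro bexI[of _ 0]) (auto simp: span_empty)
  next
    case (insert e B)
    have sB: "span B \<subseteq> D" "span (insert e B) \<subseteq> D" by (rule span_minimal[OF _ D], use insert.prems in blast)+
    have e: "e \<in> D" using insert.prems by auto
    obtain z1 where z1: "z1 \<in> span B" "\<And>w. w \<in> span B \<Longrightarrow> b (u - z1) w = 0" using insert by blast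
    obtain z2 where z2: "z2 \<in> span B" "\<And>w. w \<in> span B \<Longrightarrow> b (e - z2) w = 0" using insert.IH[of e] insert.prems e by blast
    define e' where "e' = e - z2"
    have e': "e' \<in> D" unfolding e'_def using e z2(1) sB by (intro subspace_diff[OF D]) auto
    have u1: "u - z1 \<in> D" using insert.prems z1(1) sB by (intro subspace_diff[OF D]) auto
    define r where "r = (if e' = 0 then 0 else b (u - z1) e' / b e' e')"
    define z where "z = z1 + r *\<^sub>R e'"
    have re: "b (u - z1) e' = r * b e' e'"
    proof (cases "e' = 0")
      case True
      have "b (u - z1) 0 = 0" using scale[of 0 "u - z1" 0] sym[of "u - z1" 0] u1 subspace_0[OF D] by simp
      moreover have "b 0 0 = 0" using scale[of 0 0 0] subspace_0[OF D] by simp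
      ultimately show ?thesis using True by simp
    next
      case False
      then show ?thesis using pos[of e'] e' by (simp add: r_def)
    qed
    have zs: "z \<in> span (insert e B)"
    proof -
      have "span B \<subseteq> span (insert e B)" by (rule span_mono) auto
      moreover have "e \<in> span (insert e B)" by (rule span_base) simp
      ultimately show ?thesis unfolding z_def e'_def
        using z1(1) z2(1) by (intro span_add span_scale span_diff) auto
    qed
    have eq: "u - z = (u - z1) - r *\<^sub>R e'" by (simp add: z_def)
    have bz: "b (u - z) x = b (u - z1) x - r * b e' x" if "x \<in> D" for x
      unfolding eq using diff[OF u1 subspace_scale[OF D e', of r] that] scale[OF e' that] by simp
    have "b (u - z) w = 0" if w: "w \<in> span (insert e B)" for w
    proof -
      obtain k where k: "w - k *\<^sub>R e \<in> span B" using w span_breakdown_eq by blast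
      define y where "y = w - k *\<^sub>R e + k *\<^sub>R z2"
      have y: "y \<in> span B" unfolding y_def using k z2(1) by (intro span_add span_scale) auto
      have we: "w = y + k *\<^sub>R e'" by (simp add: y_def e'_def algebra_simps)
      have yD: "y \<in> D" using y sB by auto
      have kD: "k *\<^sub>R e' \<in> D" by (rule subspace_scale[OF D e'])
      have rs: "b x w = b x y + k * b x e'" if "x \<in> D" for x
      proof -
        have "b x w = b (y + k *\<^sub>R e') x" using sym[of x w] that yD kD subspace_add[OF D yD kD] we by simp
        also have "\<dots> = b y x + k * b e' x" using add[OF yD kD that] scale[OF e' that] by simp
        finally show ?thesis using sym that yD e' by metis
      qed
      have wD: "w \<in> D" using w sB by auto
      have "b (u - z) w = b (u - z1) w - r * b e' w" by (rule bz[OF wD])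
      also have "\<dots> = (0 + k * (r * b e' e')) - r * (0 + k * b e' e')"
        using rs[OF u1] rs[OF e'] z1(2)[OF y] z2(2)[OF y] re by (simp add: e'_def)
      finally show ?thesis by simp
    qed
    with zs show ?case by blast
  qed
  moreover obtain B where "finite B" "span B = W" "B \<subseteq> W"
    by (metis W(1) basis_exists independent_imp_finite span_eq_iff span_mono span_superset subset_antisym)
  ultimately show ?thesis using W(2) u by blast
qed

lemma square_difference_bound_implies_inverse_bound:
  fixes d d' :: real
  assumes C: "\<bar>d'\<^sup>2 - d\<^sup>2\<bar> \<le> C" and nonneg: "0 \<le> d'" and d: "0 < d"
  shows "\<bar>d' - d\<bar> \<le> C * (1 / d)"
proof -
  have "\<bar>d' - d\<bar> * d \<le> \<bar>d' - d\<bar> * (d' + d)" using nonneg by (intro mult_left_mono) auto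
  also have "\<dots> = \<bar>d'\<^sup>2 - d\<^sup>2\<bar>"
    using nonneg d by (simp add: power2_eq_square square_diff_square_factored abs_mult)
  also have "\<dots> \<le> C" by (rule C)
  finally show ?thesis using d by (simp add: field_simps)
qed

lemma integral_nonneg_pointwise:
  fixes f :: "'a::euclidean_space \<Rightarrow> real"
  assumes "\<And>x. 0 \<le> f x"
  shows "0 \<le> integral S f"
  by (cases "f integrable_on S") (auto simp: not_integrable_integral intro: integral_nonneg assms)

context two_step_lie_group
begin

definition steers :: "'g \<Rightarrow> 'g \<Rightarrow> (real \<Rightarrow> 'e) \<Rightarrow> bool" where
  "steers p q u \<longleftrightarrow> (\<exists>\<gamma>. control \<gamma> u \<and> \<gamma> 0 = p \<and> \<gamma> 1 = q)"

lemma perturbation_closed_steers: "perturbation_closed (lie_bracket A) (steers p q)"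
  unfolding perturbation_closed_def
proof (intro allI impI)
  fix u :: "real \<Rightarrow> 'e" and f :: "real \<Rightarrow> real" and X
  assume "steers p q u" and f: "f absolutely_integrable_on {0..1}" "integral {0..1} f = (0::real)"
  then obtain \<gamma> where \<gamma>: "control \<gamma> u" "\<gamma> 0 = p" "\<gamma> 1 = q" by (auto simp: steers_def)
  obtain \<eta> where \<eta>: "control \<eta> (\<lambda>t. u t - integral {0..t} f *\<^sub>R lie_bracket A X (u t) + f t *\<^sub>R X)"
    "\<eta> 0 = \<gamma> 0" "integral {0..1} f = 0 \<Longrightarrow> \<eta> 1 = \<gamma> 1"
    using control_perturbation[OF \<gamma>(1) f(1), of X] by blast
  then show "steers p q (\<lambda>t. u t - integral {0..t} f *\<^sub>R lie_bracket A X (u t) + f t *\<^sub>R X)"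
    using \<gamma> f(2) by (auto simp: steers_def)
qed

end

section \<open>Comparison of the two distances\<close>

theorem theorem1p1:
  fixes A :: "('g::{group_add, t2_space, second_countable_topology}, 'e::euclidean_space) chart set"
    and \<Delta> :: "'g \<Rightarrow> 'e set"
    and \<rho> :: "'g \<Rightarrow> 'e \<Rightarrow> 'e \<Rightarrow> real"
    and d d_inf :: "'g \<Rightarrow> 'g \<Rightarrow> real"
  assumes "lie_group A"
    and "simply_connected (UNIV :: 'g set)"
    and "two_step_nilpotent A"
    and "sub_riemannian_structure A \<Delta> \<rho>"
    and "d = sr_dist A \<Delta> \<rho>"
    and "d_inf = asymptotic_dist A \<Delta> \<rho>"
  shows "(\<exists>C>0. \<forall>p q. \<bar>(d_inf p q)\<^sup>2 - (d p q)\<^sup>2\<bar> \<le> C) \<and>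
    (\<lambda>(p, q). \<bar>d_inf p q - d p q\<bar>)
       \<in> O[filtercomap (\<lambda>(p, q). d p q) at_top](\<lambda>(p, q). 1 / d p q) \<and>
    ((\<lambda>(p, q). \<bar>d_inf p q - d p q\<bar>) \<longlongrightarrow> 0) (filtercomap (\<lambda>(p, q). d p q) at_top)"
proof -
  interpret two_step_lie_group A by unfold_locales (rule assms)+
  define D where "D = \<Delta> 0"
  define Z where "Z = derived_algebra A"
  define V where "V = asymptotic_space A \<Delta> \<rho>"
  define V' where "V' = asymptotic_bundle A \<Delta> \<rho>"
  let ?b = "\<rho> 0" and ?br = "lie_bracket A"
  note sr = assms(4)[unfolded sub_riemannian_structure_def]
  have sD: "subspace D" and gen: "lie_generated A D = UNIV" and ip: "inner_product_on D ?b"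
    using sr unfolding D_def by blast+
  have \<Delta>: "\<Delta> p = d_left A p 0 ` \<Delta> 0" for p using sr by (metis add.right_neutral)
  have \<rho>: "\<rho> p (d_left A p 0 v) (d_left A p 0 w) = \<rho> 0 v w" if "v \<in> D" "w \<in> D" for p v w
    using sr that unfolding D_def by (metis add.right_neutral)
  note b_sym = inner_product_onD(1)[OF ip] and b_add = inner_product_onD(2)[OF ip]
    and b_scale = inner_product_onD(3)[OF ip] and b_pos = inner_product_onD(4)[OF ip]
  have D0: "0 \<in> D" by (rule subspace_0[OF sD])
  have sZ: "subspace Z" unfolding Z_def bracket_space_def by (rule subspace_span)
  have sW: "subspace (D \<inter> Z)" by (rule subspace_inter[OF sD sZ])
  have V_iff: "v \<in> V \<longleftrightarrow> v \<in> D \<and> (\<forall>w\<in>D \<inter> Z. ?b v w = 0)" for v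
    by (auto simp: V_def asymptotic_space_def D_def Z_def)
  have b0: "?b 0 w = 0" if "w \<in> D" for w using b_scale[of 0 w 0] D0 that by simp
  have sV: "subspace V"
    by (rule subspaceI) (auto simp: V_iff D0 b0 b_add b_scale intro: subspace_add[OF sD] subspace_scale[OF sD])
  have dec: "\<exists>a. a \<in> V \<and> u - a \<in> D \<inter> Z" if u: "u \<in> D" for u
  proof -
    obtain z where z: "z \<in> D \<inter> Z" "\<And>w. w \<in> D \<inter> Z \<Longrightarrow> ?b (u - z) w = 0"
      using inner_product_orthogonal_decomposition[OF ip sD sW _ u] by blast
    have "u - z \<in> V" using z u by (auto simp: V_iff intro: subspace_diff[OF sD])
    then show ?thesis using z(1) by (intro exI[of _ "u - z"]) simp
  qed
  have br_Z: "?br x y \<in> Z" for x y unfolding Z_def by (rule lie_bracket_in_derived)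
  have br_central: "?br x z = 0" if "z \<in> Z" for x z using that unfolding Z_def by (rule lie_bracket_derived)
  have br_central': "?br z x = 0" if "z \<in> Z" for x z using lie_bracket_antisym[of z x] br_central[OF that] by simp
  have sum_all: "\<exists>a z. a \<in> V \<and> z \<in> Z \<and> x = a + z" for x
  proof -
    \<comment> \<open>The sum of \<open>D\<close> and \<open>Z\<close> is closed under brackets and hence everything, as \<open>D\<close> generates the algebra.\<close>
    let ?T = "{x + y |x y. x \<in> D \<and> y \<in> Z}"
    have "subspace ?T" by (rule subspace_sums[OF sD sZ])
    moreover have "D \<subseteq> ?T" using subspace_0[OF sZ] by force
    moreover have "\<forall>v\<in>?T. \<forall>w\<in>?T. ?br v w \<in> ?T" using br_Z D0 by force
    ultimately have "lie_generated A D \<subseteq> ?T" unfolding lie_generated_def by blast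
    then have "x \<in> ?T" using gen by blast
    then obtain u z where u: "u \<in> D" "z \<in> Z" "x = u + z" by blast
    obtain a where a: "a \<in> V" "u - a \<in> D \<inter> Z" using dec[OF u(1)] by blast
    have "(u - a) + z \<in> Z" using a u by (intro subspace_add[OF sZ]) auto
    then show ?thesis using a(1) u(3) by (intro exI[of _ a] exI[of _ "(u - a) + z"]) simp
  qed
  have generate: "Z \<subseteq> span {?br X Y |X Y. X \<in> V \<and> Y \<in> V}"
  proof -
    have "{?br v w |v w. v \<in> UNIV \<and> w \<in> UNIV} \<subseteq> {?br X Y |X Y. X \<in> V \<and> Y \<in> V}"
    proof clarify
      fix v w
      obtain a z where a: "a \<in> V" "z \<in> Z" "v = a + z" using sum_all by blast
      obtain a' z' where a': "a' \<in> V" "z' \<in> Z" "w = a' + z'" using sum_all by blast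
      have "?br v w = ?br a a'"
        using br_central[OF a'(2)] br_central'[OF a(2)]
        by (simp add: a(3) a'(3) bilinear_ladd[OF bilinear_lie_bracket] bilinear_radd[OF bilinear_lie_bracket])
      then show "\<exists>X Y. ?br v w = ?br X Y \<and> X \<in> V \<and> Y \<in> V" using a(1) a'(1) by blast
    qed
    then show ?thesis unfolding Z_def bracket_space_def by (rule span_mono)
  qed
  obtain \<pi> where \<pi>: "linear \<pi>" "\<And>u. \<pi> u \<in> D" "\<And>u. u \<in> D \<Longrightarrow> \<pi> u = u"
    by (rule linear_projection_onto_subspace[OF sD]) (rule that, assumption+)
  \<comment> \<open>The inner product is only meaningful on \<open>D\<close>; composing with a projection makes it bilinear on the whole space.\<close>
  define \<beta> where "\<beta> u v = ?b (\<pi> u) (\<pi> v)" for u v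
  have \<beta>_sym: "\<beta> x y = \<beta> y x" for x y unfolding \<beta>_def using b_sym \<pi>(2) by blast
  have \<beta>_D: "\<beta> x y = ?b x y" if "x \<in> D" "y \<in> D" for x y using that by (simp add: \<beta>_def \<pi>(3))
  have lin1: "linear (\<lambda>x. \<beta> x y)" for y
    by (rule linearI) (simp_all add: \<beta>_def linear_add[OF \<pi>(1)] linear_scale[OF \<pi>(1)] b_add b_scale \<pi>(2))
  have lin2: "linear (\<beta> x)" for x using lin1[of x] by (simp add: \<beta>_sym[of _ x])
  have bil: "bilinear \<beta>" using lin1 lin2 by (simp add: bilinear_def)
  have \<beta>_nonneg: "0 \<le> \<beta> x x" for x
    using b_pos[of "\<pi> x"] b0[OF D0] \<pi>(2)[of x] by (cases "\<pi> x = 0") (auto simp: \<beta>_def less_imp_le)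
  interpret tc: two_step_control ?br Z V \<beta>
    by unfold_locales (fact bilinear_lie_bracket lie_bracket_antisym br_Z br_central sZ sV bil \<beta>_sym \<beta>_nonneg generate)+
  obtain P where P: "linear P" "\<And>u. u \<in> D \<Longrightarrow> P u \<in> V" "\<And>u. u \<in> D \<Longrightarrow> u - P u \<in> D \<inter> Z"
    by (rule linear_map_into_summands[OF sD sV sW dec]) (assumption, rule that, assumption+)
  obtain c where c: "0 < c" "\<And>u. u \<in> D \<Longrightarrow> c * (norm u)\<^sup>2 \<le> \<beta> u u"
  proof (rule positive_definite_bilinear_lower_bound[OF bil sD])
    show "0 < \<beta> u u" if "u \<in> D" "u \<noteq> 0" for u using b_pos[of u] that by (simp add: \<beta>_D)
  qed (rule that, assumption+)
  have orth: "\<beta> (P u) (u - P u) = 0" if "u \<in> D" for u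
    using P(2)[OF that] P(3)[OF that] by (auto simp: V_iff \<beta>_D)
  obtain C where C: "0 \<le> C" "\<And>R u \<epsilon>. perturbation_closed ?br R \<Longrightarrow> R u \<Longrightarrow> u absolutely_integrable_on {0..1} \<Longrightarrow>
     (\<And>t. u t \<in> D) \<Longrightarrow> 0 < \<epsilon> \<Longrightarrow> \<exists>v. R v \<and> (\<forall>t. v t \<in> V) \<and>
       (integral {0..1} (\<lambda>t. sqrt (\<beta> (v t) (v t))))\<^sup>2 \<le> (integral {0..1} (\<lambda>t. sqrt (\<beta> (u t) (u t))) + \<epsilon>)\<^sup>2 + C"
  proof (rule tc.replace_control[where D = D and P = P and \<kappa> = c])
    show "linear P" by (rule P(1))
    show "P u \<in> V" if "u \<in> D" for u using P(2)[OF that] .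
    show "u - P u \<in> Z" if "u \<in> D" for u using P(3)[OF that] by blast
    show "\<beta> (P u) (u - P u) = 0" if "u \<in> D" for u using orth[OF that] .
    show "0 < c" by (rule c(1))
    show "c * (norm (u - P u))\<^sup>2 \<le> \<beta> (u - P u) (u - P u)" if "u \<in> D" for u using P(3)[OF that] by (intro c(2)) blast
    fix K :: real
    assume K: "0 \<le> K" "\<And>R u \<epsilon>. perturbation_closed ?br R \<Longrightarrow> R u \<Longrightarrow> u absolutely_integrable_on {0..1} \<Longrightarrow>
     (\<And>t. u t \<in> D) \<Longrightarrow> 0 < \<epsilon> \<Longrightarrow> \<exists>v. R v \<and> (\<forall>t. v t \<in> V) \<and>
       (integral {0..1} (\<lambda>t. sqrt (\<beta> (v t) (v t))))\<^sup>2 \<le> (integral {0..1} (\<lambda>t. sqrt (\<beta> (u t) (u t))) + \<epsilon>)\<^sup>2 + K"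
    show thesis by (rule that[OF K])
  qed
  define SD where "SD p q = {curve_length A \<rho> \<gamma> |\<gamma>. horizontal A \<Delta> \<gamma> \<and> p \<in> \<gamma> ` {0..1} \<and> q \<in> \<gamma> ` {0..1}}" for p q
  define SV where "SV p q = {curve_length A \<rho> \<gamma> |\<gamma>. horizontal A V' \<gamma> \<and> p \<in> \<gamma> ` {0..1} \<and> q \<in> \<gamma> ` {0..1}}" for p q
  have d: "d p q = Inf (SD p q)" "d_inf p q = Inf (SV p q)" for p q
    by (simp_all add: assms(5,6) sr_dist_def asymptotic_dist_def SD_def SV_def V'_def)
  have VD: "V \<subseteq> D" by (auto simp: V_iff)
  have V'0: "V' 0 = V" by (auto simp: V'_def asymptotic_bundle_def V_def d_left_0)
  have V': "V' p = d_left A p 0 ` V' 0" for p by (simp add: V'0) (simp add: V'_def asymptotic_bundle_def V_def)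
  have "V' p \<subseteq> \<Delta> p" for p
    unfolding V'[of p] \<Delta>[of p] V'0 using VD by (auto simp: D_def)
  then have sub: "SV p q \<subseteq> SD p q" for p q
    unfolding SV_def SD_def horizontal_def by (fastforce elim!: eventually_mono)
  have nonneg: "0 \<le> L" if "L \<in> SD p q" for L p q
  proof -
    obtain \<gamma> where \<gamma>: "horizontal A \<Delta> \<gamma>" "L = curve_length A \<rho> \<gamma>" using \<open>L \<in> SD p q\<close> unfolding SD_def by blast
    obtain u where u: "control \<gamma> u" "\<And>t. u t \<in> \<Delta> 0" "curve_length A \<rho> \<gamma> = integral {0..1} (\<lambda>t. sqrt (\<rho> 0 (u t) (u t)))"
      by (rule horizontal_imp_control[OF \<Delta> _ _ \<gamma>(1), of \<rho>]) (use D0 \<rho> in \<open>auto simp: D_def\<close>)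
    have "0 \<le> sqrt (\<rho> 0 (u t) (u t))" for t
      using \<beta>_nonneg[of "u t"] \<beta>_D[of "u t" "u t"] u(2)[of t] by (simp add: D_def)
    then show ?thesis unfolding \<gamma>(2) u(3) by (rule integral_nonneg_pointwise) 
  qed
  have SD_sym: "SD p q = SD q p" "SV p q = SV q p" for p q by (auto simp: SD_def SV_def)
  have key: "\<exists>L'\<in>SV p q. L'\<^sup>2 \<le> (L + \<epsilon>)\<^sup>2 + C"
    if \<gamma>: "horizontal A \<Delta> \<gamma>" "L = curve_length A \<rho> \<gamma>" and s: "0 \<le> s1" "s1 \<le> s2" "s2 \<le> 1" "\<gamma> s1 = p" "\<gamma> s2 = q"
      and \<epsilon>: "0 < \<epsilon>" for \<gamma> L s1 s2 p q \<epsilon>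
  proof -
    obtain u where u: "control \<gamma> u" "\<And>t. u t \<in> \<Delta> 0" "curve_length A \<rho> \<gamma> = integral {0..1} (\<lambda>t. sqrt (\<rho> 0 (u t) (u t)))"
      by (rule horizontal_imp_control[OF \<Delta> _ _ \<gamma>(1), of \<rho>]) (use D0 \<rho> in \<open>auto simp: D_def\<close>)
    have uD: "u t \<in> D" for t using u(2) by (simp add: D_def)
    define u' where "u' t = (if t \<in> {s1..s2} then u t else 0)" for t
    have c': "control (\<lambda>t. \<gamma> (max s1 (min s2 t))) u'"
      unfolding u'_def by (rule control_clamp[OF u(1) s(1-3)])
    have "max s1 (min s2 0) = s1" "max s1 (min s2 1) = s2" using s(1-3) by auto
    then have st: "steers p q u'" using c' s(4,5) unfolding steers_def by (intro exI[of _ "\<lambda>t. \<gamma> (max s1 (min s2 t))"]) simp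
    have u'D: "u' t \<in> D" for t using uD D0 by (simp add: u'_def)
    have u'int: "u' absolutely_integrable_on {0..1}" by (rule control_absolutely_integrable[OF c'])
    have len: "integral {0..1} (\<lambda>t. sqrt (\<beta> (u' t) (u' t))) \<le> L"
    proof -
      have "integral {0..1} (\<lambda>t. sqrt (\<beta> (u' t) (u' t))) \<le> integral {0..1} (\<lambda>t. sqrt (\<beta> (u t) (u t)))"
      proof (rule integral_le)
        show "(\<lambda>t. sqrt (\<beta> (u' t) (u' t))) integrable_on {0..1}" "(\<lambda>t. sqrt (\<beta> (u t) (u t))) integrable_on {0..1}"
          using tc.sqrt_\<beta>_absolutely_integrable[OF u'int] tc.sqrt_\<beta>_absolutely_integrable[OF control_absolutely_integrable[OF u(1)]]
          by (simp_all add: absolutely_integrable_on_def)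
        show "sqrt (\<beta> (u' t) (u' t)) \<le> sqrt (\<beta> (u t) (u t))" for t
          using \<beta>_nonneg[of "u t"] \<beta>_D[OF D0 D0] b0[OF D0] by (simp add: u'_def)
      qed
      also have "\<dots> = L" unfolding \<gamma>(2) u(3) by (simp add: \<beta>_D uD)
      finally show ?thesis .
    qed
    obtain v where v: "steers p q v" "\<And>t. v t \<in> V"
      "(integral {0..1} (\<lambda>t. sqrt (\<beta> (v t) (v t))))\<^sup>2 \<le> (integral {0..1} (\<lambda>t. sqrt (\<beta> (u' t) (u' t))) + \<epsilon>)\<^sup>2 + C"
      using C(2)[OF perturbation_closed_steers st u'int u'D \<epsilon>] by blast
    obtain \<eta> where \<eta>: "control \<eta> v" "\<eta> 0 = p" "\<eta> 1 = q" using v(1) by (auto simp: steers_def)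
    have vV': "v t \<in> V' 0" for t using v(2) by (simp add: V'0)
    have rV: "\<rho> g (d_left A g 0 x) (d_left A g 0 y) = \<rho> 0 x y" if "x \<in> V' 0" "y \<in> V' 0" for g x y
      using that VD by (intro \<rho>) (auto simp: V'0)
    have h: "horizontal A V' \<eta>" "curve_length A \<rho> \<eta> = integral {0..1} (\<lambda>t. sqrt (\<rho> 0 (v t) (v t)))"
      by (rule control_imp_horizontal[where D = V' and u = v and \<gamma> = \<eta> and \<rho> = \<rho>]; fact V' rV \<eta>(1) vV')+
    have "curve_length A \<rho> \<eta> \<in> SV p q"
      unfolding SV_def using h(1) \<eta>(2,3) by (intro CollectI exI[of _ \<eta>]) auto
    moreover have "(curve_length A \<rho> \<eta>)\<^sup>2 \<le> (L + \<epsilon>)\<^sup>2 + C"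
    proof -
      have "curve_length A \<rho> \<eta> = integral {0..1} (\<lambda>t. sqrt (\<beta> (v t) (v t)))"
        unfolding h(2) using v(2) VD by (simp add: \<beta>_D subset_iff)
      moreover have "(integral {0..1} (\<lambda>t. sqrt (\<beta> (u' t) (u' t))) + \<epsilon>)\<^sup>2 \<le> (L + \<epsilon>)\<^sup>2"
        using len \<epsilon> by (intro power_mono add_mono add_nonneg_nonneg integral_nonneg_pointwise) (auto simp: \<beta>_nonneg)
      ultimately show ?thesis using v(3) by simp
    qed
    ultimately show ?thesis by blast
  qed
  have replace: "\<exists>L'\<in>SV p q. L'\<^sup>2 \<le> (L + \<epsilon>)\<^sup>2 + C" if L: "L \<in> SD p q" and \<epsilon>: "0 < \<epsilon>" for L p q \<epsilon>
  proof -
    obtain \<gamma> s1 s2 where \<gamma>: "horizontal A \<Delta> \<gamma>" "L = curve_length A \<rho> \<gamma>" "s1 \<in> {0..1}" "s2 \<in> {0..1}" "\<gamma> s1 = p" "\<gamma> s2 = q"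
      using L unfolding SD_def by blast
    show ?thesis
    proof (cases "s1 \<le> s2")
      case True
      then show ?thesis using \<gamma> by (intro key[OF \<gamma>(1,2) _ _ _ _ _ \<epsilon>, of s1 s2]) auto
    next
      case False
      then show ?thesis unfolding SD_sym(2)[of p q] using \<gamma> by (intro key[OF \<gamma>(1,2) _ _ _ _ _ \<epsilon>, of s2 s1]) auto
    qed
  qed
  \<comment> \<open>If no horizontal curve passes through both points then both distances are the infimum of the empty set.\<close>
  have compare: "(d p q = d_inf p q) \<or> (0 \<le> d p q \<and> d p q \<le> d_inf p q \<and> (d_inf p q)\<^sup>2 \<le> (d p q)\<^sup>2 + C)" for p q
  proof (cases "SD p q = {}")
    case True
    then have "SV p q = {}" using sub[of p q] by blast
    then show ?thesis using True by (simp add: d)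
  next
    case False
    then obtain L where "L \<in> SD p q" by blast
    then have ne: "SV p q \<noteq> {}" using replace[of L p q 1] by auto
    have bdd: "bdd_below (SD p q)" "bdd_below (SV p q)"
      using nonneg sub[of p q] by (auto intro!: bdd_belowI[of _ 0])
    have 0: "0 \<le> d p q" unfolding d by (rule cInf_greatest[OF False nonneg])
    have 1: "d p q \<le> d_inf p q" unfolding d by (rule cInf_superset_mono[OF ne bdd(1) sub])
    have 2: "(d_inf p q)\<^sup>2 \<le> (d p q)\<^sup>2 + C"
    proof (rule ccontr)
      assume "\<not> (d_inf p q)\<^sup>2 \<le> (d p q)\<^sup>2 + C"
      then have big: "(d p q)\<^sup>2 < (d_inf p q)\<^sup>2 - C" by simp
      define r where "r = sqrt ((d_inf p q)\<^sup>2 - C)"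
      have r: "d p q < r" unfolding r_def using big 0 by (simp add: real_less_rsqrt)
      have "0 \<le> (d_inf p q)\<^sup>2 - C" using big zero_le_power2[of "d p q"] by linarith
      then have r2: "r\<^sup>2 = (d_inf p q)\<^sup>2 - C" unfolding r_def by (rule real_sqrt_pow2)
      obtain L where L: "L \<in> SD p q" "L < (d p q + r) / 2"
        using cInf_lessD[OF False, of "(d p q + r) / 2"] r d(1)[of p q] by auto
      define \<epsilon> where "\<epsilon> = (r - d p q) / 4"
      have \<epsilon>: "0 < \<epsilon>" using r by (simp add: \<epsilon>_def)
      obtain L' where L': "L' \<in> SV p q" "L'\<^sup>2 \<le> (L + \<epsilon>)\<^sup>2 + C" using replace[OF L(1) \<epsilon>] by blast
      have "L + \<epsilon> < r" using L(2) r by (simp add: \<epsilon>_def field_simps)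
      then have "(L + \<epsilon>)\<^sup>2 < r\<^sup>2" using nonneg[OF L(1)] \<epsilon> by (intro power_strict_mono) auto
      moreover have "d_inf p q \<le> L'" unfolding d by (rule cInf_lower[OF L'(1) bdd(2)])
      then have "(d_inf p q)\<^sup>2 \<le> L'\<^sup>2" using 0 1 by (intro power_mono) auto
      ultimately show False using L'(2) r2 by simp
    qed
    show ?thesis using 0 1 2 by simp
  qed
  have bound: "\<bar>(d_inf p q)\<^sup>2 - (d p q)\<^sup>2\<bar> \<le> C + 1" for p q
  proof -
    have "(d p q)\<^sup>2 \<le> (d_inf p q)\<^sup>2 \<and> (d_inf p q)\<^sup>2 \<le> (d p q)\<^sup>2 + C"
      using compare[of p q] C(1) by (auto intro: power_mono)
    then show ?thesis using C(1) by simp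
  qed
  have bound': "\<bar>d_inf p q - d p q\<bar> \<le> (C + 1) * (1 / d p q)" if "0 < d p q" for p q
    using compare[of p q]
  proof
    assume "d p q = d_inf p q"
    then show ?thesis using that C(1) by simp
  next
    assume "0 \<le> d p q \<and> d p q \<le> d_inf p q \<and> (d_inf p q)\<^sup>2 \<le> (d p q)\<^sup>2 + C"
    then show ?thesis by (intro square_difference_bound_implies_inverse_bound[OF bound _ that]) auto
  qed
  let ?F = "filtercomap (\<lambda>(p, q). d p q) at_top"
  have ev: "\<forall>\<^sub>F x in ?F. norm (case x of (p, q) \<Rightarrow> \<bar>d_inf p q - d p q\<bar>) \<le> (C + 1) * norm (case x of (p, q) \<Rightarrow> 1 / d p q)"
    unfolding eventually_filtercomap_at_top_linorder
  proof (intro exI[of _ 1] allI impI)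
    fix x :: "'g \<times> 'g" assume x: "1 \<le> (case x of (p, q) \<Rightarrow> d p q)"
    obtain p q where "x = (p, q)" by (cases x)
    with x bound'[of p q] show "norm (case x of (p, q) \<Rightarrow> \<bar>d_inf p q - d p q\<bar>) \<le> (C + 1) * norm (case x of (p, q) \<Rightarrow> 1 / d p q)"
      by simp
  qed
  have "filterlim (\<lambda>(p, q). d p q) at_top ?F" by (rule filterlim_filtercomap)
  then have "((\<lambda>x. inverse (case x of (p, q) \<Rightarrow> d p q)) \<longlongrightarrow> 0) ?F" by (rule tendsto_inverse_0_at_top)
  then have inv: "((\<lambda>x. case x of (p, q) \<Rightarrow> 1 / d p q) \<longlongrightarrow> 0) ?F"
    by (simp add: split_beta inverse_eq_divide)
  have "((\<lambda>(p, q). \<bar>d_inf p q - d p q\<bar>) \<longlongrightarrow> 0) ?F"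
  proof (rule Lim_null_comparison[OF ev])
    have "((\<lambda>x. (C + 1) * norm (case x of (p, q) \<Rightarrow> 1 / d p q)) \<longlongrightarrow> (C + 1) * norm (0 :: real)) ?F"
      by (intro tendsto_intros inv)
    then show "((\<lambda>x. (C + 1) * norm (case x of (p, q) \<Rightarrow> 1 / d p q)) \<longlongrightarrow> 0) ?F" by simp
  qed
  moreover have "(\<lambda>(p, q). \<bar>d_inf p q - d p q\<bar>) \<in> O[?F](\<lambda>(p, q). 1 / d p q)"
    by (rule bigoI[OF ev])
  moreover have "\<exists>C>0. \<forall>p q. \<bar>(d_inf p q)\<^sup>2 - (d p q)\<^sup>2\<bar> \<le> C"
    using bound C(1) by (intro exI[of _ "C + 1"]) simp
  ultimately show ?thesis by blast
qed

end
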